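(* Let $K$ be a number field and let $(\mathcal{O};\mathfrak{m},\Sigma)$ and $(\mathcal{O}';\mathfrak{m}',\Sigma')$ be level data for $K$ with $\mathcal{O}\subseteq\mathcal{O}'$, $\mathfrak{m}\mathcal{O}'\subseteq\mathfrak{m}'$ and $\Sigma\supseteq\Sigma'$. Let $\mathfrak{d}$ be any $\mathcal{O}'$-ideal with $\mathfrak{d}\subseteq(\mathfrak{m}:\mathcal{O}')$. Then there is an exact sequence $$1\to\frac{U_{\mathfrak{m}',\Sigma'}(\mathcal{O}')}{U_{\mathfrak{m},\Sigma}(\mathcal{O})}\to\frac{U_{\mathfrak{m}'}(\mathcal{O}'/\mathfrak{d})}{U_{\mathfrak{m}}(\mathcal{O}/\mathfrak{d})}\times\{\pm1\}^{|\Sigma\setminus\Sigma'|}\to\mathrm{Cl}_{\mathfrak{m},\Sigma}(\mathcal{O})\to\mathrm{Cl}_{\mathfrak{m}',\Sigma'}(\mathcal{O}')\to1.$$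
   Context: A level datum $(\mathcal{O};\mathfrak{m},\Sigma)$ for $K$ consists of an order $\mathcal{O}$ of $K$ (subring containing 1, free $\mathbb Z$-module of rank $[K:\mathbb Q]$), a nonzero integral $\mathcal{O}$-ideal $\mathfrak{m}$ and a set $\Sigma$ of real embeddings of $K$. $(\mathfrak a:\mathfrak b)=\{x\in K: x\mathfrak b\subseteq\mathfrak a\}$. For a commutative ring $R$ and ideal $I$: $U_I(R)=\{\alpha\in R^\times:\alpha\equiv1\pmod I\}$, and if $R\subseteq K$, $U_{I,\Sigma}(R)=\{\alpha\in U_I(R):\rho(\alpha)>0\ \forall\rho\in\Sigma\}$; when an ideal $I$ of a ring $R_1$ is used with a ring $R_2$ receiving a natural map from $R_1$, $U_I(R_2)$ means $U_{IR_2}(R_2)$ (so $U_{\mathfrak m'}(\mathcal O'/\mathfrak d)$ is the group of units of $\mathcal O'/\mathfrak d$ congruent to $1$ modulo the image of $\mathfrak m'$; note $\mathfrak d$ is also an $\mathcal O$-ideal). The quotients are taken via the natural inclusions/maps. Fractional $\mathcal{O}$-ideal: $\mathcal O$-submodule $\mathfrak a\subseteq K$ with $\lambda\mathfrak a\subseteq\mathcal O$ for some $\lambda\in K^\times$; invertible if $\mathfrak a\mathfrak b=\mathcal O$ for some fractional $\mathfrak b$; coprime to integral $\mathfrak c$ if $\mathfrak a=(\mathfrak a_1:\mathfrak b_1)$ with $\mathfrak a_1$ integral and $\mathfrak b_1$ invertible integral, each with sum with $\mathfrak c$ equal to $\mathcal O$. $J^*_{\mathfrak m}(\mathcal O)$: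 group of invertible fractional ideals coprime to $\mathfrak m$. For $\alpha\in K$, $\alpha\equiv1\pmod{\mathfrak m}$ means $\alpha-1\in\mathfrak m\mathcal O[S_{\mathfrak m}^{-1}]$ with $S_{\mathfrak m}=\{a\in\mathcal O:a\mathcal O+\mathfrak m=\mathcal O\}$. $P_{\mathfrak m,\Sigma}(\mathcal O)=\{\alpha\mathcal O:\alpha\in K^\times,\alpha\equiv1\pmod{\mathfrak m},\rho(\alpha)>0\ \forall\rho\in\Sigma\}$; ray class group $\mathrm{Cl}_{\mathfrak m,\Sigma}(\mathcal O)=J^*_{\mathfrak m}(\mathcal O)/P_{\mathfrak m,\Sigma}(\mathcal O)$.
   Formalization: The ideal d is required to be nonzero; for d = 0 the sequence can fail, e.g. K = Q, both orders Z, m = 5Z, m' = Z, and Σ, Σ' empty, where Cl of modulus 5 has order 2 but the middle map would have to be trivial. *)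

theory Defs
  imports Complex_Main "HOL-Algebra.Coset"
begin

text \<open>The number field K is modelled as a type 'k of characteristic 0 (so it contains Q via
  of_rat) that is finite dimensional over Q. Orders, ideals, fractional ideals are subsets of 'k.\<close>

definition qspan :: "(nat \<Rightarrow> 'k::field_char_0) \<Rightarrow> nat \<Rightarrow> 'k set" where
  "qspan b n = {x. \<exists>c::nat \<Rightarrow> rat. x = (\<Sum>i<n. of_rat (c i) * b i)}"

definition qindep :: "(nat \<Rightarrow> 'k::field_char_0) \<Rightarrow> nat \<Rightarrow> bool" where
  "qindep b n \<longleftrightarrow> (\<forall>c::nat \<Rightarrow> rat. (\<Sum>i<n. of_rat (c i) * b i) = 0 \<longrightarrow> (\<forall>i<n. c i = 0))"

definition zspan :: "(nat \<Rightarrow> 'k::field_char_0) \<Rightarrow> nat \<Rightarrow> 'k set" where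
  "zspan b n = {x. \<exists>c::nat \<Rightarrow> int. x = (\<Sum>i<n. of_int (c i) * b i)}"

definition zindep :: "(nat \<Rightarrow> 'k::field_char_0) \<Rightarrow> nat \<Rightarrow> bool" where
  "zindep b n \<longleftrightarrow> (\<forall>c::nat \<Rightarrow> int. (\<Sum>i<n. of_int (c i) * b i) = 0 \<longrightarrow> (\<forall>i<n. c i = 0))"

definition number_field :: "'k::field_char_0 itself \<Rightarrow> bool" where
  "number_field _ \<longleftrightarrow> (\<exists>n (b :: nat \<Rightarrow> 'k). qindep b n \<and> qspan b n = UNIV)"

definition field_degree :: "'k::field_char_0 itself \<Rightarrow> nat" where
  "field_degree _ = (THE n. \<exists>b :: nat \<Rightarrow> 'k. qindep b n \<and> qspan b n = UNIV)"

definition nf_order :: "'k::field_char_0 set \<Rightarrow> bool" where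
  "nf_order Rg \<longleftrightarrow> 1 \<in> Rg \<and> (\<forall>x\<in>Rg. \<forall>y\<in>Rg. x + y \<in> Rg \<and> x * y \<in> Rg \<and> - x \<in> Rg) \<and>
     (\<exists>b. (\<forall>i<field_degree TYPE('k). b i \<in> Rg) \<and> zindep b (field_degree TYPE('k))
          \<and> Rg = zspan b (field_degree TYPE('k)))"

definition is_ideal :: "'k::field set \<Rightarrow> 'k set \<Rightarrow> bool" where
  "is_ideal R I \<longleftrightarrow> I \<subseteq> R \<and> 0 \<in> I \<and> (\<forall>x\<in>I. \<forall>y\<in>I. x + y \<in> I) \<and> (\<forall>a\<in>R. \<forall>x\<in>I. a * x \<in> I)"

definition mprod :: "'k::field set \<Rightarrow> 'k set \<Rightarrow> 'k set" where
  "mprod A B = {x. \<exists>(n::nat) f g. (\<forall>i<n. f i \<in> A \<and> g i \<in> B) \<and> x = (\<Sum>i<n. f i * g i)}"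

definition isum :: "'k::field set \<Rightarrow> 'k set \<Rightarrow> 'k set" where
  "isum A B = {a + b | a b. a \<in> A \<and> b \<in> B}"

definition colon :: "'k::field set \<Rightarrow> 'k set \<Rightarrow> 'k set" where
  "colon A B = {x. \<forall>y\<in>B. x * y \<in> A}"

definition real_emb :: "('k::field \<Rightarrow> real) \<Rightarrow> bool" where
  "real_emb \<rho> \<longleftrightarrow> \<rho> 1 = 1 \<and> (\<forall>x y. \<rho> (x + y) = \<rho> x + \<rho> y \<and> \<rho> (x * y) = \<rho> x * \<rho> y)"

definition level_datum :: "'k::field_char_0 set \<Rightarrow> 'k set \<Rightarrow> ('k \<Rightarrow> real) set \<Rightarrow> bool" where
  "level_datum Rg m \<Sigma> \<longleftrightarrow> nf_order Rg \<and> is_ideal Rg m \<and> m \<noteq> {0} \<and> (\<forall>\<rho>\<in>\<Sigma>. real_emb \<rho>)"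

definition Ugrp_set :: "'k::field set \<Rightarrow> 'k set \<Rightarrow> ('k \<Rightarrow> real) set \<Rightarrow> 'k set" where
  "Ugrp_set R m \<Sigma> = {a \<in> R. a \<noteq> 0 \<and> inverse a \<in> R \<and> a - 1 \<in> m \<and> (\<forall>\<rho>\<in>\<Sigma>. \<rho> a > 0)}"

definition kgrp :: "'k::field set \<Rightarrow> 'k monoid" where
  "kgrp S = \<lparr>carrier = S, monoid.mult = (*), one = 1\<rparr>"

definition rcls :: "'k::field set \<Rightarrow> 'k \<Rightarrow> 'k set" where
  "rcls d x = (\<lambda>e. x + e) ` d"

text \<open>U_I(R/d): classes of units of R/d congruent to 1 modulo the image (I + d)/d of I.\<close>
definition resU :: "'k::field set \<Rightarrow> 'k set \<Rightarrow> 'k set \<Rightarrow> 'k set set" where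
  "resU R d I = {rcls d x | x. x \<in> R \<and> (\<exists>y\<in>R. x * y - 1 \<in> d) \<and> x - 1 \<in> isum I d}"

definition resgrp :: "'k::field set \<Rightarrow> 'k set set \<Rightarrow> 'k set monoid" where
  "resgrp d S = \<lparr>carrier = S,
      monoid.mult = (\<lambda>A B. {a * b + e | a b e. a \<in> A \<and> b \<in> B \<and> e \<in> d}),
      one = rcls d 1\<rparr>"

definition sign_grp :: "('k \<Rightarrow> real) set \<Rightarrow> (('k \<Rightarrow> real) \<Rightarrow> real) monoid" where
  "sign_grp T = \<lparr>carrier = {f. (\<forall>\<rho>\<in>T. f \<rho> = 1 \<or> f \<rho> = -1) \<and> (\<forall>\<rho>. \<rho> \<notin> T \<longrightarrow> f \<rho> = 1)},
      monoid.mult = (\<lambda>f g \<rho>. f \<rho> * g \<rho>), one = (\<lambda>_. 1)\<rparr>"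

definition frac_ideal :: "'k::field set \<Rightarrow> 'k set \<Rightarrow> bool" where
  "frac_ideal Rg a \<longleftrightarrow> 0 \<in> a \<and> (\<forall>x\<in>a. \<forall>y\<in>a. x + y \<in> a) \<and> (\<forall>r\<in>Rg. \<forall>x\<in>a. r * x \<in> a)
     \<and> (\<exists>l. l \<noteq> 0 \<and> (\<lambda>x. l * x) ` a \<subseteq> Rg)"

definition invertible_fi :: "'k::field set \<Rightarrow> 'k set \<Rightarrow> bool" where
  "invertible_fi Rg a \<longleftrightarrow> (\<exists>b. frac_ideal Rg b \<and> mprod a b = Rg)"

definition coprime_fi :: "'k::field set \<Rightarrow> 'k set \<Rightarrow> 'k set \<Rightarrow> bool" where
  "coprime_fi Rg a c \<longleftrightarrow> (\<exists>a1 b1. a = colon a1 b1 \<and> is_ideal Rg a1 \<and> is_ideal Rg b1 \<and>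
     invertible_fi Rg b1 \<and> isum a1 c = Rg \<and> isum b1 c = Rg)"

definition Jstar :: "'k::field set \<Rightarrow> 'k set \<Rightarrow> 'k set set" where
  "Jstar Rg m = {a. frac_ideal Rg a \<and> invertible_fi Rg a \<and> coprime_fi Rg a m}"

definition ideal_grp :: "'k::field set \<Rightarrow> 'k set \<Rightarrow> 'k set monoid" where
  "ideal_grp Rg m = \<lparr>carrier = Jstar Rg m, monoid.mult = mprod, one = Rg\<rparr>"

definition Sm :: "'k::field set \<Rightarrow> 'k set \<Rightarrow> 'k set" where
  "Sm Rg m = {a \<in> Rg. isum ((\<lambda>x. a * x) ` Rg) m = Rg}"

definition localize :: "'k::field set \<Rightarrow> 'k set \<Rightarrow> 'k set" where
  "localize Rg S = {a / s | a s. a \<in> Rg \<and> s \<in> S}"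

definition cong1 :: "'k::field set \<Rightarrow> 'k set \<Rightarrow> 'k \<Rightarrow> bool" where
  "cong1 Rg m \<alpha> \<longleftrightarrow> \<alpha> - 1 \<in> mprod m (localize Rg (Sm Rg m))"

definition Pray :: "'k::field set \<Rightarrow> 'k set \<Rightarrow> ('k \<Rightarrow> real) set \<Rightarrow> 'k set set" where
  "Pray Rg m \<Sigma> = {(\<lambda>x. \<alpha> * x) ` Rg | \<alpha>. \<alpha> \<noteq> 0 \<and> cong1 Rg m \<alpha> \<and> (\<forall>\<rho>\<in>\<Sigma>. \<rho> \<alpha> > 0)}"

definition ray_class_group :: "'k::field set \<Rightarrow> 'k set \<Rightarrow> ('k \<Rightarrow> real) set \<Rightarrow> 'k set set monoid" where
  "ray_class_group Rg m \<Sigma> = ideal_grp Rg m Mod Pray Rg m \<Sigma>"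

definition unit_map ::
  "'k::field set \<Rightarrow> 'k set \<Rightarrow> 'k set \<Rightarrow> 'k set \<Rightarrow> 'k set \<Rightarrow> ('k \<Rightarrow> real) set \<Rightarrow> ('k \<Rightarrow> real) set \<Rightarrow>
   'k set \<Rightarrow> 'k set set \<times> (('k \<Rightarrow> real) \<Rightarrow> real)" where
  "unit_map Rg' m' Rg m d \<Sigma> \<Sigma>' C = (let x = (SOME x. x \<in> C) in
      (resU Rg d m #>\<^bsub>resgrp d (resU Rg' d m')\<^esub> rcls d x,
       (\<lambda>\<rho>. if \<rho> \<in> \<Sigma> - \<Sigma>' then sgn (\<rho> x) else 1)))"

definition ext_map ::
  "'k::field set \<Rightarrow> 'k set \<Rightarrow> ('k \<Rightarrow> real) set \<Rightarrow> 'k set set \<Rightarrow> 'k set set" where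
  "ext_map Rg' m' \<Sigma>' C = Pray Rg' m' \<Sigma>' #>\<^bsub>ideal_grp Rg' m'\<^esub> mprod (SOME a. a \<in> C) Rg'"

end

theory Submission
  imports Defs
begin

text \<open>
  Everything is parametrised by the multiplicative set \<open>gens\<close> of those nonzero \<open>\<alpha> \<in> Ok'\<close> that are
  units modulo \<open>d\<close>, congruent to 1 modulo \<open>m'\<close> and positive on \<open>\<Sigma>'\<close>. Density of a number field in the
  product of its real completions makes \<open>\<alpha> \<mapsto> (\<alpha> mod d, signs of \<alpha>)\<close> a surjection onto the second
  group, and \<open>\<alpha> \<mapsto> [\<alpha> Ok' \<inter> Ok]\<close> factors through it: this is the connecting homomorphism. It is
  multiplicative because contraction along \<open>Ok \<subseteq> Ok'\<close> is multiplicative on integral ideals coprime to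
  \<open>d\<close>, an ideal of both rings. Contraction and extension are mutually inverse on such ideals, so
  exactness on the right only requires every ray class to contain an integral ideal coprime to \<open>d\<close>.
\<close>

section \<open>Invertible ideals coprime to a modulus\<close>

text \<open>Orders need not be integrally closed, so there is no unique factorization of ideals to
  steer by when an ideal has to be moved away from \<open>d\<close>. Finiteness replaces it: a
  nonzero \<open>d\<close> contains a positive integer, so \<open>Ok / d\<close> and
  \<open>Ok' / d\<close> are finite and every residue class has an idempotent power. These
  idempotents allow a generator of an invertible ideal modulo \<open>d\<close> to be patched
  together from local choices. Large multiples of suitable elements of \<open>d\<close> then correct
  the signs at the real embeddings without changing anything modulo \<open>d\<close>. The two rings
  are compared by one recurring device: if \<open>t\<close> is congruent to 1 modulo
  \<open>d\<close>, then multiplication by \<open>1 - t\<close> carries \<open>Ok'\<close> into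
  \<open>d\<close>, hence into \<open>Ok\<close>, and \<open>z = t * z + (1 - t) * z\<close> splits
  an element into a piece controlled by \<open>t\<close> and a piece that forgets which ring it came
  from. The maps at both ends, like the connecting one, choose representatives of cosets. Each
  therefore gets a formula valid for every representative, after which exactness is a matter of
  elements and ideals only.\<close>

lemma mprodI: "a \<in> A \<Longrightarrow> b \<in> B \<Longrightarrow> a * b \<in> mprod A B"
  unfolding mprod_def by clarify (rule exI[of _ "1::nat"], rule exI[of _ "\<lambda>_. a"], rule exI[of _ "\<lambda>_. b"], simp)

lemma mprod_zero: "0 \<in> mprod A B"
  unfolding mprod_def by (auto intro!: exI[of _ "0::nat"])

lemma mprod_add:
  assumes "x \<in> mprod A B" "y \<in> mprod A B"
  shows "x + y \<in> mprod A B"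
proof -
  obtain n f g where 1: "\<forall>i<(n::nat). f i \<in> A \<and> g i \<in> B" "x = (\<Sum>i<n. f i * g i)"
    using assms(1) by (auto simp: mprod_def)
  obtain n' f' g' where 2: "\<forall>i<(n'::nat). f' i \<in> A \<and> g' i \<in> B" "y = (\<Sum>i<n'. f' i * g' i)"
    using assms(2) by (auto simp: mprod_def)
  define F where "F i = (if i < n then f i else f' (i - n))" for i
  define G where "G i = (if i < n then g i else g' (i - n))" for i
  have "(\<Sum>i<n + n'. F i * G i) = x + y"
  proof -
    have "(\<Sum>i<n + k. F i * G i) = x + (\<Sum>i<k. f' i * g' i)" for k
      by (induction k) (auto simp: F_def G_def 1(2) algebra_simps)
    then show ?thesis by (simp add: 2)
  qed
  moreover have "\<forall>i<n + n'. F i \<in> A \<and> G i \<in> B"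
    using 1 2 by (auto simp: F_def G_def)
  ultimately show ?thesis unfolding mprod_def mem_Collect_eq
    by (intro exI[of _ "n + n'"] exI[of _ F] exI[of _ G]) simp
qed

lemma mprod_induct [consumes 1, case_names zero add prod]:
  assumes "x \<in> mprod A B" "P 0" "\<And>x y. P x \<Longrightarrow> P y \<Longrightarrow> P (x + y)"
    "\<And>a b. a \<in> A \<Longrightarrow> b \<in> B \<Longrightarrow> P (a * b)"
  shows "P x"
proof -
  obtain n f g where 1: "\<forall>i<(n::nat). f i \<in> A \<and> g i \<in> B" "x = (\<Sum>i<n. f i * g i)"
    using assms(1) by (auto simp: mprod_def)
  have "P (\<Sum>i<k. f i * g i)" if "k \<le> n" for k
    using that by (induction k) (auto intro!: assms(2-4) simp: 1)
  then show ?thesis by (simp add: 1)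
qed

lemma mprod_subsetI:
  assumes "\<And>a b. a \<in> A \<Longrightarrow> b \<in> B \<Longrightarrow> a * b \<in> C" "0 \<in> C" "\<And>x y. x \<in> C \<Longrightarrow> y \<in> C \<Longrightarrow> x + y \<in> C"
  shows "mprod A B \<subseteq> C"
proof
  fix x assume "x \<in> mprod A B"
  then show "x \<in> C" by (induction rule: mprod_induct) (auto intro: assms)
qed

lemma mprod_commute: "mprod A B = mprod B A"
proof -
  have "mprod A B \<subseteq> mprod B A" for A B :: "'a::field set"
    by (rule mprod_subsetI, subst mult.commute) (auto intro: mprod_zero mprod_add mprodI)
  then show ?thesis by blast
qed

lemma mprod_assoc: "mprod (mprod A B) C = mprod A (mprod B C)"
proof -
  have *: "mprod (mprod A B) C \<subseteq> mprod A (mprod B C)" for A B C :: "'a::field set"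
  proof (rule mprod_subsetI)
    fix x c assume "x \<in> mprod A B" "c \<in> C"
    then show "x * c \<in> mprod A (mprod B C)"
    proof (induction rule: mprod_induct)
      case (prod a b)
      then show ?case using mprodI[of a A "b * c" "mprod B C"] mprodI[of b B c C]
        by (simp add: mult.assoc)
    qed (auto intro: mprod_zero mprod_add simp: distrib_right)
  qed (auto intro: mprod_zero mprod_add)
  have "mprod A (mprod B C) = mprod (mprod C B) A"
    by (simp add: mprod_commute)
  also have "\<dots> \<subseteq> mprod C (mprod B A)" by (rule *)
  also have "\<dots> = mprod (mprod A B) C" by (simp add: mprod_commute)
  finally show ?thesis using * by blast
qed

lemma mprod_scale: "mprod ((*) x ` A) B = (*) x ` mprod A B"
proof
  show "mprod ((*) x ` A) B \<subseteq> (*) x ` mprod A B"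
  proof (rule mprod_subsetI)
    show "0 \<in> (*) x ` mprod A B" by (rule image_eqI[of _ _ 0]) (auto intro: mprod_zero)
  qed (auto simp: mult.assoc distrib_left[symmetric] intro: imageI mprodI mprod_add)
  show "(*) x ` mprod A B \<subseteq> mprod ((*) x ` A) B"
  proof safe
    fix y assume "y \<in> mprod A B"
    then show "x * y \<in> mprod ((*) x ` A) B"
    proof (induction rule: mprod_induct)
      case (prod a b)
      then have "x * a * b \<in> mprod ((*) x ` A) B" by (intro mprodI imageI)
      then show ?case by (simp add: mult.assoc)
    qed (auto intro: mprod_zero mprod_add simp: distrib_left)
  qed
qed

text \<open>The denominator bound of a fractional ideal is left out, because for the ideals
  considered here a witness congruent to 1 supplies it. One predicate then covers integral ideals,
  fractional ideals and the same set seen over a subring.\<close>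

definition submodule_on :: "'k::field set \<Rightarrow> 'k set \<Rightarrow> bool" where
  "submodule_on R a \<longleftrightarrow> 0 \<in> a \<and> (\<forall>x\<in>a. \<forall>y\<in>a. x + y \<in> a) \<and> (\<forall>r\<in>R. \<forall>x\<in>a. r * x \<in> a)"

text \<open>Nonvanishing is demanded explicitly, since \<open>0\<close> is congruent to 1 when
  \<open>m\<close> is the whole ring; members can thus always serve as denominators.\<close>

definition cong_one :: "'k::field set \<Rightarrow> 'k set" where
  "cong_one m = {x. x \<noteq> 0 \<and> x - 1 \<in> m}"

lemma submodule_onD:
  assumes "submodule_on R a"
  shows "0 \<in> a" "x \<in> a \<Longrightarrow> y \<in> a \<Longrightarrow> x + y \<in> a" "r \<in> R \<Longrightarrow> x \<in> a \<Longrightarrow> r * x \<in> a"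
    "r \<in> R \<Longrightarrow> x \<in> a \<Longrightarrow> x * r \<in> a"
  using assms by (auto simp: submodule_on_def mult.commute)

lemma frac_ideal_iff:
  "frac_ideal R a \<longleftrightarrow> submodule_on R a \<and> (\<exists>l. l \<noteq> 0 \<and> (\<forall>x\<in>a. l * x \<in> R))"
  unfolding frac_ideal_def submodule_on_def image_subset_iff by blast

lemma is_ideal_iff: "is_ideal R I \<longleftrightarrow> submodule_on R I \<and> I \<subseteq> R"
  by (auto simp: is_ideal_def submodule_on_def)

lemma submodule_on_mprod: "submodule_on R a \<Longrightarrow> submodule_on R (mprod a b)"
  unfolding submodule_on_def
proof safe
  fix r x assume a: "\<forall>r\<in>R. \<forall>x\<in>a. r * x \<in> a" "r \<in> R" "x \<in> mprod a b"
  from a(3) show "r * x \<in> mprod a b"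
  proof (induction rule: mprod_induct)
    case (prod y z)
    then show ?case using mprodI[of "r * y" a z b] a by (simp add: mult.assoc)
  qed (auto intro: mprod_zero mprod_add simp: distrib_left)
qed (auto intro: mprod_zero mprod_add)

lemma submodule_on_mprod_right: "submodule_on R b \<Longrightarrow> submodule_on R (mprod a b)"
  using submodule_on_mprod mprod_commute by metis

lemma submodule_on_scale: "submodule_on R a \<Longrightarrow> submodule_on R ((*) x ` a)"
  unfolding submodule_on_def
  by (auto simp: distrib_left[symmetric] mult.left_commute)

lemma submodule_on_mono: "S \<subseteq> R \<Longrightarrow> submodule_on R a \<Longrightarrow> submodule_on S a"
  unfolding submodule_on_def by blast

lemma submodule_on_Int: "submodule_on R a \<Longrightarrow> submodule_on R b \<Longrightarrow> submodule_on R (a \<inter> b)"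
  unfolding submodule_on_def by blast

lemma mem_scale_iff: "x \<noteq> 0 \<Longrightarrow> y \<in> (*) x ` A \<longleftrightarrow> y / x \<in> (A :: 'k::field set)"
  by (metis image_iff nonzero_mult_div_cancel_left times_divide_eq_right)

lemma scale_scale: "(*) x ` (*) y ` A = (*) (x * y :: 'k::field) ` A"
  by (auto simp: image_image mult.assoc)

section \<open>Subrings of a field, their ideals, and elements congruent to 1\<close>

locale field_subring =
  fixes R :: "'k::field set"
  assumes one_mem: "1 \<in> R"
    and add_mem: "x \<in> R \<Longrightarrow> y \<in> R \<Longrightarrow> x + y \<in> R"
    and mult_mem: "x \<in> R \<Longrightarrow> y \<in> R \<Longrightarrow> x * y \<in> R"
    and neg_mem: "x \<in> R \<Longrightarrow> - x \<in> R"
begin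

lemma zero_mem: "0 \<in> R" using add_mem[OF one_mem neg_mem[OF one_mem]] by simp

lemma diff_mem: "x \<in> R \<Longrightarrow> y \<in> R \<Longrightarrow> x - y \<in> R"
  using add_mem[of x "- y"] neg_mem by simp

lemma power_mem: "x \<in> R \<Longrightarrow> x ^ n \<in> R"
  by (induction n) (auto intro: one_mem mult_mem)

lemma sum_mem: "(\<And>i. i \<in> I \<Longrightarrow> f i \<in> R) \<Longrightarrow> sum f I \<in> R"
  by (induction I rule: infinite_finite_induct) (auto intro: zero_mem add_mem)

lemma of_nat_mem: "of_nat n \<in> R"
  by (induction n) (auto intro: zero_mem add_mem one_mem)

lemma submodule_on_self: "submodule_on R R"
  by (auto simp: submodule_on_def intro: zero_mem add_mem mult_mem)

lemma sub_neg: "submodule_on R a \<Longrightarrow> x \<in> a \<Longrightarrow> - x \<in> a"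
  using submodule_onD(3)[of R a "- 1" x] neg_mem[OF one_mem] by simp

lemma sub_diff: "submodule_on R a \<Longrightarrow> x \<in> a \<Longrightarrow> y \<in> a \<Longrightarrow> x - y \<in> a"
  using submodule_onD(2)[of R a x "- y"] sub_neg by simp

lemma sub_sum: "submodule_on R a \<Longrightarrow> (\<And>i. i \<in> I \<Longrightarrow> f i \<in> a) \<Longrightarrow> sum f I \<in> a"
  by (induction I rule: infinite_finite_induct) (auto intro: submodule_onD)

lemma mprod_R: "submodule_on R a \<Longrightarrow> mprod a R = a"
proof
  assume a: "submodule_on R a"
  show "mprod a R \<subseteq> a" by (rule mprod_subsetI) (auto intro: submodule_onD[OF a])
  show "a \<subseteq> mprod a R" using mprodI[OF _ one_mem] by fastforce
qed

lemma R_mprod: "submodule_on R a \<Longrightarrow> mprod R a = a"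
  using mprod_R mprod_commute by metis

lemma scale_mprod: "submodule_on R a \<Longrightarrow> mprod ((*) x ` R) a = (*) x ` a"
  by (simp add: mprod_scale R_mprod)

end

locale ring_ideal = field_subring R for R :: "'k::field set" +
  fixes m :: "'k set"
  assumes ideal: "is_ideal R m"
begin

lemma m_sub: "submodule_on R m" and m_le: "m \<subseteq> R"
  using ideal by (auto simp: is_ideal_iff)

lemma cong_one_mem: "x \<in> cong_one m \<Longrightarrow> x \<in> R"
  using add_mem[of "x - 1" 1] m_le one_mem by (auto simp: cong_one_def)

lemma one_cong_one: "1 \<in> cong_one m"
  using submodule_onD[OF m_sub] by (auto simp: cong_one_def)

lemma cong_one_mult_diff: "x - 1 \<in> m \<Longrightarrow> y - 1 \<in> m \<Longrightarrow> x * y - 1 \<in> m"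
proof -
  assume a: "x - 1 \<in> m" "y - 1 \<in> m"
  then have "x \<in> R" using m_le add_mem[of "x - 1" 1] one_mem by auto
  then have "x * (y - 1) + (x - 1) \<in> m" using a submodule_onD[OF m_sub] by auto
  then show ?thesis by (simp add: algebra_simps)
qed

lemma cong_one_mult: "x \<in> cong_one m \<Longrightarrow> y \<in> cong_one m \<Longrightarrow> x * y \<in> cong_one m"
  using cong_one_mult_diff by (auto simp: cong_one_def)

lemma cong_one_cancel:
  assumes "x * z - 1 \<in> m" "x - 1 \<in> m" "z \<in> R"
  shows "z - 1 \<in> m"
proof -
  have "(x * z - 1) - z * (x - 1) \<in> m"
    by (rule sub_diff[OF m_sub assms(1) submodule_onD(3)[OF m_sub assms(3,2)]])
  then show ?thesis by (simp add: algebra_simps)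
qed

text \<open>A witness \<open>t\<close> can vanish only if \<open>1 \<in> m\<close>; then every
  element of \<open>R\<close> is congruent to 1 and the nonzero \<open>y\<close> takes its
  place.\<close>

lemma nonzero_cong_one:
  assumes "submodule_on R a" "t \<in> a" "t - 1 \<in> m" "y \<in> a" "y \<noteq> 0" "y \<in> R"
  shows "\<exists>t\<in>cong_one m. t \<in> a"
proof (cases "t = 0")
  case True
  then have "1 \<in> m" using assms(3) sub_neg[OF m_sub, of "-1"] by simp
  then have "x \<in> m" if "x \<in> R" for x using that submodule_onD(3)[OF m_sub, of x 1] by simp
  then show ?thesis using assms one_mem by (auto simp: cong_one_def intro: diff_mem)
qed (use assms in \<open>auto simp: cong_one_def\<close>)

lemma isum_one: "1 \<in> isum a m \<Longrightarrow> \<exists>s\<in>a. s - 1 \<in> m"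
proof -
  assume "1 \<in> isum a m"
  then obtain s u where su: "s \<in> a" "u \<in> m" "1 = s + u" unfolding isum_def by blast
  have "s - 1 = - u" unfolding su(3) by simp
  with sub_neg[OF m_sub su(2)] su(1) show ?thesis by (intro bexI[of _ s]) simp_all
qed

text \<open>Witnesses \<open>s\<close>, \<open>t\<close> congruent to 1 replace the presentation as a quotient of integral ideals; this
  form is visibly stable under products, inverses and change of ring.\<close>

lemma Jstar_iff:
  "a \<in> Jstar R m \<longleftrightarrow> submodule_on R a \<and> (\<exists>b. submodule_on R b \<and> mprod a b = R) \<and>
     (\<exists>s\<in>cong_one m. \<forall>x\<in>a. s * x \<in> R) \<and> (\<exists>t\<in>cong_one m. t \<in> a)" (is "_ \<longleftrightarrow> ?r")
proof
  assume "a \<in> Jstar R m"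
  then obtain b a1 b1 c1 where a: "submodule_on R a" and b: "submodule_on R b" "mprod a b = R"
    and c: "a = colon a1 b1" "is_ideal R a1" "is_ideal R b1" "isum a1 m = R" "isum b1 m = R"
      "submodule_on R c1" "mprod b1 c1 = R"
    by (auto simp: Jstar_def frac_ideal_iff invertible_fi_def coprime_fi_def)
  have nz: "\<exists>y\<in>a'. y \<noteq> 0" if "mprod a' b' = R" for a' b'
  proof (rule ccontr)
    assume "\<not> ?thesis"
    then have "mprod a' b' \<subseteq> {0}" by (intro mprod_subsetI) auto
    then show False using that one_mem by auto
  qed
  have b1: "submodule_on R b1" "b1 \<subseteq> R" and a1: "submodule_on R a1" "a1 \<subseteq> R"
    using c by (auto simp: is_ideal_iff)
  obtain s where s: "s \<in> b1" "s - 1 \<in> m"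
    using isum_one[of b1] c(5) one_mem by auto
  obtain t where t: "t \<in> a1" "t - 1 \<in> m"
    using isum_one[of a1] c(4) one_mem by auto
  obtain y where y: "y \<in> b1" "y \<noteq> 0" using nz c by blast
  obtain s' where s': "s' \<in> cong_one m" "s' \<in> b1"
    using nonzero_cong_one[OF b1(1) s y] b1 y by auto
  have s'a: "s' * x \<in> a1" if "x \<in> a" for x using that s' c(1) by (auto simp: colon_def mult.commute)
  have ta: "t \<in> a" using t b1(2) submodule_onD(4)[OF a1(1)] by (auto simp: c(1) colon_def)
  obtain y where y: "y \<in> a" "y \<noteq> 0" using nz b by blast
  \<comment> \<open>\<open>t\<close> may be zero; \<open>s' * y\<close> is the nonzero integral
    element of \<open>a\<close> to fall back on.\<close>
  have "\<exists>t\<in>cong_one m. t \<in> a"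
  proof (rule nonzero_cong_one[OF a ta t(2)])
    show "s' * y \<in> a" using submodule_onD(3)[OF a] s' cong_one_mem y by auto
    show "s' * y \<noteq> 0" using s' y by (auto simp: cong_one_def)
    show "s' * y \<in> R" using s'a y a1 by auto
  qed
  then show ?r using a b s' s'a a1 by blast
next
  assume ?r
  then obtain b s t where a: "submodule_on R a" and b: "submodule_on R b" "mprod a b = R"
    and s: "s \<in> cong_one m" "\<And>x. x \<in> a \<Longrightarrow> s * x \<in> R" and t: "t \<in> cong_one m" "t \<in> a" by blast
  have s0: "s \<noteq> 0" "s \<in> R" and t0: "t \<noteq> 0" using s t cong_one_mem by (auto simp: cong_one_def)
  have fb: "frac_ideal R b"
    unfolding frac_ideal_iff using b t t0 mprodI[of t a _ b] by auto
  have isum: "isum a1 m = R" if "submodule_on R a1" "a1 \<subseteq> R" "u \<in> a1" "u - 1 \<in> m" for a1 u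
  proof
    show "isum a1 m \<subseteq> R" using that m_le add_mem by (auto simp: isum_def)
    show "R \<subseteq> isum a1 m"
    proof
      fix r assume r: "r \<in> R"
      have "r * u \<in> a1" "r * (1 - u) \<in> m"
        using r that submodule_onD(3)[OF that(1) r] sub_neg[OF m_sub that(4)] submodule_onD(3)[OF m_sub r] by auto
      moreover have "r = r * u + r * (1 - u)" by (simp add: algebra_simps)
      ultimately show "r \<in> isum a1 m" unfolding isum_def by blast
    qed
  qed
  have "coprime_fi R a m"
    unfolding coprime_fi_def
  \<comment> \<open>Multiplication by \<open>s\<close> makes \<open>a\<close> integral, so
    \<open>a\<close> is the quotient of \<open>s a\<close> by the principal ideal
    \<open>s R\<close>. They are coprime to \<open>m\<close> because they contain
    \<open>s * t\<close> and \<open>s\<close> respectively, both congruent to 1.\<close>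
  proof (intro exI conjI)
    show "a = colon ((*) s ` a) ((*) s ` R)"
    proof
      show "a \<subseteq> colon ((*) s ` a) ((*) s ` R)"
        using submodule_onD[OF a] by (auto simp: colon_def mult.left_commute)
      show "colon ((*) s ` a) ((*) s ` R) \<subseteq> a"
        using s0 one_mem by (force simp: colon_def)
    qed
    show "is_ideal R ((*) s ` a)" "is_ideal R ((*) s ` R)"
      using a s s0 by (auto simp: is_ideal_iff intro: submodule_on_scale submodule_on_self mult_mem)
    have "mprod ((*) s ` R) ((*) (inverse s) ` R) = R"
      using s0 by (simp add: scale_mprod submodule_on_scale submodule_on_self scale_scale)
    moreover have "frac_ideal R ((*) (inverse s) ` R)"
      unfolding frac_ideal_iff using s0
      by (auto simp: submodule_on_scale submodule_on_self mult.assoc[symmetric] intro!: exI[of _ s])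
    ultimately show "invertible_fi R ((*) s ` R)" by (auto simp: invertible_fi_def)
    show "isum ((*) s ` a) m = R"
      by (rule isum[of _ "s * t"])
        (use a s t cong_one_mult[of s t] in \<open>auto simp: cong_one_def submodule_on_scale\<close>)
    show "isum ((*) s ` R) m = R"
      by (rule isum[of _ "s"])
        (use s s0 one_mem in \<open>auto simp: cong_one_def submodule_on_self submodule_on_scale image_iff intro: mult_mem\<close>)
  qed
  then show "a \<in> Jstar R m"
    using a b s s0 fb by (auto simp: Jstar_def frac_ideal_iff invertible_fi_def)
qed

text \<open>Every nonzero \<open>s\<close> in \<open>Sm R m\<close> has a multiple
  \<open>s * c\<close> congruent to 1, so the denominators of the localization can all be taken in
  \<open>cong_one m\<close>. The numerator is allowed to be zero, because
  \<open>\<alpha> = 0\<close> satisfies the congruence when \<open>m\<close> is the whole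
  ring.\<close>

lemma cong1_iff: "cong1 R m \<alpha> \<longleftrightarrow> (\<exists>x y. \<alpha> = x / y \<and> x - 1 \<in> m \<and> y \<in> cong_one m)"
proof
  have cancel: "\<exists>c\<in>R. s * c \<in> cong_one m" if "s \<in> Sm R m" "s \<noteq> 0" for s
  proof -
    from that(1) have sR: "s \<in> R" and "1 \<in> isum ((*) s ` R) m"
      using one_mem by (auto simp: Sm_def)
    then obtain c where c: "c \<in> R" "s * c - 1 \<in> m" using isum_one by blast
    have "s * c \<in> (*) s ` R" "s \<in> (*) s ` R" using c one_mem by (auto simp: image_iff)
    then show ?thesis
      using nonzero_cong_one[of "(*) s ` R" "s * c" s] that sR c
      by (auto simp: submodule_on_scale submodule_on_self)
  qed
  assume "cong1 R m \<alpha>"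
  then have "\<alpha> - 1 \<in> mprod m (localize R (Sm R m))" by (simp add: cong1_def)
  then have "\<exists>u\<in>m. \<exists>y\<in>cong_one m. \<alpha> - 1 = u / y"
  proof (induction rule: mprod_induct)
    case zero
    then show ?case using one_cong_one submodule_onD(1)[OF m_sub] by force
  next
    case (add x y)
    then obtain u y1 v y2 where "u \<in> m" "v \<in> m" "y1 \<in> cong_one m" "y2 \<in> cong_one m"
      "x = u / y1" "y = v / y2" by blast
    moreover from this have "x + y = (u * y2 + v * y1) / (y1 * y2)"
      by (simp add: cong_one_def field_simps)
    moreover from calculation have "u * y2 + v * y1 \<in> m"
      by (meson cong_one_mem submodule_onD[OF m_sub])
    ultimately show ?case using cong_one_mult by blast
  next
    case (prod u z)
    then obtain a s where z: "z = a / s" "a \<in> R" "s \<in> Sm R m" by (auto simp: localize_def)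
    show ?case
    \<comment> \<open>\<open>Sm R m\<close> contains \<open>0\<close> when \<open>m = R\<close>; the
      fraction \<open>a / 0\<close> is then \<open>0\<close> by the convention for division.\<close>
    proof (cases "s = 0")
      case True
      then show ?thesis using z one_cong_one submodule_onD(1)[OF m_sub] by force
    next
      case False
      then obtain c where c: "c \<in> R" "s * c \<in> cong_one m" using cancel z by blast
      then have "c \<noteq> 0" by (auto simp: cong_one_def)
      then have "u * z = u * a * c / (s * c)" using z by simp
      moreover have "u * a * c \<in> m" using z c prod submodule_onD(4)[OF m_sub] by auto
      ultimately show ?thesis using c by blast
    qed
  qed
  then obtain u y where u: "u \<in> m" "y \<in> cong_one m" "\<alpha> - 1 = u / y" by blast
  then have "\<alpha> = (y + u) / y" by (simp add: cong_one_def field_simps)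
  moreover have "y + u - 1 \<in> m"
    using submodule_onD(2)[OF m_sub, of "y - 1" u] u by (simp add: cong_one_def algebra_simps)
  ultimately show "\<exists>x y. \<alpha> = x / y \<and> x - 1 \<in> m \<and> y \<in> cong_one m" using u by blast
next
  assume "\<exists>x y. \<alpha> = x / y \<and> x - 1 \<in> m \<and> y \<in> cong_one m"
  then obtain x y where xy: "\<alpha> = x / y" "x - 1 \<in> m" "y \<in> cong_one m" by blast
  then have y0: "y \<noteq> 0" "y \<in> R" "y - 1 \<in> m" using cong_one_mem by (auto simp: cong_one_def)
  have "\<alpha> - 1 = (x - y) * (1 / y)" using y0 xy by (simp add: field_simps)
  moreover have "x - y \<in> m" using sub_diff[OF m_sub xy(2) y0(3)] by simp
  moreover have "1 / y \<in> localize R (Sm R m)"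
  proof -
    have "isum ((*) y ` R) m = R"
    proof
      show "isum ((*) y ` R) m \<subseteq> R" using m_le y0 by (auto simp: isum_def intro: add_mem mult_mem)
      show "R \<subseteq> isum ((*) y ` R) m"
      proof
        fix r assume r: "r \<in> R"
        have "r = y * r + - (r * (y - 1))" by (simp add: algebra_simps)
        moreover have "- (r * (y - 1)) \<in> m" using r y0 submodule_onD(3)[OF m_sub] sub_neg[OF m_sub] by blast
        ultimately show "r \<in> isum ((*) y ` R) m" using r unfolding isum_def by blast
      qed
    qed
    then show ?thesis using y0 one_mem by (auto simp: localize_def Sm_def)
  qed
  ultimately show "cong1 R m \<alpha>" unfolding cong1_def by (metis mprodI)
qed

end

section \<open>Real embeddings and ray class groups\<close>

lemma real_emb_simps:
  assumes "real_emb \<rho>"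
  shows "\<rho> 1 = 1" "\<rho> (x + y) = \<rho> x + \<rho> y" "\<rho> (x * y) = \<rho> x * \<rho> y" "\<rho> 0 = 0"
    "\<rho> (- x) = - \<rho> x" "\<rho> (x - y) = \<rho> x - \<rho> y"
proof -
  show 1: "\<rho> 1 = 1" "\<And>x y. \<rho> (x + y) = \<rho> x + \<rho> y" "\<rho> (x * y) = \<rho> x * \<rho> y"
    using assms by (auto simp: real_emb_def)
  show z: "\<rho> 0 = 0" using 1(2)[of 0 0] by simp
  show n: "\<rho> (- x) = - \<rho> x" for x using 1(2)[of x "- x"] z by simp
  show "\<rho> (x - y) = \<rho> x - \<rho> y" using 1(2)[of x "- y"] n[of y] by simp
qed

lemma real_emb_eq_0_iff: "real_emb \<rho> \<Longrightarrow> \<rho> x = 0 \<longleftrightarrow> x = 0"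
  using real_emb_simps(3)[of \<rho> x "inverse x"] real_emb_simps(1)[of \<rho>] real_emb_simps(4)[of \<rho>]
  by (cases "x = 0") auto

lemma real_emb_inverse: "real_emb \<rho> \<Longrightarrow> \<rho> (inverse x) = inverse (\<rho> x)"
proof (cases "x = 0")
  assume \<rho>: "real_emb \<rho>" and "x \<noteq> 0"
  then have "\<rho> x * \<rho> (inverse x) = 1"
    using real_emb_simps(3)[OF \<rho>, of x "inverse x"] real_emb_simps(1)[OF \<rho>] by simp
  then show ?thesis by (rule inverse_unique[symmetric])
qed (simp add: real_emb_simps)

lemma real_emb_divide: "real_emb \<rho> \<Longrightarrow> \<rho> (x / y) = \<rho> x / \<rho> y"
  by (simp add: divide_inverse real_emb_simps real_emb_inverse)

lemma real_emb_power: "real_emb \<rho> \<Longrightarrow> \<rho> (x ^ n) = \<rho> x ^ n"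
  by (induction n) (auto simp: real_emb_simps)

lemma real_emb_sum: "real_emb \<rho> \<Longrightarrow> \<rho> (sum f I) = (\<Sum>i\<in>I. \<rho> (f i))"
  by (induction I rule: infinite_finite_induct) (auto simp: real_emb_simps)

lemma real_emb_of_nat: "real_emb \<rho> \<Longrightarrow> \<rho> (of_nat n) = of_nat n"
  by (induction n) (auto simp: real_emb_simps)

lemma real_emb_of_int: "real_emb \<rho> \<Longrightarrow> \<rho> (of_int n) = of_int n"
  by (cases n) (auto simp: real_emb_simps real_emb_of_nat)

lemma real_emb_of_rat: "real_emb \<rho> \<Longrightarrow> \<rho> (of_rat q :: 'k::field_char_0) = of_rat q"
  by (cases q) (simp add: of_rat_rat real_emb_divide real_emb_of_int)

section \<open>The group of invertible ideals coprime to \<open>m\<close> and its ray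
  classes\<close>

context ring_ideal
begin

lemma J_sub: "a \<in> Jstar R m \<Longrightarrow> submodule_on R a"
  by (simp add: Jstar_iff)

lemma J_mult: "a \<in> Jstar R m \<Longrightarrow> b \<in> Jstar R m \<Longrightarrow> mprod a b \<in> Jstar R m"
proof -
  assume "a \<in> Jstar R m" "b \<in> Jstar R m"
  then obtain a' s t b' s' t' where
    a: "submodule_on R a" "submodule_on R a'" "mprod a a' = R" "s \<in> cong_one m" "\<forall>x\<in>a. s * x \<in> R"
       "t \<in> cong_one m" "t \<in> a" and
    b: "submodule_on R b" "submodule_on R b'" "mprod b b' = R" "s' \<in> cong_one m" "\<forall>x\<in>b. s' * x \<in> R"
       "t' \<in> cong_one m" "t' \<in> b"
    by (auto simp: Jstar_iff)
  have "mprod (mprod a b) (mprod a' b') = mprod (mprod a a') (mprod b b')"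
    by (metis mprod_assoc mprod_commute)
  then have "mprod (mprod a b) (mprod a' b') = R" using a b by (simp add: mprod_R submodule_on_self)
  moreover have "(s * s') * x \<in> R" if "x \<in> mprod a b" for x
    using that
  proof (induction rule: mprod_induct)
    case (prod x y)
    then have "(s * x) * (s' * y) \<in> R" using a(5) b(5) mult_mem by blast
    then show ?case by (simp add: mult_ac)
  qed (auto simp: distrib_left intro: zero_mem add_mem)
  moreover have "s * s' \<in> cong_one m" "t * t' \<in> cong_one m" "t * t' \<in> mprod a b"
    using a b by (auto intro: cong_one_mult mprodI)
  ultimately show ?thesis
    using submodule_on_mprod[OF a(1), of b] submodule_on_mprod[OF a(2), of b'] unfolding Jstar_iff by blast
qed

lemma R_in_J: "R \<in> Jstar R m"
  using one_mem one_cong_one by (auto simp: Jstar_iff submodule_on_self intro!: exI[of _ R] bexI[of _ 1] mprod_R)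

text \<open>The two witnesses exchange roles: \<open>t \<in> a\<close> gives
  \<open>t b \<subseteq> R\<close>, and \<open>s a \<subseteq> R\<close> gives
  \<open>s = s * 1 \<in> b\<close> because \<open>1\<close> lies in the product of \<open>a\<close>
  and \<open>b\<close>.\<close>

lemma J_inverse: 
  assumes "a \<in> Jstar R m"
  shows "\<exists>b\<in>Jstar R m. mprod a b = R"
proof -
  obtain b s t where
    a: "submodule_on R a" "submodule_on R b" "mprod a b = R" "s \<in> cong_one m" "\<forall>x\<in>a. s * x \<in> R"
       "t \<in> cong_one m" "t \<in> a" using assms by (auto simp: Jstar_iff)
  have "t * x \<in> R" if "x \<in> b" for x using that a mprodI[of t a x b] by simp
  moreover have "s \<in> b"
  proof -
    have "s * x \<in> b" if "x \<in> mprod a b" for x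
      using that
    proof (induction rule: mprod_induct)
      case (prod x y)
      then have "(s * x) * y \<in> b" using a submodule_onD(3)[OF a(2)] by auto
      then show ?case by (simp add: mult_ac)
    qed (auto simp: distrib_left intro: submodule_onD[OF a(2)])
    from this[of 1] show ?thesis using a one_mem by simp
  qed
  ultimately have "b \<in> Jstar R m"
    using a by (auto simp: Jstar_iff mprod_commute intro!: exI[of _ a])
  then show ?thesis using a by blast
qed

lemma comm_group_ideal_grp: "comm_group (ideal_grp R m)"
proof (rule comm_groupI)
  fix x assume "x \<in> carrier (ideal_grp R m)"
  then show "\<exists>y\<in>carrier (ideal_grp R m). y \<otimes>\<^bsub>ideal_grp R m\<^esub> x = \<one>\<^bsub>ideal_grp R m\<^esub>"
    using J_inverse[of x] by (auto simp: ideal_grp_def mprod_commute)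
next
  fix x y assume "x \<in> carrier (ideal_grp R m)" "y \<in> carrier (ideal_grp R m)"
  show "x \<otimes>\<^bsub>ideal_grp R m\<^esub> y = y \<otimes>\<^bsub>ideal_grp R m\<^esub> x"
    by (simp add: ideal_grp_def mprod_commute)
qed (simp_all add: ideal_grp_def J_mult R_in_J R_mprod J_sub mprod_assoc)

text \<open>The multiplicative group of generators behind \<open>Pray\<close>. It is kept apart from
  the ideals because a generator is determined only up to units, whereas the congruence and the
  signs belong to the generator.\<close>

definition ray_elements :: "('k \<Rightarrow> real) set \<Rightarrow> 'k set" where
  "ray_elements \<Sigma> = {\<alpha>. \<alpha> \<noteq> 0 \<and> cong1 R m \<alpha> \<and> (\<forall>\<rho>\<in>\<Sigma>. \<rho> \<alpha> > 0)}"

lemma ray_elementsI: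
  "x \<in> cong_one m \<Longrightarrow> y \<in> cong_one m \<Longrightarrow> (\<And>\<rho>. \<rho> \<in> \<Sigma> \<Longrightarrow> \<rho> (x / y) > 0) \<Longrightarrow> x / y \<in> ray_elements \<Sigma>"
  unfolding ray_elements_def cong1_iff by (auto simp: cong_one_def)

lemma ray_elementsE:
  assumes "\<alpha> \<in> ray_elements \<Sigma>"
  obtains x y where "\<alpha> = x / y" "x \<in> cong_one m" "y \<in> cong_one m"
  using assms unfolding ray_elements_def cong1_iff by (auto simp: cong_one_def)

lemma ray_elements_nonzero: "\<alpha> \<in> ray_elements \<Sigma> \<Longrightarrow> \<alpha> \<noteq> 0"
  and ray_elements_pos: "\<alpha> \<in> ray_elements \<Sigma> \<Longrightarrow> \<rho> \<in> \<Sigma> \<Longrightarrow> \<rho> \<alpha> > 0"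
  by (auto simp: ray_elements_def)

text \<open>For an integral \<open>\<alpha> = x / y\<close> the congruence in the localization
  descends to \<open>m\<close> itself: in \<open>y * \<alpha> = x\<close> the factor
  \<open>y\<close>, congruent to 1, can be cancelled.\<close>

lemma ray_elements_cong_one:
  assumes "\<alpha> \<in> ray_elements \<Sigma>" "\<alpha> \<in> R"
  shows "\<alpha> - 1 \<in> m"
proof -
  obtain x y where "\<alpha> = x / y" "x \<in> cong_one m" "y \<in> cong_one m"
    using assms by (elim ray_elementsE)
  then show ?thesis using cong_one_cancel[of y \<alpha>] assms by (auto simp: cong_one_def)
qed

lemma Pray_eq: "Pray R m \<Sigma> = {(*) \<alpha> ` R |\<alpha>. \<alpha> \<in> ray_elements \<Sigma>}"
  by (simp add: Pray_def ray_elements_def)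

context
  fixes \<Sigma> :: "('k \<Rightarrow> real) set"
  assumes embs: "\<forall>\<rho>\<in>\<Sigma>. real_emb \<rho>"
begin

lemma ray_elements_mult:
  assumes "\<alpha> \<in> ray_elements \<Sigma>" "\<beta> \<in> ray_elements \<Sigma>"
  shows "\<alpha> * \<beta> \<in> ray_elements \<Sigma>"
proof -
  obtain x y z w where *: "\<alpha> = x / y" "x \<in> cong_one m" "y \<in> cong_one m"
    "\<beta> = z / w" "z \<in> cong_one m" "w \<in> cong_one m" 
    using assms by (elim ray_elementsE)
  have "(x * z) / (y * w) \<in> ray_elements \<Sigma>"
  proof (rule ray_elementsI)
    fix \<rho> assume "\<rho> \<in> \<Sigma>"
    then have "\<rho> \<alpha> > 0" "\<rho> \<beta> > 0" "real_emb \<rho>" using assms ray_elements_pos embs by auto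
    moreover have "\<alpha> * \<beta> = (x * z) / (y * w)" by (simp add: *)
    ultimately show "\<rho> (x * z / (y * w)) > 0" by (metis real_emb_simps(3) mult_pos_pos)
  qed (use * in \<open>auto intro: cong_one_mult\<close>)
  then show ?thesis by (simp add: *)
qed

lemma ray_elements_inverse:
  assumes "\<alpha> \<in> ray_elements \<Sigma>"
  shows "inverse \<alpha> \<in> ray_elements \<Sigma>"
proof -
  obtain x y where *: "\<alpha> = x / y" "x \<in> cong_one m" "y \<in> cong_one m"
    using assms by (elim ray_elementsE)
  have "y / x \<in> ray_elements \<Sigma>"
  proof (rule ray_elementsI)
    fix \<rho> assume "\<rho> \<in> \<Sigma>"
    then have "\<rho> \<alpha> > 0" "real_emb \<rho>" using assms ray_elements_pos embs by auto
    then have "\<rho> (inverse \<alpha>) > 0" by (simp add: real_emb_inverse)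
    then show "\<rho> (y / x) > 0" by (simp add: *)
  qed (use * in auto)
  then show ?thesis by (simp add: *)
qed

lemma one_ray_element: "1 \<in> ray_elements \<Sigma>"
  using ray_elementsI[OF one_cong_one one_cong_one, of \<Sigma>] embs by (auto simp: real_emb_simps)

lemma scale_in_J:
  assumes "\<alpha> \<in> ray_elements \<Sigma>"
  shows "(*) \<alpha> ` R \<in> Jstar R m"
proof -
  obtain x y where *: "\<alpha> = x / y" "x \<in> cong_one m" "y \<in> cong_one m"
    using assms by (elim ray_elementsE)
  have xy: "x \<in> R" "y \<in> R" "x \<noteq> 0" "y \<noteq> 0" using * cong_one_mem by (auto simp: cong_one_def)
  have "\<alpha> \<noteq> 0" using ray_elements_nonzero assms .
  then have "mprod ((*) \<alpha> ` R) ((*) (inverse \<alpha>) ` R) = R"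
    by (simp add: scale_mprod submodule_on_scale submodule_on_self scale_scale)
  moreover have "x \<in> (*) \<alpha> ` R" using xy * by (intro image_eqI[of _ _ y]) auto
  moreover have "\<forall>z\<in>(*) \<alpha> ` R. y * z \<in> R" using xy * by (auto intro: mult_mem)
  ultimately show ?thesis using * unfolding Jstar_iff
    by (meson submodule_on_scale submodule_on_self)
qed

lemma J_scale: 
  assumes "\<alpha> \<in> ray_elements \<Sigma>" "a \<in> Jstar R m"
  shows "(*) \<alpha> ` a \<in> Jstar R m"
  using J_mult[OF scale_in_J[OF assms(1)] assms(2)] J_sub[OF assms(2)] by (simp add: scale_mprod)

lemma subgroup_Pray: "subgroup (Pray R m \<Sigma>) (ideal_grp R m)"
proof -
  interpret G: comm_group "ideal_grp R m" by (rule comm_group_ideal_grp)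
  have mult: "mprod ((*) \<alpha> ` R) ((*) \<beta> ` R) = (*) (\<alpha> * \<beta>) ` R" for \<alpha> \<beta>
    by (simp add: scale_mprod submodule_on_scale submodule_on_self scale_scale)
  show ?thesis
  proof (rule G.subgroupI)
    show "Pray R m \<Sigma> \<subseteq> carrier (ideal_grp R m)"
      using scale_in_J by (auto simp: ideal_grp_def Pray_eq)
    show "Pray R m \<Sigma> \<noteq> {}" using one_ray_element by (auto simp: Pray_eq)
  next
    fix a assume a: "a \<in> Pray R m \<Sigma>"
    then obtain \<alpha> where \<alpha>: "\<alpha> \<in> ray_elements \<Sigma>" "a = (*) \<alpha> ` R" by (auto simp: Pray_eq)
    have "inv\<^bsub>ideal_grp R m\<^esub> a = (*) (inverse \<alpha>) ` R"
    proof (rule G.inv_equality)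
      show "(*) (inverse \<alpha>) ` R \<otimes>\<^bsub>ideal_grp R m\<^esub> a = \<one>\<^bsub>ideal_grp R m\<^esub>"
        using \<alpha> ray_elements_nonzero by (simp add: ideal_grp_def mult)
    qed (use \<alpha> scale_in_J ray_elements_inverse in \<open>auto simp: ideal_grp_def\<close>)
    then show "inv\<^bsub>ideal_grp R m\<^esub> a \<in> Pray R m \<Sigma>"
      using \<alpha> ray_elements_inverse by (auto simp: Pray_eq)
  next
    fix a b assume "a \<in> Pray R m \<Sigma>" "b \<in> Pray R m \<Sigma>"
    then obtain \<alpha> \<beta> where "\<alpha> \<in> ray_elements \<Sigma>" "a = (*) \<alpha> ` R" "\<beta> \<in> ray_elements \<Sigma>" "b = (*) \<beta> ` R"
      by (auto simp: Pray_eq)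
    then show "a \<otimes>\<^bsub>ideal_grp R m\<^esub> b \<in> Pray R m \<Sigma>"
      using ray_elements_mult[of \<alpha> \<beta>] mult[of \<alpha> \<beta>] by (auto simp: Pray_eq ideal_grp_def)
  qed
qed

lemma normal_Pray: "Pray R m \<Sigma> \<lhd> ideal_grp R m"
  using comm_group.subgroup_imp_normal[OF comm_group_ideal_grp subgroup_Pray] .

lemma Pray_coset:
  assumes "a \<in> Jstar R m"
  shows "Pray R m \<Sigma> #>\<^bsub>ideal_grp R m\<^esub> a = {(*) \<gamma> ` a |\<gamma>. \<gamma> \<in> ray_elements \<Sigma>}"
proof -
  have "Pray R m \<Sigma> #>\<^bsub>ideal_grp R m\<^esub> a = (\<lambda>b. mprod b a) ` Pray R m \<Sigma>"
    by (auto simp: r_coset_def ideal_grp_def)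
  also have "\<dots> = (\<lambda>\<gamma>. mprod ((*) \<gamma> ` R) a) ` ray_elements \<Sigma>"
    unfolding Pray_eq by blast
  finally show ?thesis using J_sub[OF assms] by (auto simp: scale_mprod)
qed

text \<open>Cosets of \<open>Pray\<close> are orbits under multiplication by ray elements. In this
  form every equality of ray classes is produced and used below.\<close>

lemma Pray_coset_eq_iff:
  assumes "a \<in> Jstar R m" "b \<in> Jstar R m"
  shows "Pray R m \<Sigma> #>\<^bsub>ideal_grp R m\<^esub> a = Pray R m \<Sigma> #>\<^bsub>ideal_grp R m\<^esub> b \<longleftrightarrow>
    (\<exists>\<gamma>\<in>ray_elements \<Sigma>. a = (*) \<gamma> ` b)" (is "?l \<longleftrightarrow> ?r")
proof -
  interpret G: comm_group "ideal_grp R m" by (rule comm_group_ideal_grp)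
  have c: "a \<in> carrier (ideal_grp R m)" "b \<in> carrier (ideal_grp R m)"
    using assms by (auto simp: ideal_grp_def)
  have "?l \<longleftrightarrow> a \<in> Pray R m \<Sigma> #>\<^bsub>ideal_grp R m\<^esub> b"
    using G.repr_independence[OF _ c(2) subgroup_Pray] G.rcos_self[OF c(1) subgroup_Pray] by metis
  then show ?thesis by (auto simp: Pray_coset[OF assms(2)])
qed

lemma carrier_ray_class_group:
  "carrier (ray_class_group R m \<Sigma>) = (\<lambda>a. Pray R m \<Sigma> #>\<^bsub>ideal_grp R m\<^esub> a) ` Jstar R m"
  by (simp add: ray_class_group_def carrier_FactGroup) (simp add: ideal_grp_def)

lemma ray_class_mult:
  assumes "a \<in> Jstar R m" "b \<in> Jstar R m"
  shows "(Pray R m \<Sigma> #>\<^bsub>ideal_grp R m\<^esub> a) \<otimes>\<^bsub>ray_class_group R m \<Sigma>\<^esub> (Pray R m \<Sigma> #>\<^bsub>ideal_grp R m\<^esub> b)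
    = Pray R m \<Sigma> #>\<^bsub>ideal_grp R m\<^esub> mprod a b"
  using normal.rcos_sum[OF normal_Pray, of a b] assms
  by (simp add: ray_class_group_def) (simp add: ideal_grp_def)

lemma one_ray_class_group:
  "\<one>\<^bsub>ray_class_group R m \<Sigma>\<^esub> = Pray R m \<Sigma> #>\<^bsub>ideal_grp R m\<^esub> R"
proof -
  interpret G: comm_group "ideal_grp R m" by (rule comm_group_ideal_grp)
  have "Pray R m \<Sigma> #>\<^bsub>ideal_grp R m\<^esub> \<one>\<^bsub>ideal_grp R m\<^esub> = Pray R m \<Sigma>"
    by (rule G.coset_mult_one) (rule subgroup.subset[OF subgroup_Pray])
  then show ?thesis by (simp add: ray_class_group_def ideal_grp_def)
qed

text \<open>Controls the representative that \<open>ext_map\<close> chooses.\<close>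

lemma some_in_ray_class:
  assumes "C \<in> carrier (ray_class_group R m \<Sigma>)"
  shows "(SOME a. a \<in> C) \<in> Jstar R m" "C = Pray R m \<Sigma> #>\<^bsub>ideal_grp R m\<^esub> (SOME a. a \<in> C)"
proof -
  interpret G: comm_group "ideal_grp R m" by (rule comm_group_ideal_grp)
  obtain b where b: "b \<in> Jstar R m" "C = Pray R m \<Sigma> #>\<^bsub>ideal_grp R m\<^esub> b"
    using assms by (auto simp: carrier_ray_class_group)
  then have "b \<in> C" using G.rcos_self[OF _ subgroup_Pray, of b] by (simp add: ideal_grp_def)
  then have "(SOME a. a \<in> C) \<in> C" by (rule someI)
  then obtain \<gamma> where "\<gamma> \<in> ray_elements \<Sigma>" "(SOME a. a \<in> C) = (*) \<gamma> ` b"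
    using Pray_coset b by auto
  then show "(SOME a. a \<in> C) \<in> Jstar R m" "C = Pray R m \<Sigma> #>\<^bsub>ideal_grp R m\<^esub> (SOME a. a \<in> C)"
    using b J_scale[of \<gamma> b] Pray_coset_eq_iff[of "(*) \<gamma> ` b" b] by auto
qed

end

end

section \<open>Extension and contraction of ideals\<close>

text \<open>For an \<open>Ok'\<close>-ideal \<open>d\<close> the inclusion
  \<open>d \<subseteq> colon m Ok'\<close> amounts to \<open>d \<subseteq> m\<close>, and for the
  \<open>Ok'\<close>-ideal \<open>m'\<close> the inclusion of \<open>m Ok'\<close> amounts to
  \<open>m \<subseteq> m'\<close>. The sublocales \<open>D\<close> and \<open>E\<close> below view
  \<open>d\<close> as an ideal of \<open>Ok'\<close> and of \<open>Ok\<close>.\<close>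

locale level_pair = A: ring_ideal Ok m + B: ring_ideal Ok' m'
  for Ok m Ok' m' :: "'k::field_char_0 set" +
  fixes d :: "'k set"
  assumes Ok_le: "Ok \<subseteq> Ok'" and d_ideal: "is_ideal Ok' d" and d_le_m: "d \<subseteq> m" and m_le_m': "m \<subseteq> m'"
begin

sublocale D: ring_ideal Ok' d
  by unfold_locales (rule d_ideal)

sublocale E: ring_ideal Ok d
  using submodule_on_mono[OF Ok_le] d_ideal A.m_le d_le_m by unfold_locales (auto simp: is_ideal_iff)

lemma cong_one_d_m: "cong_one d \<subseteq> cong_one m" and cong_one_m_m': "cong_one m \<subseteq> cong_one m'"
  using d_le_m m_le_m' by (auto simp: cong_one_def)

lemma J_d_m: "a \<in> Jstar Ok d \<Longrightarrow> a \<in> Jstar Ok m"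
  using cong_one_d_m unfolding A.Jstar_iff E.Jstar_iff by blast

lemma J_extend: "a \<in> Jstar Ok m \<Longrightarrow> mprod a Ok' \<in> Jstar Ok' m'"
proof -
  assume "a \<in> Jstar Ok m"
  then obtain b s t where
    a: "submodule_on Ok a" "submodule_on Ok b" "mprod a b = Ok" "s \<in> cong_one m" "\<forall>x\<in>a. s * x \<in> Ok"
       "t \<in> cong_one m" "t \<in> a" by (auto simp: A.Jstar_iff)
  have "mprod (mprod a Ok') (mprod b Ok') = mprod (mprod a b) (mprod Ok' Ok')"
    by (metis mprod_assoc mprod_commute)
  also have "\<dots> = mprod Ok Ok'" using a by (simp add: B.mprod_R B.submodule_on_self)
  also have "\<dots> = Ok'"
    using A.R_mprod[OF submodule_on_mono[OF Ok_le B.submodule_on_self]] .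
  finally have inv: "mprod (mprod a Ok') (mprod b Ok') = Ok'" .
  have "s * x \<in> Ok'" if "x \<in> mprod a Ok'" for x
    using that
  proof (induction rule: mprod_induct)
    case (prod x y)
    then have "(s * x) * y \<in> Ok'" using a(5) Ok_le B.mult_mem by blast
    then show ?case by (simp add: mult_ac)
  qed (auto simp: distrib_left intro: B.zero_mem B.add_mem)
  moreover have "t \<in> mprod a Ok'" using mprodI[OF a(7) B.one_mem] by simp
  moreover have "submodule_on Ok' (mprod a Ok')" "submodule_on Ok' (mprod b Ok')"
    using submodule_on_mprod_right[OF B.submodule_on_self] by auto
  moreover have "s \<in> cong_one m'" "t \<in> cong_one m'" using a cong_one_m_m' by auto
  ultimately show ?thesis using inv unfolding B.Jstar_iff by blast
qed

lemma mprod_extend: "mprod (mprod a b) Ok' = mprod (mprod a Ok') (mprod b Ok')"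
proof -
  have "mprod (mprod a Ok') (mprod b Ok') = mprod (mprod a b) (mprod Ok' Ok')"
    by (metis mprod_assoc mprod_commute)
  then show ?thesis by (simp add: B.mprod_R B.submodule_on_self)
qed

lemma scale_extend: "mprod ((*) x ` Ok) Ok' = (*) x ` Ok'"
  using A.R_mprod[OF submodule_on_mono[OF Ok_le B.submodule_on_self]] by (simp add: mprod_scale)

text \<open>Split \<open>z \<in> a\<close> as \<open>t * z - (t - 1) * z\<close>. Here
  \<open>t\<close> lies in \<open>a \<inter> Ok\<close> since \<open>d \<subseteq> Ok\<close>, and
  \<open>(t - 1) * z\<close> lies in both \<open>d\<close> and \<open>a\<close>, hence in
  \<open>a \<inter> Ok\<close>.\<close>

lemma contract_extend:
  assumes "submodule_on Ok' a" "a \<subseteq> Ok'" "t \<in> a" "t - 1 \<in> d"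
  shows "mprod (a \<inter> Ok) Ok' = a"
proof
  show "mprod (a \<inter> Ok) Ok' \<subseteq> a"
    by (rule mprod_subsetI) (auto intro: submodule_onD[OF assms(1)])
  show "a \<subseteq> mprod (a \<inter> Ok) Ok'"
  proof
    fix z assume z: "z \<in> a"
    have tO: "t \<in> Ok" using E.m_le assms(4) A.add_mem[of "t - 1" 1] A.one_mem by auto
    have "t * z \<in> mprod (a \<inter> Ok) Ok'" using assms tO z by (intro mprodI) auto
    moreover have "(t - 1) * z \<in> d" "(t - 1) * z \<in> a"
      using assms z submodule_onD[OF D.m_sub] submodule_onD(3)[OF assms(1) _ z] E.m_le Ok_le by auto
    then have "- ((t - 1) * z) * 1 \<in> mprod (a \<inter> Ok) Ok'"
      using B.one_mem E.m_le B.sub_neg[OF D.m_sub] B.sub_neg[OF assms(1)] by (intro mprodI) blast+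
    ultimately have "t * z + - ((t - 1) * z) * 1 \<in> mprod (a \<inter> Ok) Ok'" by (rule mprod_add)
    then show "z \<in> mprod (a \<inter> Ok) Ok'" by (simp add: algebra_simps)
  qed
qed

text \<open>For \<open>z\<close> in the right-hand side use
  \<open>z = t * z + z * (1 - t) * u + z * (1 - t) * (1 - u)\<close>. The first two terms are
  products of one element from each contraction, as \<open>z\<close> itself lies in
  \<open>a\<close>, \<open>b\<close> and \<open>Ok\<close>. For the last, expand \<open>z\<close>
  into products \<open>v * w\<close>: then \<open>v * (1 - t)\<close> and \<open>w * (1 - u)\<close>
  lie in \<open>d\<close>, so in \<open>Ok\<close>.\<close>

lemma contract_mult:
  assumes a: "submodule_on Ok' a" "a \<subseteq> Ok'" "t \<in> a" "t - 1 \<in> d"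
    and b: "submodule_on Ok' b" "b \<subseteq> Ok'" "u \<in> b" "u - 1 \<in> d"
  shows "mprod (a \<inter> Ok) (b \<inter> Ok) = mprod a b \<inter> Ok"
proof
  show "mprod (a \<inter> Ok) (b \<inter> Ok) \<subseteq> mprod a b \<inter> Ok"
    by (rule mprod_subsetI) (auto intro: mprodI mprod_zero mprod_add A.zero_mem A.mult_mem A.add_mem)
  show "mprod a b \<inter> Ok \<subseteq> mprod (a \<inter> Ok) (b \<inter> Ok)" (is "_ \<subseteq> ?M")
  proof
    fix z assume z: "z \<in> mprod a b \<inter> Ok"
    have tu: "t \<in> Ok" "u \<in> Ok"
      using E.m_le assms(4,8) A.add_mem[of "t - 1" 1] A.add_mem[of "u - 1" 1] A.one_mem by auto
    have za: "z \<in> a" 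
    proof -
      have "mprod a b \<subseteq> a" using b(2) by (intro mprod_subsetI) (auto intro: submodule_onD[OF a(1)])
      then show ?thesis using z by auto
    qed
    have zb: "z \<in> b" 
    proof -
      have "mprod a b \<subseteq> b" using a(2) by (intro mprod_subsetI) (auto intro: submodule_onD[OF b(1)])
      then show ?thesis using z by auto
    qed
    have 1: "t * z \<in> ?M" using z zb a tu by (intro mprodI) auto
    have ad: "x * (1 - t) \<in> a \<inter> Ok" if "x \<in> a" for x
    proof -
      have "- (t - 1) \<in> d" using B.sub_neg[OF D.m_sub a(4)] .
      then have "1 - t \<in> d" "1 - t \<in> Ok'" using D.m_le by auto
      then show ?thesis using that submodule_onD(3)[OF D.m_sub, of x "1 - t"] E.m_le a(2)
         submodule_onD(4)[OF a(1)] by blast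
    qed
    have bd: "x * (1 - u) \<in> b \<inter> Ok" if "x \<in> b" for x
    proof -
      have "- (u - 1) \<in> d" using B.sub_neg[OF D.m_sub b(4)] .
      then have "1 - u \<in> d" "1 - u \<in> Ok'" using D.m_le by auto
      then show ?thesis using that submodule_onD(3)[OF D.m_sub, of x "1 - u"] E.m_le b(2)
         submodule_onD(4)[OF b(1)] by blast
    qed
    have 2: "z * (1 - t) * u \<in> ?M" using ad[OF za] b tu by (intro mprodI) auto
    have 3: "x * ((1 - t) * (1 - u)) \<in> ?M" if "x \<in> mprod a b" for x
      using that
    proof (induction rule: mprod_induct)
      case (prod v w)
      then have "(v * (1 - t)) * (w * (1 - u)) \<in> ?M" by (intro mprodI ad bd)
      then show ?case by (simp add: mult_ac)
    qed (auto simp: distrib_right intro: mprod_zero mprod_add)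
    have "t * z + (z * (1 - t) * u + z * ((1 - t) * (1 - u))) \<in> ?M"
      using 1 2 3[of z] z by (intro mprod_add) auto
    then show "z \<in> ?M" by (simp add: algebra_simps)
  qed
qed

text \<open>If \<open>x * w \<in> Ok\<close>, then \<open>w = y * (x * w) - (x * y - 1) * w\<close>,
  and the correction lies in \<open>d \<subseteq> Ok\<close> even though \<open>w\<close> is only
  known to lie in \<open>Ok'\<close>.\<close>

lemma scale_contract:
  assumes "x \<in> Ok" "y \<in> Ok" "x * y - 1 \<in> d"
  shows "(*) x ` Ok' \<inter> Ok = (*) x ` Ok"
proof
  show "(*) x ` Ok' \<inter> Ok \<subseteq> (*) x ` Ok"
  proof safe
    fix w assume w: "w \<in> Ok'" "x * w \<in> Ok"
    have "(x * y - 1) * w \<in> Ok" using submodule_onD(4)[OF D.m_sub w(1) assms(3)] E.m_le by auto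
    then have "y * (x * w) - (x * y - 1) * w \<in> Ok" using assms w A.mult_mem A.diff_mem by blast
    then have "w \<in> Ok" by (simp add: algebra_simps)
    then show "x * w \<in> (*) x ` Ok" by (rule imageI)
  qed
  show "(*) x ` Ok \<subseteq> (*) x ` Ok' \<inter> Ok" using assms Ok_le A.mult_mem by auto
qed

text \<open>The inverse \<open>b\<close> of \<open>a\<close> need not be integral, so it cannot be
  contracted directly. But \<open>t b\<close> is contained in \<open>Ok'\<close>, and it contains
  \<open>t\<close> because \<open>a \<subseteq> Ok'\<close> forces \<open>1 \<in> b\<close>.
  Contracting \<open>t b\<close>, multiplying by \<open>contract_mult\<close> and dividing by
  \<open>t\<close> again gives an inverse of \<open>a \<inter> Ok\<close>.\<close>

lemma contract_in_J:
  assumes "a \<in> Jstar Ok' d" "a \<subseteq> Ok'"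
  shows "a \<inter> Ok \<in> Jstar Ok d"
proof -
  obtain b t where a: "submodule_on Ok' a" and b: "submodule_on Ok' b" "mprod a b = Ok'"
    and t: "t \<in> cong_one d" "t \<in> a" using assms(1) by (auto simp: D.Jstar_iff)
  have t0: "t \<noteq> 0" "t - 1 \<in> d" and tO: "t \<in> Ok" using t E.cong_one_mem by (auto simp: cong_one_def)
  have "mprod a b \<subseteq> b" using assms(2) by (intro mprod_subsetI) (auto intro: submodule_onD[OF b(1)])
  then have "1 \<in> b" using b B.one_mem by auto
  then have tb: "t \<in> (*) t ` b" by (intro image_eqI[of _ _ 1]) auto
  have tbO: "(*) t ` b \<subseteq> Ok'" using b(2) t by (auto intro: mprodI)
  have "mprod (a \<inter> Ok) ((*) t ` b \<inter> Ok) = mprod a ((*) t ` b) \<inter> Ok"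
    by (rule contract_mult[OF a assms(2) t(2) t0(2) submodule_on_scale[OF b(1)] tbO tb t0(2)])
  also have "mprod a ((*) t ` b) = (*) t ` Ok'" using mprod_scale b(2) mprod_commute by metis
  also have "(*) t ` Ok' \<inter> Ok = (*) t ` Ok"
    using scale_contract[OF tO A.one_mem] t0 by simp
  finally have *: "mprod (a \<inter> Ok) ((*) t ` b \<inter> Ok) = (*) t ` Ok" .
  define c where "c = (*) (inverse t) ` ((*) t ` b \<inter> Ok)"
  have "mprod (a \<inter> Ok) c = (*) (inverse t) ` mprod (a \<inter> Ok) ((*) t ` b \<inter> Ok)"
    unfolding c_def using mprod_scale mprod_commute by metis
  then have "mprod (a \<inter> Ok) c = Ok" using t0 * by (simp add: scale_scale)
  moreover have "submodule_on Ok c" unfolding c_def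
    by (intro submodule_on_scale submodule_on_Int submodule_on_mono[OF Ok_le b(1)] A.submodule_on_self)
  moreover have "submodule_on Ok (a \<inter> Ok)"
    by (intro submodule_on_Int submodule_on_mono[OF Ok_le a] A.submodule_on_self)
  moreover have "\<forall>x\<in>a \<inter> Ok. 1 * x \<in> Ok" by simp
  ultimately show ?thesis
    unfolding E.Jstar_iff using t tO E.one_cong_one by blast
qed

text \<open>Since \<open>(1 - t) Ok' \<subseteq> d \<subseteq> Ok\<close>, multiplication by
  \<open>1 - t\<close> carries the extension of \<open>a\<close> back into \<open>a\<close>; for
  \<open>z \<in> Ok\<close> also \<open>z * t \<in> a\<close>, and the two add up to
  \<open>z\<close>.\<close>

lemma extend_contract:
  assumes "a \<in> Jstar Ok d" "a \<subseteq> Ok"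
  shows "mprod a Ok' \<inter> Ok = a"
proof
  obtain t where a: "submodule_on Ok a" and t: "t \<in> cong_one d" "t \<in> a"
    using assms(1) by (auto simp: E.Jstar_iff)
  show "a \<subseteq> mprod a Ok' \<inter> Ok" using assms(2) mprodI[OF _ B.one_mem] by fastforce
  have *: "(1 - t) * z \<in> a" if "z \<in> mprod a Ok'" for z
    using that
  proof (induction rule: mprod_induct)
    case (prod x y)
    have "- (t - 1) \<in> d" using t B.sub_neg[OF D.m_sub, of "t - 1"] by (simp add: cong_one_def)
    then have "1 - t \<in> d" by simp
    then have "(1 - t) * y \<in> Ok" using submodule_onD(4)[OF D.m_sub prod(2)] E.m_le by blast
    then have "((1 - t) * y) * x \<in> a" using submodule_onD(3)[OF a] prod by blast
    then show ?case by (simp add: mult_ac)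
  qed (auto simp: distrib_left intro: submodule_onD[OF a])
  show "mprod a Ok' \<inter> Ok \<subseteq> a"
  proof
    fix z assume z: "z \<in> mprod a Ok' \<inter> Ok"
    then have "z * t + (1 - t) * z \<in> a"
      using submodule_onD(2)[OF a submodule_onD(3)[OF a _ t(2)] *] by blast
    then show "z \<in> a" by (simp add: algebra_simps)
  qed
qed

end

section \<open>Moving an ideal inside its ray class\<close>

text \<open>A partition of unity modulo \<open>d\<close> subordinate to \<open>a\<close>: the \<open>x i\<close> behave like orthogonal idempotents
  supported where \<open>a i\<close> is a unit, with \<open>y i\<close> an inverse of \<open>a i\<close> there.\<close>

definition orthogonal_weights ::
  "'k::field set \<Rightarrow> 'k set \<Rightarrow> nat \<Rightarrow> (nat \<Rightarrow> 'k) \<Rightarrow> (nat \<Rightarrow> 'k) \<Rightarrow> (nat \<Rightarrow> 'k) \<Rightarrow> bool" where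
  "orthogonal_weights R d r a x y \<longleftrightarrow>
    (\<forall>i<r. x i \<in> R \<and> y i \<in> R \<and> (\<exists>g\<in>R. x i - a i * g \<in> d)) \<and>
    (\<forall>i<r. \<forall>j<r. i \<noteq> j \<longrightarrow> x i * y j \<in> d) \<and>
    (\<Sum>i<r. x i) - 1 \<in> d \<and> (\<Sum>i<r. x i * y i * a i) - 1 \<in> d"

text \<open>The third hypothesis says that every class in \<open>R / d\<close> has an idempotent
  power, as in a finite ring. Such a power of an element splits the ring into a factor where the
  element is a unit and one where it is nilpotent; in the second factor 1 minus the element is a
  unit. The modulus is generalized in the induction because the inner decomposition is needed only
  on one factor, that is, modulo the larger ideal annihilated by \<open>e\<close> modulo
  \<open>d\<close>.\<close>

lemma (in field_subring) orthogonal_decomposition: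
  fixes r :: nat
  assumes "submodule_on R d" "d \<subseteq> R" "\<forall>a\<in>R. \<exists>k\<ge>1. a ^ k * a ^ k - a ^ k \<in> d"
    and "\<forall>i<r. a i \<in> R" "(\<Sum>i<r. a i) - 1 \<in> d"
  shows "\<exists>x y. orthogonal_weights R d r a x y"
  using assms
proof (induction r arbitrary: a d)
  case 0
  then show ?case by (auto simp: orthogonal_weights_def)
next
  case (Suc r)
  note dS = Suc.prems(1)
  define A where "A = (\<Sum>i<r. a i)"
  define b where "b = a r"
  have A: "A \<in> R" unfolding A_def using Suc.prems by (intro sum_mem) auto
  have b: "b \<in> R" using Suc.prems by (auto simp: b_def)
  have Ab: "A + b - 1 \<in> d" using Suc.prems by (simp add: A_def b_def)
  obtain k where k: "k \<ge> 1" "A ^ k * A ^ k - A ^ k \<in> d" using Suc.prems(3) A by blast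
  define e where "e = A ^ k"
  define p where "p = A ^ (k - 1)"
  have e: "e \<in> R" "e * e - e \<in> d" and p: "p \<in> R" "A * p = e"
    using k A by (auto simp: e_def p_def power_mem power_Suc[symmetric] simp del: power_Suc)
  \<comment> \<open>\<open>e\<close> splits \<open>R / d\<close>: on its part \<open>a 0 + ... + a (r - 1)\<close> is a unit with inverse \<open>p\<close>, so the
    induction hypothesis applies modulo \<open>d'\<close>; on the complementary part \<open>a r\<close> is a unit.\<close>
  define d' where "d' = {y \<in> R. e * y \<in> d}"
  have d'1: "submodule_on R d'"
    unfolding submodule_on_def d'_def
    using submodule_onD[OF dS] zero_mem add_mem mult_mem
    by (auto simp: distrib_left mult.left_commute[of e])
  have d'2: "d' \<subseteq> R" by (auto simp: d'_def)
  have d'3: "\<forall>a\<in>R. \<exists>k\<ge>1. a ^ k * a ^ k - a ^ k \<in> d'"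
    using Suc.prems(2,3) submodule_onD(3)[OF dS e(1)] unfolding d'_def by blast
  have d'4: "\<forall>i<r. a i * p \<in> R" using Suc.prems p mult_mem by auto
  have d'5: "(\<Sum>i<r. a i * p) - 1 \<in> d'"
  proof -
    have "(\<Sum>i<r. a i * p) = e" unfolding p(2)[symmetric] A_def by (rule sum_distrib_right[symmetric])
    then show ?thesis using e one_mem diff_mem by (auto simp: d'_def right_diff_distrib)
  qed
  obtain x' y' where "orthogonal_weights R d' r (\<lambda>i. a i * p) x' y'"
    using Suc.IH[OF d'1 d'2 d'3 d'4 d'5] by blast
  then have xy: "\<forall>i<r. x' i \<in> R \<and> y' i \<in> R \<and> (\<exists>g\<in>R. x' i - (a i * p) * g \<in> d')"
    and orth: "\<forall>i<r. \<forall>j<r. i \<noteq> j \<longrightarrow> x' i * y' j \<in> d'"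
    and sums: "(\<Sum>i<r. x' i) - 1 \<in> d'" "(\<Sum>i<r. x' i * y' i * (a i * p)) - 1 \<in> d'"
    unfolding orthogonal_weights_def by blast+
  \<comment> \<open>The geometric sum inverts \<open>1 - A\<close>, hence \<open>a r\<close>, on the
    part where \<open>A\<close> is nilpotent.\<close>
  define G where "G = (\<Sum>j<k. A ^ j)"
  have G: "G \<in> R" "(1 - A) * G = 1 - e"
    using A by (auto simp: G_def e_def one_diff_power_eq intro: sum_mem power_mem)
  define x where "x i = (if i < r then e * x' i else 1 - e)" for i
  define y where "y i = (if i < r then e * y' i * p else (1 - e) * G)" for i
  have e1: "1 - e \<in> R" using e one_mem diff_mem by auto
  have ed': "e * z \<in> d" if "z \<in> d'" for z using that by (auto simp: d'_def)
  have "orthogonal_weights R d (Suc r) a x y"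
    unfolding orthogonal_weights_def
  proof (intro conjI allI impI)
    fix i assume i: "i < Suc r"
    show "x i \<in> R" "y i \<in> R" using xy e p G e1 by (auto simp: x_def y_def intro: mult_mem)
    show "\<exists>g\<in>R. x i - a i * g \<in> d"
    proof (cases "i < r")
      case True
      then obtain g where g: "g \<in> R" "x' i - (a i * p) * g \<in> d'" using xy by blast
      have "x i - a i * (e * p * g) = e * (x' i - (a i * p) * g)"
        using True by (simp add: x_def algebra_simps)
      then show ?thesis using g ed'[OF g(2)] e p mult_mem by metis
    next
      case False
      then have "x i = (1 - A) * G" "a i = b" using i G(2) by (auto simp: x_def b_def less_Suc_eq)
      then have "x i - a i * G = - ((A + b - 1) * G)" by (simp add: algebra_simps)
      then show ?thesis using G(1) sub_neg[OF dS submodule_onD(4)[OF dS G(1) Ab]] by metis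
    qed
  next
    fix i j assume ij: "i < Suc r" "j < Suc r" "i \<noteq> j"
    have e2: "e - e * e \<in> d" using sub_neg[OF dS e(2)] by simp
    consider "i < r" "j < r" | "i < r" "j = r" | "i = r" "j < r" using ij by linarith
    then show "x i * y j \<in> d"
    proof cases
      case 1
      then have "(e * p) * (e * (x' i * y' j)) \<in> d"
        using orth ij e p by (intro submodule_onD(3)[OF dS] ed' mult_mem) auto
      then show ?thesis using 1 by (simp add: x_def y_def mult_ac)
    next
      case 2
      then have "(x' i * G) * (e - e * e) \<in> d"
        using e2 xy G by (intro submodule_onD(3)[OF dS] mult_mem) auto
      then show ?thesis using 2 by (simp add: x_def y_def algebra_simps)
    next
      case 3
      then have "(y' j * p) * (e - e * e) \<in> d"
        using e2 xy p by (intro submodule_onD(3)[OF dS] mult_mem) auto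
      then show ?thesis using 3 by (simp add: x_def y_def algebra_simps)
    qed
  next
    have "(\<Sum>i<Suc r. x i) - 1 = e * ((\<Sum>i<r. x' i) - 1)"
      by (simp add: x_def sum_distrib_left[symmetric] algebra_simps)
    then show "(\<Sum>i<Suc r. x i) - 1 \<in> d" using ed'[OF sums(1)] by simp
  next
    define S where "S = (\<Sum>i<r. x' i * y' i * (a i * p))"
    have "(\<Sum>i<r. x i * y i * a i) = e * e * S"
      by (auto simp: x_def y_def S_def sum_distrib_left intro!: sum.cong)
    then have "(\<Sum>i<Suc r. x i * y i * a i) - 1 = e * e * S + (1 - e) * (1 - e) * (b * G) - 1"
      by (simp add: x_def y_def b_def)
    also have "b * G = (1 - e) + (A + b - 1) * G" using G(2) by (simp add: algebra_simps)
    \<comment> \<open>Regrouped around the three quantities known to lie in \<open>d\<close>; the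
      middle coefficient comes from
      \<open>e^2 + (1 - e)^3 - 1 = (3 - e) * (e^2 - e)\<close>.\<close>
    also have "e * e * S + (1 - e) * (1 - e) * ((1 - e) + (A + b - 1) * G) - 1 =
      e * (e * (S - 1)) + ((1 + 1 + (1 - e)) * (e * e - e) + ((1 - e) * (1 - e) * G) * (A + b - 1))"
      by (simp add: algebra_simps)
    also have "\<dots> \<in> d"
    proof (intro submodule_onD(2)[OF dS])
      show "e * (e * (S - 1)) \<in> d"
        unfolding S_def by (rule submodule_onD(3)[OF dS e(1) ed'[OF sums(2)]])
      show "(1 + 1 + (1 - e)) * (e * e - e) \<in> d"
        by (rule submodule_onD(3)[OF dS _ e(2)]) (intro add_mem one_mem e1)
      show "((1 - e) * (1 - e) * G) * (A + b - 1) \<in> d"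
        by (rule submodule_onD(3)[OF dS _ Ab]) (intro mult_mem e1 G(1))
    qed
    finally show "(\<Sum>i<Suc r. x i * y i * a i) - 1 \<in> d" .
  qed
  then show ?case by blast
qed

text \<open>At each embedding the multiple of \<open>v\<close> eventually dominates
  \<open>w\<close>, and finitely many embeddings allow a common bound. Beyond it two consecutive
  values differ by \<open>v \<noteq> 0\<close>, so one of them is nonzero even when
  \<open>\<Sigma>\<close> is empty. With \<open>v \<in> d\<close> this changes signs inside a
  residue class.\<close>

lemma sgn_shift:
  fixes \<Sigma> :: "('k::field \<Rightarrow> real) set"
  assumes "finite \<Sigma>" "\<And>\<rho>. \<rho> \<in> \<Sigma> \<Longrightarrow> real_emb \<rho>" "v \<noteq> 0"
  shows "\<exists>k::nat. w + of_nat k * v \<noteq> 0 \<and> (\<forall>\<rho>\<in>\<Sigma>. sgn (\<rho> (w + of_nat k * v)) = sgn (\<rho> v))"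
proof -
  have "\<forall>\<^sub>F k in sequentially. sgn (\<rho> (w + of_nat k * v)) = sgn (\<rho> v)" if "\<rho> \<in> \<Sigma>" for \<rho>
  proof -
    have \<rho>: "real_emb \<rho>" "\<rho> v \<noteq> 0" using that assms real_emb_eq_0_iff by auto
    obtain K :: nat where K: "\<bar>\<rho> w\<bar> / \<bar>\<rho> v\<bar> < K" using reals_Archimedean2 by blast
    have "sgn (\<rho> w + real k * \<rho> v) = sgn (\<rho> v)" if "k \<ge> K" for k
    proof -
      have "\<bar>\<rho> w\<bar> / \<bar>\<rho> v\<bar> < real k" using that K by linarith
      then have "\<bar>\<rho> w\<bar> < real k * \<bar>\<rho> v\<bar>" using \<rho> by (simp add: divide_less_eq)
      then show ?thesis using \<rho>(2) by (cases "\<rho> v > 0") (auto simp: sgn_if abs_if split: if_splits)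
    qed
    then show ?thesis
      unfolding eventually_sequentially using \<rho> by (auto simp: real_emb_simps real_emb_of_nat)
  qed
  then have "\<forall>\<^sub>F k in sequentially. \<forall>\<rho>\<in>\<Sigma>. sgn (\<rho> (w + of_nat k * v)) = sgn (\<rho> v)"
    using assms(1) by (simp add: eventually_ball_finite)
  then obtain K where K: "\<And>k. k \<ge> K \<Longrightarrow> \<forall>\<rho>\<in>\<Sigma>. sgn (\<rho> (w + of_nat k * v)) = sgn (\<rho> v)"
    unfolding eventually_sequentially by blast
  have "w + of_nat K * v \<noteq> 0 \<or> w + of_nat (Suc K) * v \<noteq> 0"
    using assms(3) by (auto simp: algebra_simps)
  then show ?thesis using K[OF le_refl] K[OF le_SucI[OF le_refl]] by blast
qed

text \<open>After scaling \<open>a\<close> to an integral ideal \<open>b\<close> with inverse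
  \<open>c\<close>, it suffices to find \<open>w \<in> c\<close> and \<open>v \<in> b\<close> with
  \<open>w * v\<close> congruent to 1 modulo \<open>d\<close>: then \<open>w b\<close> is integral
  and contains an element congruent to 1. A single element of \<open>c\<close> works because an
  invertible ideal is principal over a ring with finitely many maximal ideals; the orthogonal
  weights make this explicit and allow the congruence modulo \<open>m\<close> to be imposed at the
  same time.\<close>

lemma (in ring_ideal) move_ideal_coprime:
  fixes \<Sigma> :: "('k \<Rightarrow> real) set"
  assumes a: "a \<in> Jstar R m"
    and d: "is_ideal R d" "d \<subseteq> m" "\<forall>a\<in>R. \<exists>k\<ge>1. a ^ k * a ^ k - a ^ k \<in> d"
    and N: "of_nat N \<in> d" "(of_nat N :: 'k) \<noteq> 0"
    and \<Sigma>: "finite \<Sigma>" "\<And>\<rho>. \<rho> \<in> \<Sigma> \<Longrightarrow> real_emb \<rho>"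
  shows "\<exists>\<gamma>\<in>ray_elements \<Sigma>. (*) \<gamma> ` a \<in> Jstar R d \<and> (*) \<gamma> ` a \<subseteq> R"
proof -
  interpret D: ring_ideal R d by unfold_locales (rule d)
  obtain a' s0 t where
    a': "submodule_on R a" "submodule_on R a'" "mprod a a' = R" and
    s0: "s0 \<in> cong_one m" "\<forall>x\<in>a. s0 * x \<in> R" and t: "t \<in> cong_one m" "t \<in> a"
    using a by (auto simp: Jstar_iff)
  \<comment> \<open>A square, so that \<open>s\<close> is positive at every real embedding.\<close>
  define s where "s = s0 * s0"
  have s: "s \<in> cong_one m" "s \<noteq> 0" "\<And>x. x \<in> a \<Longrightarrow> s * x \<in> R"
    using s0 cong_one_mult[of s0 s0] cong_one_mem[of s0] mult_mem[of s0]
    by (auto simp: s_def cong_one_def mult.assoc)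
  define b where "b = (*) s ` a"
  define c where "c = (*) (inverse s) ` a'"
  have b: "submodule_on R b" "b \<subseteq> R" and c: "submodule_on R c"
    using s a' by (auto simp: b_def c_def submodule_on_scale)
  have bc: "mprod b c = R"
  proof -
    have "mprod b c = (*) s ` mprod a c" unfolding b_def by (rule mprod_scale)
    also have "mprod a c = mprod c a" by (rule mprod_commute)
    also have "(*) s ` mprod c a = (*) (s * inverse s) ` R" unfolding c_def mprod_scale scale_scale
      using a'(3) mprod_commute[of a a'] by simp
    finally show ?thesis using s by simp
  qed
  have prodR: "y * x \<in> R" "x * y \<in> R" if "x \<in> b" "y \<in> c" for x y
    using mprodI[OF that] bc by (auto simp: mult.commute)
  have c1: "1 \<in> c"
  proof -
    have "mprod b c \<subseteq> c" using b by (intro mprod_subsetI) (auto intro: submodule_onD[OF c])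
    then show ?thesis using bc one_mem by auto
  qed
  define u where "u = s * t"
  have u: "u \<in> b" "u \<in> cong_one m" "u \<in> R" "u - 1 \<in> m" "u \<noteq> 0"
    using s t cong_one_mult[of s t] cong_one_mem by (auto simp: u_def b_def cong_one_def)
  then have u1: "1 - u \<in> m" "1 - u \<in> R" using sub_neg[OF m_sub u(4)] m_le by auto
  have "1 \<in> mprod b c" using bc one_mem by simp
  then obtain n f g where fg: "\<forall>i<(n::nat). f i \<in> b \<and> g i \<in> c" "1 = (\<Sum>i<n. f i * g i)"
    unfolding mprod_def by auto
  \<comment> \<open>Origin of the family: \<open>1 = u + (1 - u) * 1\<close>, with the last
    \<open>1\<close> expanded as the sum of \<open>f i * g i\<close>. Index 0 carries the product
    \<open>1 * u\<close>.\<close>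
  define C where "C i = (case i of 0 \<Rightarrow> 1 | Suc j \<Rightarrow> (1 - u) * g j)" for i
  define F where "F i = (case i of 0 \<Rightarrow> u | Suc j \<Rightarrow> f j)" for i
  have CF: "C i \<in> c" "F i \<in> b" if "i < Suc n" for i
    using that fg c1 u submodule_onD(3)[OF c u1(2)] by (auto simp: C_def F_def split: nat.splits)
  have "(\<Sum>i<Suc n. C i * F i) = u + (1 - u) * (\<Sum>i<n. f i * g i)"
    unfolding sum.lessThan_Suc_shift by (simp add: C_def F_def sum_distrib_left mult_ac)
  then have sumCF: "(\<Sum>i<Suc n. C i * F i) - 1 \<in> d"
    unfolding fg(2)[symmetric] using submodule_onD(1)[OF D.m_sub] by simp
  have CFR: "\<forall>i<Suc n. C i * F i \<in> R" using prodR CF by blast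
  obtain x y where weights: "orthogonal_weights R d (Suc n) (\<lambda>i. C i * F i) x y"
    using orthogonal_decomposition[OF D.m_sub D.m_le d(3) CFR sumCF] by blast
  then have sums: "(\<Sum>i<Suc n. x i) - 1 \<in> d" "(\<Sum>i<Suc n. x i * y i * (C i * F i)) - 1 \<in> d"
    unfolding orthogonal_weights_def by blast+
  have xy: "x i \<in> R" "y i \<in> R" "\<exists>g\<in>R. x i - (C i * F i) * g \<in> d" if "i < Suc n" for i
    using weights that unfolding orthogonal_weights_def by blast+
  have orth: "x i * y j \<in> d" if "i < Suc n" "j < Suc n" "i \<noteq> j" for i j
    using weights that unfolding orthogonal_weights_def by blast
  \<comment> \<open>\<open>w\<close> generates the inverse \<open>c\<close> of \<open>b\<close> modulo \<open>d\<close>. The index 0 carries \<open>C 0 = 1\<close> and all other \<open>C i\<close> lie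
    in \<open>m c\<close>, which makes \<open>w\<close> congruent to 1.\<close>
  define w where "w = (\<Sum>i<Suc n. x i * C i)"
  define v where "v = (\<Sum>i<Suc n. y i * F i)"
  have w: "w \<in> c" unfolding w_def using xy CF by (intro sub_sum[OF c]) (auto intro: submodule_onD(3)[OF c])
  have v: "v \<in> b" unfolding v_def using xy CF by (intro sub_sum[OF b(1)]) (auto intro: submodule_onD(3)[OF b(1)])
  have wv: "w * v - 1 \<in> d"
  proof -
    have "w * v = (\<Sum>i<Suc n. \<Sum>j<Suc n. (x i * y j) * (C i * F j))"
      unfolding w_def v_def sum_product by (intro sum.cong refl) (simp add: mult_ac)
    also have "\<dots> = (\<Sum>i<Suc n. x i * y i * (C i * F i) + (\<Sum>j\<in>{..<Suc n} - {i}. (x i * y j) * (C i * F j)))"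
      using sum.remove[of "{..<Suc n}" i "\<lambda>j. (x i * y j) * (C i * F j)" for i]
      by (intro sum.cong refl) blast
    finally have "w * v - 1 = ((\<Sum>i<Suc n. x i * y i * (C i * F i)) - 1) +
       (\<Sum>i<Suc n. \<Sum>j\<in>{..<Suc n} - {i}. (x i * y j) * (C i * F j))"
      by (simp only: sum.distrib algebra_simps)
    also have "\<dots> \<in> d"
    proof (intro submodule_onD(2)[OF D.m_sub sums(2)] sub_sum[OF D.m_sub])
      fix i j assume "i \<in> {..<Suc n}" "j \<in> {..<Suc n} - {i}"
      then show "(x i * y j) * (C i * F j) \<in> d"
        using submodule_onD(4)[OF D.m_sub prodR(2)[OF CF(2,1)] orth] by (simp add: mult.commute[of "C i"])
    qed
    finally show ?thesis .
  qed
  \<comment> \<open>Modulo \<open>d\<close> the weight is a multiple of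
    \<open>C (Suc j) * F (Suc j)\<close> and so inherits the factor \<open>1 - u \<in> m\<close>. As
    the weights sum to 1, only \<open>x 0\<close> survives modulo \<open>m\<close>.\<close>
  have xm: "x (Suc j) \<in> m" if jn: "j < n" for j
  proof -
    obtain g' where g': "g' \<in> R" "x (Suc j) - (C (Suc j) * F (Suc j)) * g' \<in> d" using xy(3)[of "Suc j"] jn by blast
    have "(g j * f j * g') * (1 - u) \<in> m"
      using u1 fg that g' prodR mult_mem by (intro submodule_onD(3)[OF m_sub]) auto
    then have "(x (Suc j) - (C (Suc j) * F (Suc j)) * g') + (g j * f j * g') * (1 - u) \<in> m"
      using g' d by (intro submodule_onD(2)[OF m_sub]) auto
    then show ?thesis by (simp add: C_def F_def algebra_simps)
  qed
  have x0: "x 0 - 1 \<in> m"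
  proof -
    have "(\<Sum>i<Suc n. x i) - 1 \<in> m" using sums(1) d(2) by blast
    moreover have "(\<Sum>j<n. x (Suc j)) \<in> m" by (rule sub_sum[OF m_sub]) (use xm in auto)
    ultimately have "((\<Sum>i<Suc n. x i) - 1) - (\<Sum>j<n. x (Suc j)) \<in> m" by (rule sub_diff[OF m_sub])
    then show ?thesis unfolding sum.lessThan_Suc_shift by simp
  qed
  \<comment> \<open>\<open>w\<close> lies in \<open>c\<close> and need not be integral, so its
    congruence is read off from \<open>u * w\<close>, which is integral because
    \<open>u \<in> b\<close>.\<close>
  have uw: "u * w - 1 \<in> m"
  proof -
    have "u * w = u * x 0 + (\<Sum>j<n. (g j * u * (1 - u)) * x (Suc j))"
      unfolding w_def sum.lessThan_Suc_shift by (simp add: C_def distrib_left sum_distrib_left mult_ac)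
    then have "u * w - 1 = (u * x 0 - 1) + (\<Sum>j<n. (g j * u * (1 - u)) * x (Suc j))" by simp
    also have "\<dots> \<in> m"
    proof (intro submodule_onD(2)[OF m_sub] sub_sum[OF m_sub] submodule_onD(3)[OF m_sub])
      show "u * x 0 - 1 \<in> m" using u x0 cong_one_mult_diff by blast
      fix j assume "j \<in> {..<n}"
      then show "x (Suc j) \<in> m" "g j * u * (1 - u) \<in> R" using xm prodR fg u u1 mult_mem by auto
    qed
    finally show ?thesis .
  qed
  \<comment> \<open>Adding multiples of the positive integer \<open>N \<in> d\<close> makes
    \<open>w\<close> positive; since \<open>1 \<in> c\<close>, the result stays in
    \<open>c\<close>.\<close>
  obtain k where k: "w + of_nat k * of_nat N \<noteq> 0"
    "\<forall>\<rho>\<in>\<Sigma>. sgn (\<rho> (w + of_nat k * of_nat N)) = sgn (\<rho> (of_nat N))"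
    using sgn_shift[OF \<Sigma> N(2)] by blast
  define \<delta> where "\<delta> = (of_nat k * of_nat N :: 'k)"
  define w' where "w' = w + \<delta>"
  have \<delta>: "\<delta> \<in> d" "\<delta> \<in> R" using submodule_onD(3)[OF D.m_sub of_nat_mem N(1)] D.m_le by (auto simp: \<delta>_def)
  have w'0: "w' \<noteq> 0" using k by (simp add: w'_def \<delta>_def)
  have w'c: "w' \<in> c" using w submodule_onD(2)[OF c] submodule_onD(3)[OF c \<delta>(2) c1] by (simp add: w'_def)
  have w'v: "w' * v - 1 \<in> d"
  proof -
    have "(w * v - 1) + \<delta> * v \<in> d"
      using wv submodule_onD(4)[OF D.m_sub _ \<delta>(1)] v b by (intro submodule_onD(2)[OF D.m_sub]) auto
    then show ?thesis by (simp add: w'_def algebra_simps)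
  qed
  have uw': "u * w' \<in> cong_one m"
  proof -
    have "(u * w - 1) + u * \<delta> \<in> m"
      using uw submodule_onD(3)[OF m_sub u(3)] \<delta> d by (intro submodule_onD(2)[OF m_sub]) auto
    then have "u * w' - 1 \<in> m" by (simp add: w'_def algebra_simps)
    then show ?thesis using u(5) w'0 by (simp add: cong_one_def)
  qed
  define \<gamma> where "\<gamma> = w' * s"
  have \<gamma>eq: "\<gamma> = (u * w') / t" using t by (auto simp: u_def \<gamma>_def cong_one_def)
  have \<gamma>_ray: "\<gamma> \<in> ray_elements \<Sigma>"
    unfolding \<gamma>eq
  proof (rule ray_elementsI[OF uw' t(1)])
    fix \<rho> assume \<rho>: "\<rho> \<in> \<Sigma>"
    have "\<rho> w' > 0"
      using k(2) \<rho> \<Sigma>(2)[OF \<rho>] N(2) by (auto simp: w'_def \<delta>_def real_emb_of_nat sgn_if split: if_splits)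
    moreover have "\<rho> s > 0"
      using s0(1) \<Sigma>(2)[OF \<rho>] real_emb_eq_0_iff[OF \<Sigma>(2)[OF \<rho>], of s0] by (auto simp: s_def real_emb_simps cong_one_def zero_less_mult_iff)
    ultimately have "\<rho> \<gamma> > 0" using \<Sigma>(2)[OF \<rho>] by (simp add: \<gamma>_def real_emb_simps)
    then show "\<rho> (u * w' / t) > 0" by (simp add: \<gamma>eq)
  qed
  have \<gamma>a: "(*) \<gamma> ` a = (*) w' ` b" by (simp add: \<gamma>_def b_def scale_scale)
  have sub: "(*) w' ` b \<subseteq> R" using prodR w'c by auto
  have "(*) w' ` b \<in> Jstar R d"
  proof -
    have sm: "submodule_on R ((*) w' ` b)" using b by (simp add: submodule_on_scale)
    have "mprod ((*) w' ` b) ((*) (inverse w') ` c) = (*) w' ` mprod b ((*) (inverse w') ` c)"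
      by (rule mprod_scale)
    also have "mprod b ((*) (inverse w') ` c) = (*) (inverse w') ` mprod b c"
      using mprod_scale mprod_commute by metis
    finally have inv: "mprod ((*) w' ` b) ((*) (inverse w') ` c) = R"
      using w'0 bc by (simp add: scale_scale)
    have "\<exists>t\<in>cong_one d. t \<in> (*) w' ` b"
    proof (rule D.nonzero_cong_one[OF sm _ w'v])
      show "w' * v \<in> (*) w' ` b" "w' * u \<in> (*) w' ` b" using u v by auto
      show "w' * u \<noteq> 0" using w'0 u by simp
      show "w' * u \<in> R" using prodR w'c u by auto
    qed
    moreover have "\<forall>x\<in>(*) w' ` b. 1 * x \<in> R" using sub by auto
    ultimately show ?thesis
      unfolding D.Jstar_iff using sm inv submodule_on_scale[OF c] D.one_cong_one by blast
  qed
  then show ?thesis by (intro bexI[OF _ \<gamma>_ray]) (simp only: \<gamma>a sub simp_thms)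
qed

section \<open>Number fields\<close>

interpretation rat_vs: vector_space "\<lambda>q (x :: 'k::field_char_0). of_rat q * x"
  by unfold_locales (auto simp: algebra_simps of_rat_add of_rat_mult)

lemma qindep_inj:
  assumes "qindep b n"
  shows "inj_on b {..<n}"
proof (rule inj_onI, rule ccontr)
  fix i j assume ij: "i \<in> {..<n}" "j \<in> {..<n}" "b i = b j" "i \<noteq> j"
  define c :: "nat \<Rightarrow> rat" where "c k = (if k = i then 1 else if k = j then -1 else 0)" for k
  have "(\<Sum>k<n. of_rat (c k) * b k) = (\<Sum>k\<in>{i,j}. of_rat (c k) * b k)"
    using ij by (intro sum.mono_neutral_right) (auto simp: c_def)
  also have "\<dots> = 0" using ij by (simp add: c_def)
  finally have "c i = 0" using assms ij by (auto simp: qindep_def)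
  then show False by (simp add: c_def)
qed

lemma qindep_independent:
  assumes "qindep b n"
  shows "rat_vs.independent (b ` {..<n})"
proof (rule rat_vs.independent_if_scalars_zero)
  fix f x assume f: "(\<Sum>x\<in>b ` {..<n}. of_rat (f x) * x) = 0" and x: "x \<in> b ` {..<n}"
  have "(\<Sum>i<n. of_rat ((f \<circ> b) i) * b i) = 0"
    using f by (simp add: sum.reindex[OF qindep_inj[OF assms]])
  then have "\<forall>i<n. (f \<circ> b) i = 0" using assms unfolding qindep_def by blast
  then show "f x = 0" using x by auto
qed simp

lemma qspan_span: "qspan b n \<subseteq> rat_vs.span (b ` {..<n})"
  unfolding qspan_def by (blast intro: rat_vs.span_sum rat_vs.span_scale rat_vs.span_base)

lemma qindep_le:
  fixes b b' :: "nat \<Rightarrow> 'k::field_char_0"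
  assumes "qindep b n" "qspan b' n' = UNIV"
  shows "n \<le> n'"
proof -
  have "b ` {..<n} \<subseteq> rat_vs.span (b' ` {..<n'})" using assms(2) qspan_span[of b' n'] by auto
  then have "card (b ` {..<n}) \<le> card (b' ` {..<n'})"
    using rat_vs.independent_span_bound[OF _ qindep_independent[OF assms(1)]] by blast
  also have "card (b' ` {..<n'}) \<le> n'" using card_image_le[of "{..<n'}" b'] by simp
  finally show ?thesis using card_image[OF qindep_inj[OF assms(1)]] by simp
qed

lemma field_degree_eq:
  assumes "qindep (b :: nat \<Rightarrow> 'k::field_char_0) n" "qspan b n = UNIV"
  shows "field_degree TYPE('k) = n"
  unfolding field_degree_def
  by (rule the_equality) (use assms qindep_le in \<open>auto intro!: le_antisym\<close>)

text \<open>A vector outside the span would extend the family to \<open>n + 1\<close> independent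
  vectors in a space spanned by \<open>n\<close>.\<close>

lemma qindep_max_span:
  fixes b b' :: "nat \<Rightarrow> 'k::field_char_0"
  assumes "qindep b n" "qspan b' n = UNIV"
  shows "qspan b n = UNIV"
proof (rule ccontr)
  assume "qspan b n \<noteq> UNIV"
  then obtain x where x: "x \<notin> qspan b n" by blast
  have "qindep (b(n := x)) (Suc n)"
    unfolding qindep_def
  proof (intro allI impI)
    fix c :: "nat \<Rightarrow> rat" and i
    assume "(\<Sum>i<Suc n. of_rat (c i) * (b(n := x)) i) = 0" and i: "i < Suc n"
    then have eq: "(\<Sum>i<n. of_rat (c i) * b i) + of_rat (c n) * x = 0" by simp
    have "c n = 0"
    proof (rule ccontr)
      assume cn: "c n \<noteq> 0"
      then have "x = - (\<Sum>i<n. of_rat (c i) * b i) / of_rat (c n)"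
        using eq by (simp add: field_simps eq_neg_iff_add_eq_0)
      also have "\<dots> = (\<Sum>i<n. of_rat (- c i / c n) * b i)"
        by (simp add: sum_divide_distrib sum_negf[symmetric] of_rat_divide of_rat_minus del: sum_negf)
      finally show False using x unfolding qspan_def mem_Collect_eq by metis
    qed
    then show "c i = 0" using eq assms(1) i by (auto simp: qindep_def less_Suc_eq)
  qed
  then have "Suc n \<le> n" using assms(2) by (rule qindep_le)
  then show False by simp
qed

section \<open>Orders: full rank and finiteness modulo a nonzero ideal\<close>

lemma common_denominator:
  "\<exists>D>0. \<exists>z :: nat \<Rightarrow> int. \<forall>i<n. of_nat D * (c i :: rat) = of_int (z i)"
proof (induction n)
  case (Suc n)
  then obtain D z where D: "D > 0" "\<forall>i<n. of_nat D * c i = of_int (z i)" by blast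
  obtain a q where q: "c n = of_int a / of_int q" "q > 0" by (metis Rat_cases Fract_of_int_quotient)
  have eq: "of_nat (D * nat q) * c i = of_int ((if i < n then z i * q else of_nat D * a))" if "i < Suc n" for i
  proof -
    have "of_nat (D * nat q) * c i = (of_nat D * c i) * of_int q" using q(2) by simp
    moreover have "of_nat (D * nat q) * c n = of_int (int D * a)" using q by (simp add: field_simps)
    ultimately show ?thesis using D(2) that by (cases "i < n") (auto simp: less_Suc_eq)
  qed
  have "D * nat q > 0" using D q by simp
  with eq show ?case
    by (intro exI[of _ "D * nat q"] conjI exI[of _ "\<lambda>i. if i < n then z i * q else int D * a"] allI impI)
qed auto

lemma zindep_qindep:
  assumes "zindep b n"
  shows "qindep b n"
  unfolding qindep_def
proof (intro allI impI)
  fix c :: "nat \<Rightarrow> rat" and i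
  assume s: "(\<Sum>i<n. of_rat (c i) * b i) = 0" and i: "i < n"
  obtain D z where D: "D > 0" "\<forall>i<n. of_nat D * c i = of_int (z i)" using common_denominator by blast
  have "(\<Sum>i<n. of_int (z i) * b i) = (\<Sum>i<n. of_rat (of_nat D * c i) * b i)"
    using D(2) by (intro sum.cong refl) simp
  also have "\<dots> = of_nat D * (\<Sum>i<n. of_rat (c i) * b i)"
    by (simp add: of_rat_mult sum_distrib_left mult.assoc)
  finally have "z i = 0" using s assms i by (auto simp: zindep_def)
  then show "c i = 0" using D i by auto
qed

lemma order_field_subring: "nf_order R \<Longrightarrow> field_subring R"
  unfolding nf_order_def by unfold_locales auto

text \<open>Clearing denominators turns a Z-basis of the order into a Q-independent family; its size
  is the degree, so it spans the field, and clearing denominators of the coordinates of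
  \<open>x\<close> finishes.\<close>

lemma order_multiple:
  assumes "number_field TYPE('k::field_char_0)" "nf_order (R :: 'k set)"
  shows "\<exists>N>0. of_nat N * x \<in> R"
proof -
  let ?n = "field_degree TYPE('k)"
  obtain b where b: "zindep b ?n" "R = zspan b ?n" using assms(2) by (auto simp: nf_order_def)
  obtain b' :: "nat \<Rightarrow> 'k" where "qindep b' ?n" "qspan b' ?n = UNIV"
    using assms(1) field_degree_eq unfolding number_field_def by blast
  then have "x \<in> qspan b ?n" using qindep_max_span[OF zindep_qindep[OF b(1)]] by blast
  then obtain c where c: "x = (\<Sum>i<?n. of_rat (c i) * b i)" by (auto simp: qspan_def)
  obtain D z where D: "D > 0" "\<forall>i<?n. of_nat D * c i = of_int (z i)" using common_denominator by blast
  have "of_nat D * x = (\<Sum>i<?n. of_rat (of_nat D * c i) * b i)"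
    by (simp add: of_rat_mult sum_distrib_left mult.assoc c)
  also have "\<dots> = (\<Sum>i<?n. of_int (z i) * b i)"
    using D(2) by (intro sum.cong refl) simp
  finally have "of_nat D * x \<in> R" by (auto simp: b(2) zspan_def)
  then show ?thesis using D(1) by blast
qed

text \<open>Apply \<open>order_multiple\<close> to \<open>1 / x\<close> for a nonzero
  \<open>x \<in> d\<close> and multiply back by \<open>x\<close>.\<close>

lemma ideal_contains_nat:
  assumes "number_field TYPE('k::field_char_0)" "nf_order (R :: 'k set)" "submodule_on R d" "d \<noteq> {0}"
  shows "\<exists>N>0. of_nat N \<in> d"
proof -
  obtain x where x: "x \<in> d" "x \<noteq> 0" using assms(3,4) by (auto simp: submodule_on_def)
  obtain N where N: "N > 0" "of_nat N * (1 / x) \<in> R" using order_multiple[OF assms(1,2)] by blast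
  then have "of_nat N * (1 / x) * x \<in> d" using x submodule_onD(3)[OF assms(3)] by blast
  then show ?thesis using N x by auto
qed

text \<open>Coordinates modulo \<open>N\<close> take finitely many values, so two powers of
  \<open>a\<close> agree modulo \<open>d\<close> and the powers become periodic. A power whose
  exponent is a multiple of the period and lies in the periodic range equals its own square.\<close>

lemma idempotent_power:
  assumes R: "nf_order (R :: 'k::field_char_0 set)" "submodule_on R d" "of_nat N \<in> d" "N > 0" "a \<in> R"
  shows "\<exists>k\<ge>1. a ^ k * a ^ k - a ^ k \<in> d"
proof -
  interpret R: field_subring R using R(1) by (rule order_field_subring)
  obtain b n where b: "R = zspan b n" using R(1) by (auto simp: nf_order_def)
  have "\<forall>k. \<exists>c. a ^ k = (\<Sum>i<n. of_int (c i) * b i)"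
    using R.power_mem[OF R(5)] b by (auto simp: zspan_def)
  then obtain c where c: "\<And>k. a ^ k = (\<Sum>i<n. of_int (c k i) * b i)" by metis
  define r where "r k = (\<lambda>i\<in>{..<n}. c k i mod int N)" for k
  have "range r \<subseteq> {..<n} \<rightarrow>\<^sub>E {0..<int N}" using R(4) by (auto simp: r_def PiE_def extensional_def restrict_def)
  then have "finite (range r)" by (rule finite_subset) (auto intro: finite_PiE)
  then have "\<not> inj r" using finite_imageD by blast
  then obtain k l where kl: "k < l" "r k = r l" unfolding inj_def by (metis linorder_neqE_nat)
  have "a ^ l - a ^ k \<in> d"
  proof -
    have "\<exists>q. c l i - c k i = int N * q" if "i < n" for i
    proof -
      have "r l i = r k i" using kl by simp
      then have "c l i mod int N = c k i mod int N" using that by (simp add: r_def)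
      then show ?thesis by (metis mod_eq_dvd_iff dvd_def)
    qed
    then obtain q where q: "\<And>i. i < n \<Longrightarrow> c l i - c k i = int N * q i" by metis
    have "a ^ l - a ^ k = (\<Sum>i<n. of_int (c l i - c k i) * b i)"
      by (simp add: c sum_subtractf algebra_simps)
    also have "\<dots> = (\<Sum>i<n. of_int (int N * q i) * b i)" using q by (intro sum.cong refl) simp
    also have "\<dots> = (\<Sum>i<n. of_int (q i) * b i) * of_nat N"
      by (simp add: sum_distrib_right sum_distrib_left mult_ac)
    also have "\<dots> \<in> d"
      by (rule submodule_onD(3)[OF R(2) _ R(3)]) (auto simp: b zspan_def)
    finally show ?thesis .
  qed
  define p where "p = l - k"
  have p: "p \<ge> 1" using kl by (simp add: p_def)
  have step: "a ^ (j + p) - a ^ j \<in> d" if "j \<ge> k" for j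
  proof -
    have "a ^ (j - k) * (a ^ l - a ^ k) \<in> d"
      using R.power_mem[OF R(5)] \<open>a ^ l - a ^ k \<in> d\<close> by (rule submodule_onD(3)[OF R(2)])
    also have "a ^ (j - k) * (a ^ l - a ^ k) = a ^ (j + p) - a ^ j"
      using that kl by (simp add: p_def right_diff_distrib power_add[symmetric])
    finally show ?thesis .
  qed
  have steps: "a ^ (j + i * p) - a ^ j \<in> d" if "j \<ge> k" for i j
  proof (induction i)
    case 0
    then show ?case using submodule_onD(1)[OF R(2)] by simp
  next
    case (Suc i)
    have "(a ^ (j + i * p + p) - a ^ (j + i * p)) + (a ^ (j + i * p) - a ^ j) \<in> d"
      using step[of "j + i * p"] that Suc by (intro submodule_onD(2)[OF R(2)]) auto
    then show ?case by (simp add: algebra_simps)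
  qed
  \<comment> \<open>A multiple of the period \<open>p\<close> that is at least \<open>k\<close>; the
    factor \<open>Suc k\<close> keeps it positive when \<open>k = 0\<close>. Then
    \<open>2 * j\<close> is \<open>j\<close> plus a multiple of \<open>p\<close>.\<close>
  define j where "j = Suc k * p"
  have "Suc k * 1 \<le> j" unfolding j_def by (rule mult_le_mono2[OF p])
  then have "j \<ge> k" "j \<ge> 1" by auto
  moreover from this have "a ^ (j + Suc k * p) - a ^ j \<in> d" by (intro steps)
  then have "a ^ j * a ^ j - a ^ j \<in> d" unfolding j_def[symmetric] by (simp add: power_add)
  ultimately show ?thesis by blast
qed

section \<open>Real embeddings: finiteness and approximation of signs\<close>

lemma finite_real_emb:
  assumes "number_field TYPE('k::field_char_0)"
  shows "finite {\<rho> :: 'k \<Rightarrow> real. real_emb \<rho>}"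
proof -
  obtain n and b :: "nat \<Rightarrow> 'k" where b: "qindep b n" "qspan b n = UNIV"
    using assms by (auto simp: number_field_def)
  \<comment> \<open>The \<open>n + 1\<close> powers \<open>1, x, ..., x^n\<close> are dependent, so
    all values of embeddings at \<open>x\<close> are roots of one nonzero rational
    polynomial.\<close>
  have fin: "finite {\<rho> x |\<rho>. real_emb \<rho>}" for x :: 'k
  proof -
    have "\<not> qindep (\<lambda>i. x ^ i) (Suc n)" using qindep_le[OF _ b(2), of _ "Suc n"] by auto
    then obtain c where c: "(\<Sum>i<Suc n. of_rat (c i) * x ^ i) = 0" "\<exists>i<Suc n. c i \<noteq> 0"
      by (auto simp: qindep_def)
    have "(\<Sum>i\<le>n. of_rat (c i) * \<rho> x ^ i) = 0" if "real_emb \<rho>" for \<rho>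
    proof -
      have "\<rho> (\<Sum>i<Suc n. of_rat (c i) * x ^ i) = 0" unfolding c(1) using that by (simp add: real_emb_simps)
      then show ?thesis
        unfolding lessThan_Suc_atMost real_emb_sum[OF that]
        by (simp add: that real_emb_simps real_emb_of_rat real_emb_power)
    qed
    then have "{\<rho> x |\<rho>. real_emb \<rho>} \<subseteq> {t. (\<Sum>i\<le>n. of_rat (c i) * t ^ i) = 0}" by auto
    moreover have "finite {t::real. (\<Sum>i\<le>n. of_rat (c i) * t ^ i) = 0}"
      using c(2) by (subst polyfun_finite_roots) (auto simp: less_Suc_eq_le)
    ultimately show ?thesis by (rule finite_subset)
  qed
  \<comment> \<open>An embedding fixes the rationals and is therefore determined by its values on
    the basis.\<close>
  define F where "F \<rho> = (\<lambda>i\<in>{..<n}. \<rho> (b i))" for \<rho> :: "'k \<Rightarrow> real"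
  have "F ` {\<rho>. real_emb \<rho>} \<subseteq> Pi\<^sub>E {..<n} (\<lambda>i. {\<rho> (b i) |\<rho>. real_emb \<rho>})" by (auto simp: F_def PiE_def extensional_def restrict_def)
  then have "finite (F ` {\<rho>. real_emb \<rho>})" by (rule finite_subset) (auto intro!: finite_PiE fin)
  moreover have "inj_on F {\<rho>. real_emb \<rho>}"
  proof (rule inj_onI, rule ext)
    fix \<rho> \<tau> :: "'k \<Rightarrow> real" and x
    assume e: "\<rho> \<in> {\<rho>. real_emb \<rho>}" "\<tau> \<in> {\<rho>. real_emb \<rho>}" "F \<rho> = F \<tau>"
    have eq: "\<rho> (b i) = \<tau> (b i)" if "i < n" for i using fun_cong[OF e(3), of i] that by (simp add: F_def)
    obtain c where "x = (\<Sum>i<n. of_rat (c i) * b i)" using b(2) by (auto simp: qspan_def set_eq_iff)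
    then show "\<rho> x = \<tau> x"
      using e by (auto simp: real_emb_sum real_emb_simps real_emb_of_rat eq intro!: sum.cong)
  qed
  ultimately show ?thesis by (rule finite_imageD)
qed

text \<open>Scale an element on which the embeddings differ until the values are more than 2 apart,
  then subtract an integer that brings the value at \<open>\<tau>\<close> into
  \<open>[0, 1)\<close>. The value at \<open>\<rho>\<close> has absolute value above 1, and squaring
  makes it positive.\<close>

lemma separate_two_embeddings:
  assumes "real_emb \<rho>" "real_emb \<tau>" "\<rho> \<noteq> \<tau>"
  shows "\<exists>y. \<rho> y > 1 \<and> \<bar>\<tau> y\<bar> < 1"
proof -
  obtain \<theta> where \<theta>: "\<rho> \<theta> \<noteq> \<tau> \<theta>" using assms(3) by auto
  obtain M :: nat where "2 / \<bar>\<rho> \<theta> - \<tau> \<theta>\<bar> < M" using reals_Archimedean2 by blast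
  then have M: "2 < M * \<bar>\<rho> \<theta> - \<tau> \<theta>\<bar>" using \<theta> by (simp add: divide_less_eq)
  define z where "z = of_nat M * \<theta> - of_int \<lfloor>M * \<tau> \<theta>\<rfloor>"
  have "\<rho> z - \<tau> z = M * (\<rho> \<theta> - \<tau> \<theta>)"
    using assms by (simp add: z_def real_emb_simps real_emb_of_nat real_emb_of_int algebra_simps)
  then have "\<bar>\<rho> z - \<tau> z\<bar> > 2" using M by (simp add: abs_mult)
  moreover have t: "\<bar>\<tau> z\<bar> < 1"
    using assms by (simp add: z_def real_emb_simps real_emb_of_nat real_emb_of_int) linarith
  ultimately have "\<bar>\<rho> z\<bar> > 1" by linarith
  then have "\<rho> (z ^ 2) > 1"
    using assms power_strict_mono[of 1 "\<bar>\<rho> z\<bar>" 2] by (simp add: real_emb_power)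
  moreover have "\<bar>\<tau> (z ^ 2)\<bar> < 1"
    using assms t power_strict_mono[of "\<bar>\<tau> z\<bar>" 1 2] by (simp add: real_emb_power)
  ultimately show ?thesis by blast
qed

text \<open>The induction of the Artin-Whaples approximation theorem. Taking powers of
  \<open>x^2\<close> instead of \<open>x\<close> keeps the denominators nonzero and the correcting
  factor between 0 and 1 at every real embedding, whatever the size of \<open>x\<close> at the new
  embedding \<open>\<tau>\<close>.\<close>

lemma separate_embeddings:
  assumes "finite T" "\<forall>\<tau>\<in>T. real_emb \<tau>" "real_emb \<rho>" "\<rho> \<notin> T"
  shows "\<exists>x. \<rho> x > 1 \<and> (\<forall>\<tau>\<in>T. \<bar>\<tau> x\<bar> < 1)"
  using assms
proof (induction T rule: finite_induct)
  case empty
  have "\<rho> (of_nat 2) > 1" using empty by (simp only: real_emb_of_nat)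
  then show ?case by blast
next
  case (insert \<tau> T)
  then obtain x where x: "\<rho> x > 1" "\<forall>\<sigma>\<in>T. \<bar>\<sigma> x\<bar> < 1" by auto
  obtain y where y: "\<rho> y > 1" "\<bar>\<tau> y\<bar> < 1"
    using separate_two_embeddings[of \<rho> \<tau>] insert.prems by auto
  \<comment> \<open>the factor of \<open>y\<close> tends to 1 at \<open>\<rho>\<close>, to 0 on \<open>T\<close>, and never exceeds 1\<close>
  define z where "z k = (x ^ 2) ^ k / (1 + (x ^ 2) ^ k) * y" for k :: nat
  have z: "\<sigma> (z k) = ((\<sigma> x)\<^sup>2) ^ k / (1 + ((\<sigma> x)\<^sup>2) ^ k) * \<sigma> y" if "real_emb \<sigma>" for \<sigma> k
    using that by (simp add: z_def real_emb_simps(1,2,3) real_emb_divide real_emb_power)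
  have "\<forall>\<^sub>F k in sequentially. \<rho> (z k) > 1"
  proof -
    have x2: "(\<rho> x)\<^sup>2 > 1" using x(1) by (simp add: one_less_power)
    have "(\<lambda>k. inverse ((\<rho> x)\<^sup>2) ^ k) \<longlonglongrightarrow> 0"
      by (rule LIMSEQ_power_zero) (use x2 in \<open>simp add: inverse_less_1_iff\<close>)
    then have "(\<lambda>k. 1 / (1 + inverse ((\<rho> x)\<^sup>2) ^ k) * \<rho> y) \<longlonglongrightarrow> 1 / (1 + 0) * \<rho> y"
      by (intro tendsto_mult tendsto_divide tendsto_add tendsto_const) auto
    then have "(\<lambda>k. 1 / (1 + inverse ((\<rho> x)\<^sup>2) ^ k) * \<rho> y) \<longlonglongrightarrow> \<rho> y" by simp
    moreover have "1 / (1 + inverse ((\<rho> x)\<^sup>2) ^ k) * \<rho> y = \<rho> (z k)" for k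
    proof -
      have "((\<rho> x)\<^sup>2) ^ k > 0" using x(1) by simp
      then have "1 / (1 + inverse (((\<rho> x)\<^sup>2) ^ k)) = ((\<rho> x)\<^sup>2) ^ k / (1 + ((\<rho> x)\<^sup>2) ^ k)"
        by (simp add: divide_simps del: power_mult power_eq_0_iff zero_less_power2)
      then show ?thesis unfolding z[OF insert.prems(2)] power_inverse by simp
    qed
    ultimately show ?thesis using y(1) by (auto elim: order_tendstoD)
  qed
  moreover have "\<forall>\<^sub>F k in sequentially. \<forall>\<sigma>\<in>T. \<bar>\<sigma> (z k)\<bar> < 1"
    using insert.hyps(1)
  proof (rule eventually_ball_finite, intro ballI)
    fix \<sigma> assume \<sigma>: "\<sigma> \<in> T"
    then have x2: "(\<sigma> x)\<^sup>2 < 1" using x(2) by (simp add: abs_square_less_1)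
    have "(\<lambda>k. ((\<sigma> x)\<^sup>2) ^ k) \<longlonglongrightarrow> 0" by (rule LIMSEQ_power_zero) (use x2 in simp)
    then have "(\<lambda>k. \<bar>((\<sigma> x)\<^sup>2) ^ k / (1 + ((\<sigma> x)\<^sup>2) ^ k) * \<sigma> y\<bar>) \<longlonglongrightarrow> \<bar>0 / (1 + 0) * \<sigma> y\<bar>"
      by (intro tendsto_rabs tendsto_mult tendsto_divide tendsto_add tendsto_const) auto
    then have "(\<lambda>k. \<bar>\<sigma> (z k)\<bar>) \<longlonglongrightarrow> 0"
      using z[of \<sigma>] \<sigma> insert.prems(1) by (simp only: insert_iff simp_thms ball_simps) simp
    then show "\<forall>\<^sub>F k in sequentially. \<bar>\<sigma> (z k)\<bar> < 1" by (rule order_tendstoD) simp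
  qed
  ultimately have "\<forall>\<^sub>F k in sequentially. \<rho> (z k) > 1 \<and> (\<forall>\<sigma>\<in>T. \<bar>\<sigma> (z k)\<bar> < 1)"
    by (rule eventually_conj)
  then obtain k where k: "\<rho> (z k) > 1" "\<forall>\<sigma>\<in>T. \<bar>\<sigma> (z k)\<bar> < 1"
    by (auto simp: eventually_sequentially)
  have "\<bar>\<tau> (z k)\<bar> < 1"
  proof -
    have le: "\<bar>X / (1 + X)\<bar> \<le> 1" if "0 \<le> X" for X :: real using that by (simp add: divide_le_eq)
    have "\<bar>((\<tau> x)\<^sup>2) ^ k / (1 + ((\<tau> x)\<^sup>2) ^ k)\<bar> \<le> 1" by (intro le) simp
    then have "\<bar>((\<tau> x)\<^sup>2) ^ k / (1 + ((\<tau> x)\<^sup>2) ^ k)\<bar> * \<bar>\<tau> y\<bar> \<le> 1 * \<bar>\<tau> y\<bar>"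
      by (rule mult_right_mono) simp
    moreover have "real_emb \<tau>" using insert.prems(1) by simp
    ultimately have "\<bar>\<tau> (z k)\<bar> \<le> 1 * \<bar>\<tau> y\<bar>" by (simp only: z abs_mult)
    then show ?thesis using y by simp
  qed
  then show ?case using k by auto
qed

text \<open>If \<open>x\<close> is large at \<open>\<sigma>\<close> and small elsewhere, then
  \<open>1 - x\<close> is negative exactly at \<open>\<sigma>\<close>. A product of such factors,
  one for each prescribed minus sign, has the required signs.\<close>

lemma sign_approximation:
  fixes S :: "('k::field \<Rightarrow> real) set"
  assumes "finite S" "\<forall>\<rho>\<in>S. real_emb \<rho>" "\<forall>\<rho>\<in>S. \<epsilon> \<rho> = 1 \<or> \<epsilon> \<rho> = -1"
  shows "\<exists>u. u \<noteq> 0 \<and> (\<forall>\<rho>\<in>S. sgn (\<rho> u) = \<epsilon> \<rho>)"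
proof -
  have "\<exists>u. u \<noteq> 0 \<and> (\<forall>\<rho>\<in>S. sgn (\<rho> u) = (if \<rho> \<in> F then -1 else 1))" if "finite F" "F \<subseteq> S" for F
    using that
  proof (induction F rule: finite_induct)
    case empty
    then show ?case using assms(2) by (auto simp: real_emb_simps intro!: exI[of _ 1])
  next
    case (insert \<sigma> F)
    from insert.prems have "F \<subseteq> S" by simp
    from insert.IH[OF this] obtain u where u: "u \<noteq> 0" "\<forall>\<rho>\<in>S. sgn (\<rho> u) = (if \<rho> \<in> F then -1 else 1)"
      by blast
    obtain x where x: "\<sigma> x > 1" "\<forall>\<tau>\<in>S - {\<sigma>}. \<bar>\<tau> x\<bar> < 1"
      using separate_embeddings[of "S - {\<sigma>}" \<sigma>] assms insert.prems by auto
    have \<sigma>: "\<sigma> \<in> S" "real_emb \<sigma>" using insert.prems assms(2) by auto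
    have sg: "sgn (\<rho> (1 - x)) = (if \<rho> = \<sigma> then -1 else 1)" if "\<rho> \<in> S" for \<rho>
    proof -
      have "\<rho> (1 - x) = 1 - \<rho> x" using that assms(2) by (simp add: real_emb_simps)
      moreover have "\<bar>\<rho> x\<bar> < 1" if "\<rho> \<noteq> \<sigma>" using x(2) that \<open>\<rho> \<in> S\<close> by blast
      ultimately show ?thesis using x(1) by (cases "\<rho> = \<sigma>") (auto simp: sgn_if)
    qed
    have "1 - x \<noteq> 0"
    proof
      assume "1 - x = 0"
      then have "\<sigma> (1 - x) = 0" using \<sigma> by (simp only: real_emb_simps(4))
      then show False using sg[OF \<sigma>(1)] by simp
    qed
    then have "(1 - x) * u \<noteq> 0" using u(1) by simp
    moreover have "sgn (\<rho> ((1 - x) * u)) = (if \<rho> \<in> insert \<sigma> F then -1 else 1)" if "\<rho> \<in> S" for \<rho>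
    proof -
      have "sgn (\<rho> ((1 - x) * u)) = sgn (\<rho> (1 - x)) * sgn (\<rho> u)"
        using assms(2) that by (simp only: real_emb_simps(3) sgn_mult)
      also have "sgn (\<rho> u) = (if \<rho> \<in> F then -1 else 1)" using u(2) that by blast
      finally show ?thesis unfolding sg[OF that] using insert.hyps(2) by auto
    qed
    ultimately show ?case by blast
  qed
  from this[of "{\<rho>\<in>S. \<epsilon> \<rho> = -1}"] obtain u
    where "u \<noteq> 0" "\<forall>\<rho>\<in>S. sgn (\<rho> u) = (if \<rho> \<in> {\<rho>\<in>S. \<epsilon> \<rho> = -1} then -1 else 1)"
    using assms(1) by auto
  then have "u \<noteq> 0 \<and> (\<forall>\<rho>\<in>S. sgn (\<rho> u) = \<epsilon> \<rho>)" using assms(3) by auto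
  then show ?thesis by blast
qed

section \<open>The exact sequence\<close>

text \<open>Representatives in \<open>R\<close> of the classes in \<open>resU\<close>, so that
  computations take place in the field. The sum \<open>isum I d\<close> is replaced by
  \<open>I\<close>, the two being equal for \<open>d \<subseteq> I\<close> in the cases
  used.\<close>

definition unit_reps :: "'k::field set \<Rightarrow> 'k set \<Rightarrow> 'k set \<Rightarrow> 'k set" where
  "unit_reps R d I = {x \<in> R. (\<exists>y\<in>R. x * y - 1 \<in> d) \<and> x - 1 \<in> I}"

section \<open>Units of the residue ring modulo \<open>d\<close>\<close>

context ring_ideal
begin

context
  fixes d
  assumes d_ideal: "is_ideal R d" and d_le: "d \<subseteq> m"
begin

lemma d_sub: "submodule_on R d" and d_sub_R: "d \<subseteq> R"
  using d_ideal by (auto simp: is_ideal_iff)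

lemma unit_repsD:
  assumes "x \<in> unit_reps R d m"
  shows "x \<in> R" "x - 1 \<in> m" "\<exists>y\<in>unit_reps R d m. x * y - 1 \<in> d"
proof -
  show x: "x \<in> R" "x - 1 \<in> m" using assms by (auto simp: unit_reps_def)
  obtain y where y: "y \<in> R" "x * y - 1 \<in> d" using assms by (auto simp: unit_reps_def)
  then have "y - 1 \<in> m" using cong_one_cancel[of x y] x d_le by blast
  moreover have "y * x - 1 \<in> d" using y(2) by (simp add: mult.commute)
  ultimately show "\<exists>y\<in>unit_reps R d m. x * y - 1 \<in> d" using x y by (auto simp: unit_reps_def)
qed

lemma unit_reps_cong:
  assumes "x \<in> unit_reps R d m" "z - x \<in> d"
  shows "z \<in> unit_reps R d m"
proof -
  obtain y where y: "y \<in> R" "x * y - 1 \<in> d" using assms by (auto simp: unit_reps_def)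
  have x: "x \<in> R" "x - 1 \<in> m" using unit_repsD assms by auto
  have "z - x \<in> R" using assms(2) d_sub_R by blast
  then have "(z - x) + x \<in> R" using x(1) by (rule add_mem)
  moreover have "z * y - 1 \<in> d"
  proof -
    have "(z - x) * y + (x * y - 1) \<in> d"
      by (rule submodule_onD(2)[OF d_sub submodule_onD(4)[OF d_sub y(1) assms(2)] y(2)])
    then show ?thesis by (simp add: algebra_simps)
  qed
  moreover have "(z - x) + (x - 1) \<in> m" using submodule_onD(2)[OF m_sub _ x(2)] assms(2) d_le by blast
  ultimately show ?thesis using y(1) unfolding unit_reps_def by auto
qed

lemma unit_reps_mult:
  assumes "x \<in> unit_reps R d m" "y \<in> unit_reps R d m"
  shows "x * y \<in> unit_reps R d m"
proof -
  obtain x' y' where *: "x' \<in> R" "x * x' - 1 \<in> d" "y' \<in> R" "y * y' - 1 \<in> d" "x \<in> R" "y \<in> R"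
    "x - 1 \<in> m" "y - 1 \<in> m"
    using assms by (auto simp: unit_reps_def)
  interpret D: ring_ideal R d by unfold_locales (rule d_ideal)
  have "(x * x') * (y * y') - 1 \<in> d" by (rule D.cong_one_mult_diff[OF *(2,4)])
  then have "(x * y) * (x' * y') - 1 \<in> d" by (simp add: mult_ac)
  moreover have "x * y \<in> R" "x' * y' \<in> R" "x * y - 1 \<in> m"
    using * mult_mem cong_one_mult_diff by auto
  ultimately show ?thesis unfolding unit_reps_def by blast
qed

lemma one_unit_reps: "1 \<in> unit_reps R d m"
  using one_mem submodule_onD(1)[OF d_sub] submodule_onD(1)[OF m_sub] by (auto simp: unit_reps_def intro!: bexI[of _ 1])

lemma rcls_eq_iff: "rcls d x = rcls d y \<longleftrightarrow> x - y \<in> d"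
proof
  assume "rcls d x = rcls d y"
  moreover have "x \<in> rcls d x" using submodule_onD(1)[OF d_sub] by (force simp: rcls_def)
  ultimately show "x - y \<in> d" by (auto simp: rcls_def)
next
  have *: "rcls d x \<subseteq> rcls d y" if "x - y \<in> d" for x y
  proof
    fix z assume "z \<in> rcls d x"
    then obtain e where e: "e \<in> d" "z = x + e" by (auto simp: rcls_def)
    then have "z = y + ((x - y) + e)" by simp
    then show "z \<in> rcls d y" unfolding rcls_def using submodule_onD(2)[OF d_sub that e(1)] by (rule image_eqI)
  qed
  assume "x - y \<in> d"
  moreover from this have "y - x \<in> d" using sub_neg[OF d_sub, of "x - y"] by simp
  ultimately show "rcls d x = rcls d y" using * by blast
qed

lemma resU_eq: "resU R d m = rcls d ` unit_reps R d m"
proof -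
  have "isum m d = m"
  proof
    show "isum m d \<subseteq> m" using d_le submodule_onD(2)[OF m_sub] by (auto simp: isum_def)
    show "m \<subseteq> isum m d"
    proof
      fix x assume "x \<in> m"
      then have "x + 0 \<in> isum m d" using submodule_onD(1)[OF d_sub] unfolding isum_def by blast
      then show "x \<in> isum m d" by simp
    qed
  qed
  then show ?thesis by (auto simp: resU_def unit_reps_def)
qed

text \<open>The elementwise product of two cosets lies in a coset of \<open>d\<close> but need not
  fill it; the extra summand from \<open>d\<close> in \<open>resgrp\<close> makes it the full
  coset.\<close>

lemma resgrp_mult:
  assumes "x \<in> R" "y \<in> R"
  shows "rcls d x \<otimes>\<^bsub>resgrp d S\<^esub> rcls d y = rcls d (x * y)"
proof
  show "rcls d x \<otimes>\<^bsub>resgrp d S\<^esub> rcls d y \<subseteq> rcls d (x * y)"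
  proof
    fix z assume "z \<in> rcls d x \<otimes>\<^bsub>resgrp d S\<^esub> rcls d y"
    then obtain e1 e2 e where e: "e1 \<in> d" "e2 \<in> d" "e \<in> d" "z = (x + e1) * (y + e2) + e"
      by (auto simp: resgrp_def rcls_def)
    have "y + e2 \<in> R" using e(2) assms(2) d_sub_R by (intro add_mem) auto
    from submodule_onD(4)[OF d_sub this e(1)] have "e1 * (y + e2) \<in> d" .
    then have "x * e2 + (e1 * (y + e2) + e) \<in> d"
      by (rule submodule_onD(2)[OF d_sub submodule_onD(3)[OF d_sub assms(1) e(2)] submodule_onD(2)[OF d_sub _ e(3)]])
    moreover have "z = x * y + (x * e2 + (e1 * (y + e2) + e))" using e by (simp add: algebra_simps)
    ultimately show "z \<in> rcls d (x * y)" unfolding rcls_def by blast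
  qed
  show "rcls d (x * y) \<subseteq> rcls d x \<otimes>\<^bsub>resgrp d S\<^esub> rcls d y"
  proof
    fix z assume "z \<in> rcls d (x * y)"
    then obtain e where "e \<in> d" "z = x * y + e" by (auto simp: rcls_def)
    moreover have "x \<in> rcls d x" "y \<in> rcls d y" using submodule_onD(1)[OF d_sub] by (force simp: rcls_def)+
    ultimately show "z \<in> rcls d x \<otimes>\<^bsub>resgrp d S\<^esub> rcls d y" unfolding resgrp_def by auto
  qed
qed

lemma comm_group_resgrp: "comm_group (resgrp d (resU R d m))" (is "comm_group ?G")
proof -
  have car: "carrier ?G = rcls d ` unit_reps R d m" by (simp add: resgrp_def resU_eq)
  have one: "\<one>\<^bsub>?G\<^esub> = rcls d 1" by (simp add: resgrp_def)
  have m: "rcls d x \<otimes>\<^bsub>?G\<^esub> rcls d y = rcls d (x * y)" if "x \<in> unit_reps R d m" "y \<in> unit_reps R d m" for x y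
    using that unit_repsD(1) resgrp_mult by blast
  show ?thesis
  proof (rule comm_groupI)
    fix X assume "X \<in> carrier ?G"
    then obtain x where x: "x \<in> unit_reps R d m" "X = rcls d x" using car by auto
    then obtain y where y: "y \<in> unit_reps R d m" "x * y - 1 \<in> d" using unit_repsD(3) by blast
    have "rcls d y \<otimes>\<^bsub>?G\<^esub> X = \<one>\<^bsub>?G\<^esub>" using x y by (simp add: m one rcls_eq_iff mult.commute)
    then show "\<exists>Y\<in>carrier ?G. Y \<otimes>\<^bsub>?G\<^esub> X = \<one>\<^bsub>?G\<^esub>" using y car by blast
  qed (auto simp: car one m unit_reps_mult one_unit_reps mult_ac)
qed

end

end

section \<open>The residue groups of both orders\<close>

locale level_extension = level_pair Ok m Ok' m' d
  for Ok m Ok' m' d :: "'k::field_char_0 set" +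
  fixes \<Sigma> \<Sigma>' :: "('k \<Rightarrow> real) set"
  assumes nf: "number_field TYPE('k)" and orders: "nf_order Ok" "nf_order Ok'"
    and emb: "\<And>\<rho>. \<rho> \<in> \<Sigma> \<Longrightarrow> real_emb \<rho>" and Sigma_le: "\<Sigma>' \<subseteq> \<Sigma>" and d_nonzero: "d \<noteq> {0}"
begin

lemma emb': "\<rho> \<in> \<Sigma>' \<Longrightarrow> real_emb \<rho>"
  using emb Sigma_le by blast

lemma embs: "\<forall>\<rho>\<in>\<Sigma>. real_emb \<rho>" and embs': "\<forall>\<rho>\<in>\<Sigma>'. real_emb \<rho>"
  using emb emb' by auto

lemma finite_Sigma: "finite \<Sigma>" "finite \<Sigma>'"
proof -
  show "finite \<Sigma>" using finite_subset[OF _ finite_real_emb[OF nf]] emb by auto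
  then show "finite \<Sigma>'" using Sigma_le finite_subset by auto
qed

lemma d_le_m': "d \<subseteq> m'" using d_le_m m_le_m' by blast

lemma obtain_nat_in_d:
  obtains N where "of_nat N \<in> d" "N > 0"
  using ideal_contains_nat[OF nf orders(2) D.m_sub d_nonzero] by blast

lemma move_Ok:
  assumes "a \<in> Jstar Ok m"
  shows "\<exists>\<gamma>\<in>A.ray_elements \<Sigma>. (*) \<gamma> ` a \<in> Jstar Ok d \<and> (*) \<gamma> ` a \<subseteq> Ok"
proof -
  obtain N where N: "of_nat N \<in> d" "N > 0" by (rule obtain_nat_in_d)
  show ?thesis
    using idempotent_power[OF orders(1) E.m_sub N] N finite_Sigma emb
    by (intro A.move_ideal_coprime[OF assms E.ideal d_le_m]) auto
qed

lemma move_Ok':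
  assumes "a \<in> Jstar Ok' m'"
  shows "\<exists>\<gamma>\<in>B.ray_elements \<Sigma>'. (*) \<gamma> ` a \<in> Jstar Ok' d \<and> (*) \<gamma> ` a \<subseteq> Ok'"
proof -
  obtain N where N: "of_nat N \<in> d" "N > 0" by (rule obtain_nat_in_d)
  show ?thesis
    using idempotent_power[OF orders(2) D.m_sub N] N finite_Sigma emb'
    by (intro B.move_ideal_coprime[OF assms D.ideal d_le_m']) auto
qed

abbreviation W where "W \<equiv> unit_reps Ok d m"
abbreviation W' where "W' \<equiv> unit_reps Ok' d m'"
abbreviation Q where "Q \<equiv> resgrp d (resU Ok' d m')"
abbreviation V where "V \<equiv> resU Ok d m"
abbreviation Bgrp where "Bgrp \<equiv> (Q Mod V) \<times>\<times> sign_grp (\<Sigma> - \<Sigma>')"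
abbreviation U' where "U' \<equiv> Ugrp_set Ok' m' \<Sigma>'"
abbreviation U where "U \<equiv> Ugrp_set Ok m \<Sigma>"
abbreviation Agrp where "Agrp \<equiv> kgrp U' Mod U"
abbreviation Cgrp where "Cgrp \<equiv> ray_class_group Ok m \<Sigma>"
abbreviation Dgrp where "Dgrp \<equiv> ray_class_group Ok' m' \<Sigma>'"
abbreviation ray_class where "ray_class a \<equiv> Pray Ok m \<Sigma> #>\<^bsub>ideal_grp Ok m\<^esub> a"
abbreviation ray_class' where "ray_class' a \<equiv> Pray Ok' m' \<Sigma>' #>\<^bsub>ideal_grp Ok' m'\<^esub> a"

lemmas WD = A.unit_repsD[OF E.ideal d_le_m]
lemmas W'D = B.unit_repsD[OF D.ideal d_le_m']
lemmas W_mult = A.unit_reps_mult[OF E.ideal d_le_m]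
lemmas W'_mult = B.unit_reps_mult[OF D.ideal d_le_m']
lemmas rcls_iff = B.rcls_eq_iff[OF D.ideal d_le_m']

lemma W_le: "W \<subseteq> W'"
  using Ok_le m_le_m' by (auto simp: unit_reps_def)

text \<open>An inverse \<open>y = 0\<close> forces \<open>1 \<in> d\<close>, and then
  \<open>1\<close> is an inverse too. Nonvanishing is wanted because \<open>y\<close> will enlarge a
  fraction to numerator and denominator congruent to 1.\<close>

lemma W'_inverse:
  assumes "x \<in> W'"
  obtains y where "y \<in> Ok'" "y \<noteq> 0" "x * y - 1 \<in> d"
proof -
  obtain y where y: "y \<in> Ok'" "x * y - 1 \<in> d" using assms by (auto simp: unit_reps_def)
  show ?thesis
  proof (cases "y = 0")
    case True
    then have "- 1 \<in> d" using y(2) by simp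
    from B.sub_neg[OF D.m_sub this] have "1 \<in> d" by simp
    then have "(x * 1 - 1) * 1 \<in> d"
      using W'D(1)[OF assms] B.one_mem by (intro submodule_onD(3)[OF D.m_sub] B.diff_mem) auto
    then show ?thesis using that[of 1] B.one_mem by simp
  qed (use that y in blast)
qed

sublocale Q: comm_group Q
  by (rule B.comm_group_resgrp[OF D.ideal d_le_m'])

lemma carrier_Q: "carrier Q = rcls d ` W'"
  by (simp add: resgrp_def B.resU_eq[OF D.ideal d_le_m'])

lemma V_eq: "V = rcls d ` W"
  by (rule A.resU_eq[OF E.ideal d_le_m])

lemma Q_mult: "x \<in> W' \<Longrightarrow> y \<in> W' \<Longrightarrow> rcls d x \<otimes>\<^bsub>Q\<^esub> rcls d y = rcls d (x * y)"
  using W'D(1) B.resgrp_mult[OF D.ideal d_le_m'] by blast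

lemma Q_one: "\<one>\<^bsub>Q\<^esub> = rcls d 1"
  by (simp add: resgrp_def)

lemma subgroup_V: "subgroup V Q"
proof (rule Q.subgroupI)
  show "V \<subseteq> carrier Q" using W_le by (auto simp: carrier_Q V_eq)
  show "V \<noteq> {}" using A.one_unit_reps[OF E.ideal d_le_m] by (auto simp: V_eq)
next
  fix X assume "X \<in> V"
  then obtain x where x: "x \<in> W" "X = rcls d x" by (auto simp: V_eq)
  then obtain y where y: "y \<in> W" "x * y - 1 \<in> d" using WD(3) by blast
  have xy': "x \<in> W'" "y \<in> W'" using x y W_le by auto
  have "inv\<^bsub>Q\<^esub> X = rcls d y"
  proof (rule Q.inv_equality)
    show "rcls d y \<otimes>\<^bsub>Q\<^esub> X = \<one>\<^bsub>Q\<^esub>" using x y xy' by (simp add: Q_mult Q_one rcls_iff mult.commute)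
  qed (use x xy' in \<open>auto simp: carrier_Q\<close>)
  then show "inv\<^bsub>Q\<^esub> X \<in> V" using y by (auto simp: V_eq)
next
  fix X Y assume "X \<in> V" "Y \<in> V"
  then obtain x y where xy: "x \<in> W" "X = rcls d x" "y \<in> W" "Y = rcls d y" by (auto simp: V_eq)
  then have "X \<otimes>\<^bsub>Q\<^esub> Y = rcls d (x * y)" using W_le Q_mult by blast
  then show "X \<otimes>\<^bsub>Q\<^esub> Y \<in> V" using xy W_mult by (auto simp: V_eq)
qed

lemma normal_V: "V \<lhd> Q"
  using Q.subgroup_imp_normal[OF subgroup_V] .

lemma V_coset_eq_iff:
  assumes "x \<in> W'" "y \<in> W'"
  shows "V #>\<^bsub>Q\<^esub> rcls d x = V #>\<^bsub>Q\<^esub> rcls d y \<longleftrightarrow> (\<exists>w\<in>W. x - w * y \<in> d)" (is "?l \<longleftrightarrow> ?r")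
proof -
  have c: "rcls d x \<in> carrier Q" "rcls d y \<in> carrier Q" using assms by (auto simp: carrier_Q)
  have "?l \<longleftrightarrow> rcls d x \<in> V #>\<^bsub>Q\<^esub> rcls d y"
    using Q.repr_independence[OF _ c(2) subgroup_V] Q.rcos_self[OF c(1) subgroup_V] by metis
  also have "\<dots> \<longleftrightarrow> (\<exists>w\<in>W. rcls d x = rcls d w \<otimes>\<^bsub>Q\<^esub> rcls d y)"
    by (auto simp: r_coset_def V_eq)
  also have "\<dots> \<longleftrightarrow> ?r" using W_le assms by (auto simp: Q_mult rcls_iff subset_iff)
  finally show ?thesis .
qed

section \<open>Elements representing the second group, and their contractions\<close>

definition gens :: "'k set" where
  "gens = {\<alpha> \<in> W'. \<alpha> \<noteq> 0 \<and> (\<forall>\<rho>\<in>\<Sigma>'. \<rho> \<alpha> > 0)}"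

definition res_class :: "'k \<Rightarrow> 'k set set \<times> (('k \<Rightarrow> real) \<Rightarrow> real)" where
  "res_class \<alpha> = (V #>\<^bsub>Q\<^esub> rcls d \<alpha>, \<lambda>\<rho>. if \<rho> \<in> \<Sigma> - \<Sigma>' then sgn (\<rho> \<alpha>) else 1)"

definition contraction :: "'k \<Rightarrow> 'k set" where
  "contraction \<alpha> = (*) \<alpha> ` Ok' \<inter> Ok"

lemma gensD:
  assumes "\<alpha> \<in> gens"
  shows "\<alpha> \<in> W'" "\<alpha> \<noteq> 0" "\<alpha> \<in> Ok'" "\<alpha> - 1 \<in> m'" "\<And>\<rho>. \<rho> \<in> \<Sigma>' \<Longrightarrow> \<rho> \<alpha> > 0"
  using assms W'D by (auto simp: gens_def)

lemma gens_mult: "\<alpha> \<in> gens \<Longrightarrow> \<beta> \<in> gens \<Longrightarrow> \<alpha> * \<beta> \<in> gens"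
  using emb' W'_mult by (auto simp: gens_def real_emb_simps)

lemma one_gens: "1 \<in> gens"
  using emb' B.one_unit_reps[OF D.ideal d_le_m'] by (auto simp: gens_def real_emb_simps)

text \<open>The sign vector records only \<open>\<Sigma> - \<Sigma>'\<close>, but on
  \<open>\<Sigma>'\<close> all members of \<open>gens\<close> are positive, so signs can be compared
  on all of \<open>\<Sigma>\<close>.\<close>

lemma res_class_eq_iff:
  assumes "\<alpha> \<in> gens" "\<beta> \<in> gens"
  shows "res_class \<alpha> = res_class \<beta> \<longleftrightarrow>
    (\<exists>w\<in>W. \<alpha> - w * \<beta> \<in> d) \<and> (\<forall>\<rho>\<in>\<Sigma>. sgn (\<rho> \<alpha>) = sgn (\<rho> \<beta>))"
proof -
  have "\<forall>\<rho>\<in>\<Sigma>'. sgn (\<rho> \<alpha>) = sgn (\<rho> \<beta>)" using gensD(5)[OF assms(1)] gensD(5)[OF assms(2)] by simp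
  then have "(\<forall>\<rho>. (if \<rho> \<in> \<Sigma> - \<Sigma>' then sgn (\<rho> \<alpha>) else 1) = (if \<rho> \<in> \<Sigma> - \<Sigma>' then sgn (\<rho> \<beta>) else 1)) \<longleftrightarrow>
      (\<forall>\<rho>\<in>\<Sigma>. sgn (\<rho> \<alpha>) = sgn (\<rho> \<beta>))"
    by (intro iffI ballI allI) (metis DiffI, simp)
  then show ?thesis
    using V_coset_eq_iff[OF gensD(1)[OF assms(1)] gensD(1)[OF assms(2)]]
    unfolding res_class_def prod.inject fun_eq_iff by simp
qed

lemma res_class_in: "\<alpha> \<in> gens \<Longrightarrow> res_class \<alpha> \<in> carrier Bgrp"
  using gensD(1,2)[of \<alpha>] emb
  by (auto simp: res_class_def carrier_FactGroup carrier_Q sign_grp_def sgn_if real_emb_eq_0_iff)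

lemma res_class_mult:
  assumes "\<alpha> \<in> gens" "\<beta> \<in> gens"
  shows "res_class \<alpha> \<otimes>\<^bsub>Bgrp\<^esub> res_class \<beta> = res_class (\<alpha> * \<beta>)"
proof -
  have *: "\<alpha> \<in> W'" "\<beta> \<in> W'" using assms gensD by auto
  have "(V #>\<^bsub>Q\<^esub> rcls d \<alpha>) <#>\<^bsub>Q\<^esub> (V #>\<^bsub>Q\<^esub> rcls d \<beta>) = V #>\<^bsub>Q\<^esub> (rcls d \<alpha> \<otimes>\<^bsub>Q\<^esub> rcls d \<beta>)"
    using * by (intro normal.rcos_sum[OF normal_V]) (auto simp: carrier_Q)
  then show ?thesis
    unfolding res_class_def using * emb
    by (auto simp: Q_mult sign_grp_def fun_eq_iff real_emb_simps sgn_mult)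
qed

lemma res_class_one: "res_class 1 = \<one>\<^bsub>Bgrp\<^esub>"
proof -
  have "V #>\<^bsub>Q\<^esub> \<one>\<^bsub>Q\<^esub> = V"
    by (rule Q.coset_mult_one[OF subgroup.subset[OF subgroup_V]])
  then show ?thesis
    unfolding res_class_def using emb by (auto simp: Q_one sign_grp_def fun_eq_iff real_emb_simps)
qed

text \<open>A lift \<open>x\<close> of the residue class is shifted by a large multiple of an
  element \<open>v \<in> d\<close> with the prescribed signs; \<open>v\<close> is a sign
  approximation \<open>u\<close> multiplied by positive integers that carry it into
  \<open>d\<close>. The value 1 of \<open>\<epsilon>\<close> on \<open>\<Sigma>'\<close> supplies
  the positivity there.\<close>

lemma res_class_surj:
  assumes "z \<in> carrier Bgrp"
  shows "\<exists>\<alpha>\<in>gens. res_class \<alpha> = z"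
proof -
  obtain x \<epsilon> where x: "x \<in> W'" "z = (V #>\<^bsub>Q\<^esub> rcls d x, \<epsilon>)" and \<epsilon>: "\<epsilon> \<in> carrier (sign_grp (\<Sigma> - \<Sigma>'))"
    using assms by (auto simp: carrier_FactGroup carrier_Q)
  have \<epsilon>1: "\<forall>\<rho>\<in>\<Sigma>. \<epsilon> \<rho> = 1 \<or> \<epsilon> \<rho> = -1" "\<And>\<rho>. \<rho> \<notin> \<Sigma> - \<Sigma>' \<Longrightarrow> \<epsilon> \<rho> = 1"
    using \<epsilon> by (auto simp: sign_grp_def)
  obtain u where u: "u \<noteq> 0" "\<forall>\<rho>\<in>\<Sigma>. sgn (\<rho> u) = \<epsilon> \<rho>"
    using sign_approximation[OF finite_Sigma(1) _ \<epsilon>1(1)] emb by blast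
  obtain M where M: "M > 0" "of_nat M * u \<in> Ok'" using order_multiple[OF nf orders(2)] by blast
  obtain N where N: "of_nat N \<in> d" "N > 0" by (rule obtain_nat_in_d)
  define v where "v = (of_nat M * u) * of_nat N"
  have v: "v \<in> d" "v \<noteq> 0" using M N u submodule_onD(3)[OF D.m_sub] by (auto simp: v_def)
  obtain k where k: "x + of_nat k * v \<noteq> 0" "\<forall>\<rho>\<in>\<Sigma>. sgn (\<rho> (x + of_nat k * v)) = sgn (\<rho> v)"
    using sgn_shift[OF finite_Sigma(1) emb v(2)] by blast
  define \<alpha> where "\<alpha> = x + of_nat k * v"
  have sg: "sgn (\<rho> \<alpha>) = \<epsilon> \<rho>" if "\<rho> \<in> \<Sigma>" for \<rho>
  proof -
    have "sgn (\<rho> v) = sgn (\<rho> u)"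
      using M N emb[OF that] by (simp add: v_def real_emb_simps real_emb_of_nat sgn_mult)
    then show ?thesis using k(2) u(2) that by (simp add: \<alpha>_def)
  qed
  have ax: "\<alpha> - x \<in> d" using submodule_onD(3)[OF D.m_sub B.of_nat_mem v(1)] by (simp add: \<alpha>_def)
  have aW: "\<alpha> \<in> W'" using B.unit_reps_cong[OF D.ideal d_le_m' x(1) ax] .
  have "\<rho> \<alpha> > 0" if "\<rho> \<in> \<Sigma>'" for \<rho>
    using sg[of \<rho>] \<epsilon>1(2)[of \<rho>] that Sigma_le by (auto simp: sgn_1_pos)
  then have "\<alpha> \<in> gens" using aW k(1) by (auto simp: gens_def \<alpha>_def)
  moreover have "rcls d \<alpha> = rcls d x" using ax by (simp add: rcls_iff)
  then have "res_class \<alpha> = z"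
    unfolding res_class_def x(2) using sg \<epsilon>1(2) by (auto simp: fun_eq_iff)
  ultimately show ?thesis by blast
qed

lemma scale_coprime:
  assumes "\<alpha> \<in> gens"
  shows "submodule_on Ok' ((*) \<alpha> ` Ok')" "(*) \<alpha> ` Ok' \<subseteq> Ok'" "\<exists>t. t \<in> (*) \<alpha> ` Ok' \<and> t - 1 \<in> d"
    "(*) \<alpha> ` Ok' \<in> Jstar Ok' d"
proof -
  have a: "\<alpha> \<in> Ok'" "\<alpha> \<noteq> 0" using gensD assms by auto
  show 1: "submodule_on Ok' ((*) \<alpha> ` Ok')" "(*) \<alpha> ` Ok' \<subseteq> Ok'"
    using a B.mult_mem by (auto intro: submodule_on_scale B.submodule_on_self)
  obtain y where y: "y \<in> Ok'" "y \<noteq> 0" "\<alpha> * y - 1 \<in> d" using W'_inverse gensD(1)[OF assms] by blast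
  then show "\<exists>t. t \<in> (*) \<alpha> ` Ok' \<and> t - 1 \<in> d" by blast
  have "\<alpha> * y \<in> cong_one d" "\<alpha> * y \<in> (*) \<alpha> ` Ok'" using y a by (auto simp: cong_one_def)
  moreover have "mprod ((*) \<alpha> ` Ok') ((*) (inverse \<alpha>) ` Ok') = Ok'"
    using a by (simp add: B.scale_mprod submodule_on_scale B.submodule_on_self scale_scale)
  moreover have "\<forall>x\<in>(*) \<alpha> ` Ok'. 1 * x \<in> Ok'" using 1 by auto
  ultimately show "(*) \<alpha> ` Ok' \<in> Jstar Ok' d"
    unfolding D.Jstar_iff using 1 submodule_on_scale[OF B.submodule_on_self] D.one_cong_one by blast
qed

lemma contraction_in_J: "\<alpha> \<in> gens \<Longrightarrow> contraction \<alpha> \<in> Jstar Ok d"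
  unfolding contraction_def by (intro contract_in_J scale_coprime)

lemma contraction_mult:
  assumes "\<alpha> \<in> gens" "\<beta> \<in> gens"
  shows "mprod (contraction \<alpha>) (contraction \<beta>) = contraction (\<alpha> * \<beta>)"
proof -
  obtain t u where tu: "t \<in> (*) \<alpha> ` Ok'" "t - 1 \<in> d" "u \<in> (*) \<beta> ` Ok'" "u - 1 \<in> d"
    using scale_coprime(3) assms by metis
  have "mprod (contraction \<alpha>) (contraction \<beta>) = mprod ((*) \<alpha> ` Ok') ((*) \<beta> ` Ok') \<inter> Ok"
    unfolding contraction_def
    by (rule contract_mult[OF scale_coprime(1,2)[OF assms(1)] tu(1,2) scale_coprime(1,2)[OF assms(2)] tu(3,4)])
  also have "mprod ((*) \<alpha> ` Ok') ((*) \<beta> ` Ok') = (*) (\<alpha> * \<beta>) ` Ok'"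
    by (simp add: B.scale_mprod submodule_on_scale B.submodule_on_self scale_scale)
  finally show ?thesis by (simp add: contraction_def)
qed

lemma contraction_extend: "\<alpha> \<in> gens \<Longrightarrow> mprod (contraction \<alpha>) Ok' = (*) \<alpha> ` Ok'"
  unfolding contraction_def using contract_extend scale_coprime by metis

text \<open>With \<open>\<alpha>\<close> congruent to \<open>w * \<beta>\<close> modulo
  \<open>d\<close> and \<open>w\<close> a unit of \<open>Ok\<close> modulo \<open>d\<close>, the
  conditions \<open>\<alpha> * s \<in> Ok\<close> and \<open>\<beta> * s \<in> Ok\<close> agree for
  \<open>s \<in> Ok'\<close>, so the contractions differ by the factor
  \<open>\<alpha> / \<beta>\<close>. For \<open>y\<close> inverse to \<open>\<beta>\<close> modulo
  \<open>d\<close>, \<open>\<alpha> * y\<close> is congruent to \<open>w\<close>, hence to 1 modulo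
  \<open>m\<close>; equal signs make \<open>\<alpha> / \<beta>\<close> a ray element.\<close>

lemma contraction_res_class:
  assumes "\<alpha> \<in> gens" "\<beta> \<in> gens" "res_class \<alpha> = res_class \<beta>"
  shows "ray_class (contraction \<alpha>) = ray_class (contraction \<beta>)"
proof -
  obtain w where w: "w \<in> W" "\<alpha> - w * \<beta> \<in> d" and sg: "\<forall>\<rho>\<in>\<Sigma>. sgn (\<rho> \<alpha>) = sgn (\<rho> \<beta>)"
    using assms res_class_eq_iff by blast
  obtain w' where w': "w' \<in> W" "w * w' - 1 \<in> d" using WD(3)[OF w(1)] by blast
  have wO: "w \<in> Ok" "w' \<in> Ok" "w - 1 \<in> m" using w w' WD by auto
  have ab: "\<alpha> \<in> Ok'" "\<alpha> \<noteq> 0" "\<beta> \<in> Ok'" "\<beta> \<noteq> 0" using assms gensD by auto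
  have dO: "x * s \<in> Ok" if "x \<in> d" "s \<in> Ok'" for x s
    using that submodule_onD(4)[OF D.m_sub] E.m_le by blast
  have iff: "\<alpha> * s \<in> Ok \<longleftrightarrow> \<beta> * s \<in> Ok" if s: "s \<in> Ok'" for s
  proof
    assume as: "\<alpha> * s \<in> Ok"
    have "w' * (\<alpha> * s - (\<alpha> - w * \<beta>) * s) - (w * w' - 1) * (\<beta> * s) \<in> Ok"
      using as dO[OF w(2) s] dO[OF w'(2) B.mult_mem[OF ab(3) s]] wO A.mult_mem A.diff_mem by blast
    then show "\<beta> * s \<in> Ok" by (simp add: algebra_simps)
  next
    assume "\<beta> * s \<in> Ok"
    then have "w * (\<beta> * s) + (\<alpha> - w * \<beta>) * s \<in> Ok" using dO[OF w(2) s] wO A.mult_mem A.add_mem by blast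
    then show "\<alpha> * s \<in> Ok" by (simp add: algebra_simps)
  qed
  obtain y where y: "y \<in> Ok'" "y \<noteq> 0" "\<beta> * y - 1 \<in> d" using W'_inverse gensD(1)[OF assms(2)] by blast
  have "(\<alpha> * y) / (\<beta> * y) \<in> A.ray_elements \<Sigma>"
  proof (rule A.ray_elementsI)
    show "\<beta> * y \<in> cong_one m" using y ab d_le_m by (auto simp: cong_one_def)
    have "((\<alpha> - w * \<beta>) * y + w * (\<beta> * y - 1)) + (w - 1) \<in> m"
      using submodule_onD(4)[OF D.m_sub y(1) w(2)] submodule_onD(3)[OF E.m_sub wO(1) y(3)] wO(3) d_le_m
      by (intro submodule_onD(2)[OF A.m_sub]) auto
    then have "\<alpha> * y - 1 \<in> m" by (simp add: algebra_simps)
    then show "\<alpha> * y \<in> cong_one m" using y ab by (simp add: cong_one_def)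
  next
    fix \<rho> assume \<rho>: "\<rho> \<in> \<Sigma>"
    have "\<rho> (\<alpha> / \<beta>) = \<rho> \<alpha> / \<rho> \<beta>" "\<rho> \<beta> \<noteq> 0" using emb[OF \<rho>] ab by (auto simp: real_emb_divide real_emb_eq_0_iff)
    moreover have "sgn (\<rho> \<alpha>) = sgn (\<rho> \<beta>)" using sg \<rho> by blast
    ultimately have "\<rho> (\<alpha> / \<beta>) > 0" by (auto simp: sgn_if zero_less_divide_iff split: if_splits)
    then show "\<rho> ((\<alpha> * y) / (\<beta> * y)) > 0" using y(2) by simp
  qed
  then have "\<alpha> / \<beta> \<in> A.ray_elements \<Sigma>" using y by simp
  moreover have "contraction \<alpha> = (*) (\<alpha> / \<beta>) ` contraction \<beta>"
  proof
    show "contraction \<alpha> \<subseteq> (*) (\<alpha> / \<beta>) ` contraction \<beta>"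
    proof
      fix z assume "z \<in> contraction \<alpha>"
      then obtain s where s: "s \<in> Ok'" "z = \<alpha> * s" "\<alpha> * s \<in> Ok" by (auto simp: contraction_def)
      then have "\<beta> * s \<in> contraction \<beta>" using iff by (auto simp: contraction_def)
      moreover have "z = (\<alpha> / \<beta>) * (\<beta> * s)" using s ab by simp
      ultimately show "z \<in> (*) (\<alpha> / \<beta>) ` contraction \<beta>" by blast
    qed
    show "(*) (\<alpha> / \<beta>) ` contraction \<beta> \<subseteq> contraction \<alpha>"
    proof
      fix z assume "z \<in> (*) (\<alpha> / \<beta>) ` contraction \<beta>"
      then obtain s where s: "s \<in> Ok'" "z = (\<alpha> / \<beta>) * (\<beta> * s)" "\<beta> * s \<in> Ok" by (auto simp: contraction_def)
      then have "z = \<alpha> * s" "\<alpha> * s \<in> Ok" using ab iff by auto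
      then show "z \<in> contraction \<alpha>" using s by (auto simp: contraction_def)
    qed
  qed
  ultimately show ?thesis
    using A.Pray_coset_eq_iff[OF embs J_d_m[OF contraction_in_J[OF assms(1)]] J_d_m[OF contraction_in_J[OF assms(2)]]]
    by blast
qed

text \<open>The choice of a preimage is harmless by \<open>contraction_res_class\<close>;
  \<open>boundary_res_class\<close> is the working form.\<close>

definition boundary :: "'k set set \<times> (('k \<Rightarrow> real) \<Rightarrow> real) \<Rightarrow> 'k set set" where
  "boundary z = ray_class (contraction (SOME \<alpha>. \<alpha> \<in> gens \<and> res_class \<alpha> = z))"

lemma boundary_res_class:
  assumes "\<alpha> \<in> gens"
  shows "boundary (res_class \<alpha>) = ray_class (contraction \<alpha>)"
proof -
  define \<beta> where "\<beta> = (SOME \<beta>. \<beta> \<in> gens \<and> res_class \<beta> = res_class \<alpha>)"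
  have "\<beta> \<in> gens \<and> res_class \<beta> = res_class \<alpha>" unfolding \<beta>_def using assms by (intro someI) auto
  then show ?thesis
    unfolding boundary_def \<beta>_def[symmetric] using contraction_res_class assms by blast
qed

section \<open>The unit groups and the two given maps on representatives\<close>

lemma unit_gens: "u \<in> U' \<Longrightarrow> u \<in> gens"
  using submodule_onD(1)[OF D.m_sub]
  by (auto simp: Ugrp_set_def gens_def unit_reps_def intro!: bexI[of _ "inverse u"])

lemma U_le: "U \<subseteq> U'"
  using Ok_le m_le_m' Sigma_le by (auto simp: Ugrp_set_def)

lemma Ugrp_mult: "u \<in> U' \<Longrightarrow> v \<in> U' \<Longrightarrow> u * v \<in> U'"
  using B.mult_mem B.cong_one_mult_diff emb' by (auto simp: Ugrp_set_def real_emb_simps)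

lemma Ugrp_inverse: "u \<in> U' \<Longrightarrow> inverse u \<in> U'"
  using B.cong_one_cancel[of u "inverse u"] submodule_onD(1)[OF B.m_sub] emb'
  by (auto simp: Ugrp_set_def real_emb_inverse)

lemma comm_group_units: "comm_group (kgrp U')"
proof (rule comm_groupI)
  show "\<one>\<^bsub>kgrp U'\<^esub> \<in> carrier (kgrp U')"
    using B.one_mem submodule_onD(1)[OF B.m_sub] emb' by (auto simp: kgrp_def Ugrp_set_def real_emb_simps)
next
  fix u assume "u \<in> carrier (kgrp U')"
  then have "inverse u \<in> carrier (kgrp U')" "inverse u \<otimes>\<^bsub>kgrp U'\<^esub> u = \<one>\<^bsub>kgrp U'\<^esub>"
    using Ugrp_inverse by (auto simp: kgrp_def Ugrp_set_def)
  then show "\<exists>v\<in>carrier (kgrp U'). v \<otimes>\<^bsub>kgrp U'\<^esub> u = \<one>\<^bsub>kgrp U'\<^esub>" by blast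
qed (auto simp: kgrp_def Ugrp_mult mult_ac)

sublocale K: comm_group "kgrp U'"
  by (rule comm_group_units)

lemma subgroup_U: "subgroup U (kgrp U')"
proof (rule K.subgroupI)
  show "U \<subseteq> carrier (kgrp U')" using U_le by (simp add: kgrp_def)
  have "1 \<in> U" using A.one_mem submodule_onD(1)[OF A.m_sub] emb by (auto simp: Ugrp_set_def real_emb_simps)
  then show "U \<noteq> {}" by blast
next
  fix u assume u: "u \<in> U"
  then have u': "u \<in> U'" using U_le by blast
  have "inv\<^bsub>kgrp U'\<^esub> u = inverse u"
    by (rule K.inv_equality) (use u' Ugrp_inverse in \<open>auto simp: kgrp_def Ugrp_set_def\<close>)
  moreover have "inverse u \<in> U"
    using u A.cong_one_cancel[of u "inverse u"] submodule_onD(1)[OF A.m_sub] emb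
    by (auto simp: Ugrp_set_def real_emb_inverse)
  ultimately show "inv\<^bsub>kgrp U'\<^esub> u \<in> U" by simp
next
  fix u v assume "u \<in> U" "v \<in> U"
  then show "u \<otimes>\<^bsub>kgrp U'\<^esub> v \<in> U"
    using A.mult_mem A.cong_one_mult_diff emb by (auto simp: kgrp_def Ugrp_set_def real_emb_simps)
qed

lemma normal_U: "U \<lhd> kgrp U'"
  using K.subgroup_imp_normal[OF subgroup_U] .

abbreviation unit_class where "unit_class u \<equiv> U #>\<^bsub>kgrp U'\<^esub> u"

lemma carrier_Agrp: "carrier Agrp = unit_class ` U'"
  by (simp add: carrier_FactGroup) (simp add: kgrp_def)

lemma unit_class_mult:
  "u \<in> U' \<Longrightarrow> v \<in> U' \<Longrightarrow> unit_class u \<otimes>\<^bsub>Agrp\<^esub> unit_class v = unit_class (u * v)"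
  using normal.rcos_sum[OF normal_U, of u v] by (simp add: kgrp_def)

lemma unit_class_one: "u \<in> U \<Longrightarrow> unit_class u = \<one>\<^bsub>Agrp\<^esub>"
  using K.coset_join2[OF _ subgroup_U, of u] U_le by (auto simp: kgrp_def)

abbreviation fmap where "fmap \<equiv> unit_map Ok' m' Ok m d \<Sigma> \<Sigma>'"
abbreviation hmap where "hmap \<equiv> ext_map Ok' m' \<Sigma>'"

text \<open>The representative chosen by \<open>unit_map\<close> differs from \<open>u\<close> by
  some \<open>w \<in> U\<close>, which is a unit of \<open>Ok\<close> modulo \<open>d\<close> and
  positive on \<open>\<Sigma>\<close>, so it disappears in \<open>res_class\<close>.\<close>

lemma fmap_unit_class:
  assumes "u \<in> U'"
  shows "fmap (unit_class u) = res_class u"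
proof -
  define x where "x = (SOME x. x \<in> unit_class u)"
  have "u \<in> unit_class u"
    by (rule K.rcos_self[OF _ subgroup_U]) (use assms in \<open>simp add: kgrp_def\<close>)
  then have "x \<in> unit_class u" unfolding x_def by (rule someI)
  then obtain w where w: "w \<in> U" "x = w * u" by (auto simp: r_coset_def kgrp_def)
  have xU: "x \<in> U'" using w U_le Ugrp_mult assms by blast
  have wW: "w \<in> W" using w(1) submodule_onD(1)[OF D.m_sub]
    by (auto simp: Ugrp_set_def unit_reps_def intro!: bexI[of _ "inverse w"])
  have "x - w * u \<in> d" using submodule_onD(1)[OF D.m_sub] w by simp
  moreover have "sgn (\<rho> x) = sgn (\<rho> u)" if "\<rho> \<in> \<Sigma>" for \<rho>
    using w that emb by (simp add: Ugrp_set_def real_emb_simps sgn_mult)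
  ultimately have "res_class x = res_class u"
    using res_class_eq_iff[OF unit_gens[OF xU] unit_gens[OF assms]] wW by blast
  then show ?thesis unfolding unit_map_def x_def[symmetric] Let_def res_class_def .
qed

text \<open>Changing the representative multiplies the extended ideal by the same
  \<open>\<gamma>\<close>, which is also a ray element for \<open>m'\<close> and
  \<open>\<Sigma>'\<close> because both conditions weaken.\<close>

lemma hmap_ray_class:
  assumes "a \<in> Jstar Ok m"
  shows "hmap (ray_class a) = ray_class' (mprod a Ok')"
proof -
  define b where "b = (SOME b. b \<in> ray_class a)"
  have "ray_class a \<in> carrier Cgrp"
    using assms by (simp add: A.carrier_ray_class_group[OF embs])
  from A.some_in_ray_class[OF embs this] have b: "b \<in> Jstar Ok m" "ray_class a = ray_class b"
    unfolding b_def by auto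
  then obtain \<gamma> where \<gamma>: "\<gamma> \<in> A.ray_elements \<Sigma>" "b = (*) \<gamma> ` a"
    using A.Pray_coset_eq_iff[OF embs b(1) assms] by auto
  have "\<gamma> \<in> B.ray_elements \<Sigma>'"
  proof -
    obtain x y where xy: "\<gamma> = x / y" "x \<in> cong_one m" "y \<in> cong_one m"
      using \<gamma>(1) by (rule A.ray_elementsE)
    have "x / y \<in> B.ray_elements \<Sigma>'"
      using xy cong_one_m_m' A.ray_elements_pos[OF \<gamma>(1)] Sigma_le by (intro B.ray_elementsI) auto
    then show ?thesis by (simp add: xy)
  qed
  moreover have "mprod b Ok' = (*) \<gamma> ` mprod a Ok'" by (simp add: \<gamma>(2) mprod_scale)
  ultimately have "ray_class' (mprod b Ok') = ray_class' (mprod a Ok')"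
    using B.Pray_coset_eq_iff[OF embs' J_extend[OF b(1)] J_extend[OF assms]] by blast
  then show ?thesis unfolding ext_map_def b_def[symmetric] .
qed

lemma contraction_J: "\<alpha> \<in> gens \<Longrightarrow> contraction \<alpha> \<in> Jstar Ok m"
  using contraction_in_J J_d_m by blast

section \<open>Homomorphisms and exactness\<close>

lemma fmap_hom: "fmap \<in> hom Agrp Bgrp"
proof (rule homI)
  fix x assume "x \<in> carrier Agrp"
  then show "fmap x \<in> carrier Bgrp"
    using res_class_in unit_gens fmap_unit_class unfolding carrier_Agrp by auto
next
  fix x y assume "x \<in> carrier Agrp" "y \<in> carrier Agrp"
  then obtain u v where uv: "u \<in> U'" "v \<in> U'" "x = unit_class u" "y = unit_class v"
    unfolding carrier_Agrp by auto
  then show "fmap (x \<otimes>\<^bsub>Agrp\<^esub> y) = fmap x \<otimes>\<^bsub>Bgrp\<^esub> fmap y"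
    using fmap_unit_class[OF uv(1)] fmap_unit_class[OF uv(2)] fmap_unit_class[OF Ugrp_mult[OF uv(1,2)]]
      res_class_mult[OF unit_gens[OF uv(1)] unit_gens[OF uv(2)]] unit_class_mult[OF uv(1,2)] by metis
qed

lemma boundary_hom: "boundary \<in> hom Bgrp Cgrp"
proof (rule homI)
  fix x assume "x \<in> carrier Bgrp"
  then obtain \<alpha> where \<alpha>: "\<alpha> \<in> gens" "x = res_class \<alpha>" using res_class_surj by blast
  then show "boundary x \<in> carrier Cgrp"
    using contraction_J boundary_res_class by (simp add: A.carrier_ray_class_group[OF embs])
next
  fix x y assume "x \<in> carrier Bgrp" "y \<in> carrier Bgrp"
  then obtain \<alpha> \<beta> where *: "\<alpha> \<in> gens" "x = res_class \<alpha>" "\<beta> \<in> gens" "y = res_class \<beta>"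
    using res_class_surj by metis
  have "boundary (x \<otimes>\<^bsub>Bgrp\<^esub> y) = ray_class (contraction (\<alpha> * \<beta>))"
    unfolding *(2,4) res_class_mult[OF *(1,3)] by (rule boundary_res_class[OF gens_mult[OF *(1,3)]])
  also have "\<dots> = ray_class (contraction \<alpha>) \<otimes>\<^bsub>Cgrp\<^esub> ray_class (contraction \<beta>)"
    unfolding A.ray_class_mult[OF embs contraction_J[OF *(1)] contraction_J[OF *(3)]]
      contraction_mult[OF *(1,3)] ..
  also have "\<dots> = boundary x \<otimes>\<^bsub>Cgrp\<^esub> boundary y"
    unfolding *(2,4) boundary_res_class[OF *(1)] boundary_res_class[OF *(3)] ..
  finally show "boundary (x \<otimes>\<^bsub>Bgrp\<^esub> y) = boundary x \<otimes>\<^bsub>Cgrp\<^esub> boundary y" .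
qed

lemma hmap_hom: "hmap \<in> hom Cgrp Dgrp"
proof (rule homI)
  fix x assume "x \<in> carrier Cgrp"
  then show "hmap x \<in> carrier Dgrp"
    using hmap_ray_class J_extend
    by (auto simp: A.carrier_ray_class_group[OF embs] B.carrier_ray_class_group[OF embs'])
next
  fix x y assume "x \<in> carrier Cgrp" "y \<in> carrier Cgrp"
  then obtain a b where *: "a \<in> Jstar Ok m" "b \<in> Jstar Ok m" "x = ray_class a" "y = ray_class b"
    by (auto simp: A.carrier_ray_class_group[OF embs])
  have "hmap (x \<otimes>\<^bsub>Cgrp\<^esub> y) = ray_class' (mprod (mprod a Ok') (mprod b Ok'))"
    unfolding *(3,4) A.ray_class_mult[OF embs *(1,2)] hmap_ray_class[OF A.J_mult[OF *(1,2)]] mprod_extend ..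
  also have "\<dots> = hmap x \<otimes>\<^bsub>Dgrp\<^esub> hmap y"
    unfolding *(3,4) hmap_ray_class[OF *(1)] hmap_ray_class[OF *(2)]
      B.ray_class_mult[OF embs' J_extend[OF *(1)] J_extend[OF *(2)]] ..
  finally show "hmap (x \<otimes>\<^bsub>Cgrp\<^esub> y) = hmap x \<otimes>\<^bsub>Dgrp\<^esub> hmap y" .
qed

text \<open>A unit \<open>u\<close> of \<open>Ok'\<close> congruent modulo \<open>d\<close> to an
  element of \<open>Ok\<close> lies in \<open>Ok\<close>. If \<open>v \<in> Ok\<close> inverts it
  modulo \<open>d\<close>, then \<open>inverse u\<close> equals \<open>v\<close> minus
  \<open>inverse u * (u * v - 1)\<close>, which lies in the \<open>Ok'\<close>-ideal
  \<open>d\<close>; so the inverse lies in \<open>Ok\<close> as well.\<close>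

lemma kernel_fmap: "kernel Agrp Bgrp fmap = {\<one>\<^bsub>Agrp\<^esub>}"
proof
  show "kernel Agrp Bgrp fmap \<subseteq> {\<one>\<^bsub>Agrp\<^esub>}"
  proof
    fix x assume "x \<in> kernel Agrp Bgrp fmap"
    then obtain u where u: "u \<in> U'" "x = unit_class u" "fmap x = \<one>\<^bsub>Bgrp\<^esub>"
      unfolding kernel_def carrier_Agrp by blast
    then have "res_class u = res_class 1" using fmap_unit_class res_class_one by simp
    then obtain w where w: "w \<in> W" "u - w * 1 \<in> d" and sg: "\<forall>\<rho>\<in>\<Sigma>. sgn (\<rho> u) = sgn (\<rho> 1)"
      using res_class_eq_iff[OF unit_gens[OF u(1)] one_gens] by blast
    have wO: "w \<in> Ok" "w - 1 \<in> m" using WD w by auto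
    obtain v where v: "v \<in> Ok" "w * v - 1 \<in> d" using w(1) by (auto simp: unit_reps_def)
    have ud: "u - w \<in> d" using w by simp
    have uu: "u \<noteq> 0" "inverse u \<in> Ok'" "u \<in> Ok'" using u by (auto simp: Ugrp_set_def)
    have "(u - w) + w \<in> Ok" using ud E.m_le wO(1) by (intro A.add_mem) auto
    then have 1: "u \<in> Ok" by simp
    have "(u - w) + (w - 1) \<in> m" using ud d_le_m wO(2) by (intro submodule_onD(2)[OF A.m_sub]) auto
    then have 2: "u - 1 \<in> m" by simp
    have "(u - w) * v + (w * v - 1) \<in> d"
      using submodule_onD(2)[OF E.m_sub submodule_onD(4)[OF E.m_sub v(1) ud] v(2)] .
    then have "u * v - 1 \<in> d" by (simp add: algebra_simps)
    then have "inverse u * (u * v - 1) \<in> d" by (rule submodule_onD(3)[OF D.m_sub uu(2)])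
    then have "v - inverse u * (u * v - 1) \<in> Ok" using v(1) E.m_le by (intro A.diff_mem) auto
    then have 3: "inverse u \<in> Ok" using uu(1) by (simp add: right_diff_distrib mult.assoc[symmetric])
    have "\<rho> u > 0" if "\<rho> \<in> \<Sigma>" for \<rho>
      using sg that emb[OF that] by (auto simp: real_emb_simps sgn_1_pos)
    then have "u \<in> U" using 1 2 3 uu by (auto simp: Ugrp_set_def)
    then show "x \<in> {\<one>\<^bsub>Agrp\<^esub>}" using unit_class_one u(2) by blast
  qed
  have 1: "1 \<in> U" using A.one_mem submodule_onD(1)[OF A.m_sub] emb by (auto simp: Ugrp_set_def real_emb_simps)
  then have oneU: "1 \<in> U'" using U_le by blast
  have "\<one>\<^bsub>Agrp\<^esub> = unit_class 1" by (rule unit_class_one[OF 1, symmetric])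
  moreover have "unit_class 1 \<in> carrier Agrp" unfolding carrier_Agrp using oneU by (rule imageI)
  moreover have "fmap (unit_class 1) = \<one>\<^bsub>Bgrp\<^esub>" unfolding fmap_unit_class[OF oneU] by (rule res_class_one)
  ultimately show "{\<one>\<^bsub>Agrp\<^esub>} \<subseteq> kernel Agrp Bgrp fmap" unfolding kernel_def by auto
qed

text \<open>Units contract to \<open>Ok\<close>. Conversely, if the contraction of
  \<open>\<alpha>\<close> is \<open>\<gamma> Ok\<close> for a ray element \<open>\<gamma>\<close>,
  extension gives \<open>\<alpha> Ok' = \<gamma> Ok'\<close>, so
  \<open>u = \<alpha> / \<gamma>\<close> is a unit of \<open>Ok'\<close>. The factor
  \<open>\<gamma>\<close> is trivial in the second group, which makes \<open>u\<close> and
  \<open>\<alpha>\<close> equivalent.\<close>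

lemma image_fmap: "fmap ` carrier Agrp = kernel Bgrp Cgrp boundary"
proof
  show "fmap ` carrier Agrp \<subseteq> kernel Bgrp Cgrp boundary"
  proof
    fix z assume "z \<in> fmap ` carrier Agrp"
    then obtain u where u: "u \<in> U'" "z = res_class u"
      unfolding carrier_Agrp using fmap_unit_class by auto
    have ug: "u \<in> gens" using unit_gens u by blast
    have uu: "u \<noteq> 0" "inverse u \<in> Ok'" "u \<in> Ok'" using u by (auto simp: Ugrp_set_def)
    have "(*) u ` Ok' = Ok'"
    proof
      show "(*) u ` Ok' \<subseteq> Ok'" using uu B.mult_mem by auto
      show "Ok' \<subseteq> (*) u ` Ok'"
      proof
        fix x assume "x \<in> Ok'"
        then have "inverse u * x \<in> Ok'" "x = u * (inverse u * x)" using uu B.mult_mem by auto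
        then show "x \<in> (*) u ` Ok'" by blast
      qed
    qed
    then have "contraction u = Ok" unfolding contraction_def using Ok_le by auto
    then have "boundary z = \<one>\<^bsub>Cgrp\<^esub>"
      by (simp add: u(2) boundary_res_class[OF ug] A.one_ray_class_group[OF embs])
    then show "z \<in> kernel Bgrp Cgrp boundary"
      unfolding kernel_def using res_class_in[OF ug] u(2) by blast
  qed
  show "kernel Bgrp Cgrp boundary \<subseteq> fmap ` carrier Agrp"
  proof
    fix z assume "z \<in> kernel Bgrp Cgrp boundary"
    then have "z \<in> carrier Bgrp" "boundary z = \<one>\<^bsub>Cgrp\<^esub>" unfolding kernel_def by auto
    then obtain \<alpha> where \<alpha>: "\<alpha> \<in> gens" "z = res_class \<alpha>" "boundary z = \<one>\<^bsub>Cgrp\<^esub>"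
      using res_class_surj by blast
    then have "ray_class (contraction \<alpha>) = ray_class Ok"
      by (simp add: boundary_res_class A.one_ray_class_group[OF embs])
    then obtain \<gamma> where \<gamma>: "\<gamma> \<in> A.ray_elements \<Sigma>" "contraction \<alpha> = (*) \<gamma> ` Ok"
      using A.Pray_coset_eq_iff[OF embs contraction_J[OF \<alpha>(1)] A.R_in_J] by blast
    have \<gamma>0: "\<gamma> \<noteq> 0" and \<alpha>0: "\<alpha> \<noteq> 0"
      using A.ray_elements_nonzero[OF \<gamma>(1)] gensD(2)[OF \<alpha>(1)] by auto
    have "\<gamma> * 1 \<in> contraction \<alpha>" unfolding \<gamma>(2) using A.one_mem by (rule imageI)
    then have \<gamma>Ok: "\<gamma> \<in> Ok" by (simp add: contraction_def)
    have \<gamma>m: "\<gamma> - 1 \<in> m" by (rule A.ray_elements_cong_one[OF \<gamma>(1) \<gamma>Ok])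
    have eq: "(*) \<alpha> ` Ok' = (*) \<gamma> ` Ok'"
      using contraction_extend[OF \<alpha>(1)] scale_extend[of \<gamma>] \<gamma>(2) by simp
    have "\<alpha> * 1 \<in> (*) \<gamma> ` Ok'" unfolding eq[symmetric] using B.one_mem by (rule imageI)
    then have 1: "\<alpha> / \<gamma> \<in> Ok'" using mem_scale_iff[OF \<gamma>0] by simp
    have "\<gamma> * 1 \<in> (*) \<alpha> ` Ok'" unfolding eq using B.one_mem by (rule imageI)
    then have 2: "\<gamma> / \<alpha> \<in> Ok'" using mem_scale_iff[OF \<alpha>0] by simp
    define u where "u = \<alpha> / \<gamma>"
    have \<alpha>u: "\<gamma> * u = \<alpha>" using \<gamma>0 by (simp add: u_def)
    have "u - 1 \<in> m'"
    proof (rule B.cong_one_cancel)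
      show "\<gamma> * u - 1 \<in> m'" unfolding \<alpha>u by (rule gensD(4)[OF \<alpha>(1)])
      show "\<gamma> - 1 \<in> m'" "u \<in> Ok'" using \<gamma>m m_le_m' 1 by (auto simp: u_def)
    qed
    moreover have sg: "sgn (\<rho> \<alpha>) = sgn (\<rho> u)" if "\<rho> \<in> \<Sigma>" for \<rho>
      using A.ray_elements_pos[OF \<gamma>(1) that] emb[OF that] by (simp add: \<alpha>u[symmetric] real_emb_simps sgn_mult)
    moreover have "\<rho> u > 0" if "\<rho> \<in> \<Sigma>'" for \<rho>
      using sg[of \<rho>] gensD(5)[OF \<alpha>(1) that] that Sigma_le by (auto simp: sgn_1_pos)
    ultimately have uU: "u \<in> U'"
      using 1 2 \<gamma>0 \<alpha>0 by (auto simp: Ugrp_set_def u_def)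
    \<comment> \<open>The contraction contains some \<open>t\<close> congruent to 1 modulo
      \<open>d\<close>; written as \<open>\<gamma> * y\<close> with \<open>y \<in> Ok\<close> it
      exhibits an inverse of \<open>\<gamma>\<close> modulo \<open>d\<close>.\<close>
    have "\<gamma> \<in> W"
    proof -
      obtain t where "t \<in> cong_one d" "t \<in> contraction \<alpha>"
        using contraction_in_J[OF \<alpha>(1)] by (auto simp: E.Jstar_iff)
      then obtain y where "y \<in> Ok" "\<gamma> * y - 1 \<in> d" unfolding \<gamma>(2) by (auto simp: cong_one_def)
      then show ?thesis using \<gamma>Ok \<gamma>m by (auto simp: unit_reps_def)
    qed
    moreover have "\<alpha> - \<gamma> * u \<in> d" using submodule_onD(1)[OF D.m_sub] \<alpha>u by simp
    ultimately have "res_class \<alpha> = res_class u"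
      using res_class_eq_iff[OF \<alpha>(1) unit_gens[OF uU]] sg by blast
    then have "z = fmap (unit_class u)" using fmap_unit_class[OF uU] \<alpha>(2) by simp
    then show "z \<in> fmap ` carrier Agrp" unfolding carrier_Agrp using uU by blast
  qed
qed

text \<open>The contraction of \<open>\<alpha>\<close> extends back to \<open>\<alpha> Ok'\<close>,
  which is trivial for \<open>m'\<close>. Conversely, a class in the kernel is represented by an
  integral \<open>a\<close> coprime to \<open>d\<close> whose extension is generated by a ray
  element \<open>\<delta>\<close>; integrality and coprimality of \<open>a\<close> put
  \<open>\<delta>\<close> into \<open>gens\<close>, and \<open>a\<close> is its contraction.\<close>

lemma image_boundary: "boundary ` carrier Bgrp = kernel Cgrp Dgrp hmap"
proof
  show "boundary ` carrier Bgrp \<subseteq> kernel Cgrp Dgrp hmap"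
  proof
    fix c assume "c \<in> boundary ` carrier Bgrp"
    then obtain \<alpha> where \<alpha>: "\<alpha> \<in> gens" "c = ray_class (contraction \<alpha>)"
      using res_class_surj boundary_res_class by fastforce
    have J: "contraction \<alpha> \<in> Jstar Ok m" using contraction_J \<alpha> by blast
    have "\<alpha> / 1 \<in> B.ray_elements \<Sigma>'"
      using gensD[OF \<alpha>(1)] B.one_cong_one by (intro B.ray_elementsI) (auto simp: cong_one_def)
    then have "\<alpha> \<in> B.ray_elements \<Sigma>'" by simp
    then have "ray_class' (mprod (contraction \<alpha>) Ok') = ray_class' Ok'"
      using B.Pray_coset_eq_iff[OF embs' J_extend[OF J] B.R_in_J] contraction_extend[OF \<alpha>(1)] by blast
    then have "hmap c = \<one>\<^bsub>Dgrp\<^esub>"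
      using hmap_ray_class[OF J] \<alpha>(2) by (simp add: B.one_ray_class_group[OF embs'])
    moreover have "c \<in> carrier Cgrp" using J \<alpha>(2) by (simp add: A.carrier_ray_class_group[OF embs])
    ultimately show "c \<in> kernel Cgrp Dgrp hmap" unfolding kernel_def by blast
  qed
  show "kernel Cgrp Dgrp hmap \<subseteq> boundary ` carrier Bgrp"
  proof
    fix c assume "c \<in> kernel Cgrp Dgrp hmap"
    then have "c \<in> carrier Cgrp" and h: "hmap c = \<one>\<^bsub>Dgrp\<^esub>" unfolding kernel_def by auto
    then obtain a0 where a0: "a0 \<in> Jstar Ok m" "c = ray_class a0"
      by (auto simp: A.carrier_ray_class_group[OF embs])
    obtain \<gamma> where \<gamma>: "\<gamma> \<in> A.ray_elements \<Sigma>" "(*) \<gamma> ` a0 \<in> Jstar Ok d" "(*) \<gamma> ` a0 \<subseteq> Ok"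
      using move_Ok[OF a0(1)] by blast
    define a where "a = (*) \<gamma> ` a0"
    have a: "a \<in> Jstar Ok d" "a \<subseteq> Ok" "a \<in> Jstar Ok m" using \<gamma> J_d_m by (auto simp: a_def)
    have c: "c = ray_class a"
      using A.Pray_coset_eq_iff[OF embs a(3) a0(1)] \<gamma>(1) a_def a0(2) by blast
    have "ray_class' (mprod a Ok') = ray_class' Ok'"
      using h hmap_ray_class[OF a(3)] c by (simp add: B.one_ray_class_group[OF embs'])
    then obtain \<delta> where \<delta>: "\<delta> \<in> B.ray_elements \<Sigma>'" "mprod a Ok' = (*) \<delta> ` Ok'"
      using B.Pray_coset_eq_iff[OF embs' J_extend[OF a(3)] B.R_in_J] by blast
    have "mprod a Ok' \<subseteq> Ok'"
      using a(2) Ok_le by (intro mprod_subsetI) (auto intro: B.mult_mem B.zero_mem B.add_mem)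
    moreover have "\<delta> * 1 \<in> mprod a Ok'" unfolding \<delta>(2) using B.one_mem by (rule imageI)
    ultimately have \<delta>O: "\<delta> \<in> Ok'" by auto
    have \<delta>m: "\<delta> - 1 \<in> m'" by (rule B.ray_elements_cong_one[OF \<delta>(1) \<delta>O])
    obtain t where t: "t \<in> cong_one d" "t \<in> a" using a(1) by (auto simp: E.Jstar_iff)
    then have "t * 1 \<in> mprod a Ok'" using B.one_mem by (intro mprodI)
    then obtain y where "y \<in> Ok'" "\<delta> * y - 1 \<in> d" using t(1) unfolding \<delta>(2) by (auto simp: cong_one_def)
    then have \<delta>g: "\<delta> \<in> gens"
      using \<delta>O \<delta>m B.ray_elements_nonzero[OF \<delta>(1)] B.ray_elements_pos[OF \<delta>(1)]
      by (auto simp: gens_def unit_reps_def)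
    have "contraction \<delta> = a" unfolding contraction_def \<delta>(2)[symmetric] by (rule extend_contract[OF a(1,2)])
    then have "c = boundary (res_class \<delta>)" by (simp add: c boundary_res_class[OF \<delta>g])
    then show "c \<in> boundary ` carrier Bgrp" using res_class_in[OF \<delta>g] by blast
  qed
qed

lemma hmap_surj: "hmap ` carrier Cgrp = carrier Dgrp"
proof
  show "hmap ` carrier Cgrp \<subseteq> carrier Dgrp" using hmap_hom by (auto simp: hom_def)
  show "carrier Dgrp \<subseteq> hmap ` carrier Cgrp"
  proof
    fix z assume "z \<in> carrier Dgrp"
    then obtain b0 where b0: "b0 \<in> Jstar Ok' m'" "z = ray_class' b0"
      by (auto simp: B.carrier_ray_class_group[OF embs'])
    obtain \<gamma> where \<gamma>: "\<gamma> \<in> B.ray_elements \<Sigma>'" "(*) \<gamma> ` b0 \<in> Jstar Ok' d" "(*) \<gamma> ` b0 \<subseteq> Ok'"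
      using move_Ok'[OF b0(1)] by blast
    define b where "b = (*) \<gamma> ` b0"
    have b: "b \<in> Jstar Ok' d" "b \<subseteq> Ok'" using \<gamma> by (auto simp: b_def)
    obtain t where t: "submodule_on Ok' b" "t \<in> b" "t - 1 \<in> d"
      using b(1) by (auto simp: D.Jstar_iff cong_one_def)
    have J: "b \<inter> Ok \<in> Jstar Ok m" using contract_in_J[OF b] J_d_m by blast
    have "hmap (ray_class (b \<inter> Ok)) = ray_class' b"
      unfolding hmap_ray_class[OF J] contract_extend[OF t(1) b(2) t(2,3)] ..
    also have "\<dots> = z"
      using B.Pray_coset_eq_iff[OF embs' B.J_scale[OF embs' \<gamma>(1) b0(1)] b0(1)] \<gamma>(1) b_def b0(2) by blast
    finally show "z \<in> hmap ` carrier Cgrp"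
      using J by (auto simp: A.carrier_ray_class_group[OF embs])
  qed
qed

end

theorem theorem6p5:
  fixes Ok Ok' m m' d :: "'k::field_char_0 set"
    and \<Sigma> \<Sigma>' :: "('k \<Rightarrow> real) set"
  assumes "number_field TYPE('k)"
    and "level_datum Ok m \<Sigma>" and "level_datum Ok' m' \<Sigma>'"
    and "Ok \<subseteq> Ok'" and "mprod m Ok' \<subseteq> m'" and "\<Sigma>' \<subseteq> \<Sigma>"
    and "is_ideal Ok' d" and "d \<noteq> {0}" and "d \<subseteq> colon m Ok'"
  shows "\<exists>g.
    let A = kgrp (Ugrp_set Ok' m' \<Sigma>') Mod Ugrp_set Ok m \<Sigma>;
        B = (resgrp d (resU Ok' d m') Mod resU Ok d m) \<times>\<times> sign_grp (\<Sigma> - \<Sigma>');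
        C = ray_class_group Ok m \<Sigma>;
        D = ray_class_group Ok' m' \<Sigma>';
        f = unit_map Ok' m' Ok m d \<Sigma> \<Sigma>';
        h = ext_map Ok' m' \<Sigma>'
    in f \<in> hom A B \<and> g \<in> hom B C \<and> h \<in> hom C D
       \<and> kernel A B f = {\<one>\<^bsub>A\<^esub>}
       \<and> f ` carrier A = kernel B C g
       \<and> g ` carrier B = kernel C D h
       \<and> h ` carrier C = carrier D"
proof -
  have R: "field_subring Ok" "field_subring Ok'"
    using assms(2,3) order_field_subring by (auto simp: level_datum_def)
  then have one: "1 \<in> Ok'" by (simp add: field_subring.one_mem)
  \<comment> \<open>Both inclusions come from evaluating the hypotheses at
    \<open>1 \<in> Ok'\<close>.\<close>
  have "d \<subseteq> m" using assms(9) one by (force simp: colon_def)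
  moreover have "m \<subseteq> m'" using assms(5) mprodI[OF _ one] by fastforce
  ultimately interpret level_extension Ok m Ok' m' d \<Sigma> \<Sigma>'
    using R assms
    by (auto simp: level_datum_def level_extension_def level_extension_axioms_def level_pair_def
        level_pair_axioms_def ring_ideal_def ring_ideal_axioms_def)
  show ?thesis
    unfolding Let_def
    using fmap_hom boundary_hom hmap_hom kernel_fmap image_fmap image_boundary hmap_surj by blast
qed

end
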